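(* (In $\mathbf{ZF}$.) Let $\mathbf{X}$ be a non-empty zero-dimensional $T_1$-space for which the Banaschewski compactification $\beta_0\mathbf{X}$ exists. Let $\mathbf{Y}$ be a non-empty Tychonoff space. Then the following conditions are satisfied: (i) if the rings $U_{\aleph_0}^{\ast}(\mathbf{X})$ and $C(\mathbf{Y})$ are isomorphic, then the maximal Tychonoff compactification $\beta_T\mathbf{Y}$ exists and, moreover, the spaces $\beta_0\mathbf{X}$ and $\beta_T\mathbf{Y}$ are homeomorphic; (ii) $\mathbf{CMC}$ implies that if the rings $U_{\aleph_0}(\mathbf{X})$ and $C(\mathbf{Y})$ are isomorphic, then $\beta_T\mathbf{Y}$ exists and, moreover, the spaces $\beta_0\mathbf{X}$ and $\beta_T\mathbf{Y}$ are homeomorphic.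
   Context: The base theory is $\mathbf{ZF}$ (the Axiom of Choice is not assumed). $\mathbf{CMC}$ is the statement: for every family $\{A_n:n\in\omega\}$ of non-empty sets there is a function assigning to each $n\in\omega$ a non-empty finite subset of $A_n$. A space is compact if every open cover has a finite subcover; zero-dimensional if its clopen sets form a base; Tychonoff if it is $T_1$ and the complements of zero-sets of continuous real functions form a base. A compactification of $\mathbf{X}$ is a pair $\langle\alpha\mathbf{X},\alpha\rangle$ with $\alpha\mathbf{X}$ compact and $\alpha:\mathbf{X}\to\alpha\mathbf{X}$ a homeomorphic embedding with dense image. A Banaschewski compactification of a zero-dimensional $T_1$-space $\mathbf{X}$ is a zero-dimensional $T_1$-compactification $\beta_0\mathbf{X}$ such that for every compact zero-dimensional $T_1$-space $\mathbf{K}$ and every continuous $f:\mathbf{X}\to\mathbf{K}$ there is a continuous $\tilde f:\beta_0\mathbf{X}\to\mathbf{K}$ with $\tilde f\circ\beta_0=f$. A maximal Tychonoff compactification of a Tychonoff space $\mathbf{Y}$ is a Tychonoff compactification $\beta_T\mathbf{Y}$ such that for every compact Tychonoff space $\mathbf{K}$ and every continuous $f:\mathbf{Y}\to\mathbf{K}$ there is a continuous $\tilde f:\beta_T\mathbf{Y}\to\mathbf{K}$ with $\tilde f\circ\beta_T=f$. $C(\mathbf{X})$ is the ring of continuous real functions on $\mathbf{X}$ and $C^{\ast}(\mathbf{X})$ the subring of bounded ones. For $A\subseteq X$, $\mathrm{osc}_A(f)=\sup\{|f(x)-f(y)|:x,y\in A\}$ if $A\neq\emptyset$ and $\mathrm{osc}_\emptyset(f)=0$.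 $U_{\aleph_0}(\mathbf{X})$ is the subring of all $f\in C(\mathbf{X})$ such that for every real $\varepsilon>0$ there is a countable (equipotent to a subset of $\omega$) family $\mathcal{A}$ of clopen subsets of $\mathbf{X}$ with $\bigcup\mathcal{A}=X$ and $\mathrm{osc}_A(f)\leq\varepsilon$ for every $A\in\mathcal{A}$; $U_{\aleph_0}^{\ast}(\mathbf{X})=U_{\aleph_0}(\mathbf{X})\cap C^{\ast}(\mathbf{X})$. *)

theory Defs
  imports Main
begin

text \<open>
  The meta-logic HOL has a choice operator, so a result of ZF without choice cannot be expressed by
  reading ``set'' as ``HOL set''.  Here it is expressed as truth in every first-order model of ZF:
  a type \<open>'v\<close> with a binary relation \<open>mem\<close> satisfying the axioms of ZF, with Separation and
  Replacement for first-order formulas only.  (Schemas over arbitrary HOL predicates would import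
  the choice principle of HOL into the model.)  All mathematical objects below are elements
  of the model; HOL sets over \<open>'v\<close> serve only as notation for first-order definable classes.
\<close>

section \<open>Models of ZF\<close>

datatype zf_fm = Zf_Mem nat nat | Zf_Eq nat nat | Zf_Neg zf_fm | Zf_And zf_fm zf_fm | Zf_Ex nat zf_fm

primrec zf_sat :: "('v \<Rightarrow> 'v \<Rightarrow> bool) \<Rightarrow> zf_fm \<Rightarrow> (nat \<Rightarrow> 'v) \<Rightarrow> bool" where
  "zf_sat mem (Zf_Mem i j) s \<longleftrightarrow> mem (s i) (s j)"
| "zf_sat mem (Zf_Eq i j) s \<longleftrightarrow> s i = s j"
| "zf_sat mem (Zf_Neg p) s \<longleftrightarrow> \<not> zf_sat mem p s"
| "zf_sat mem (Zf_And p q) s \<longleftrightarrow> zf_sat mem p s \<and> zf_sat mem q s"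
| "zf_sat mem (Zf_Ex i p) s \<longleftrightarrow> (\<exists>a. zf_sat mem p (s(i := a)))"

definition zf_elts :: "('v \<Rightarrow> 'v \<Rightarrow> bool) \<Rightarrow> 'v \<Rightarrow> 'v set" where
  "zf_elts mem A = {x. mem x A}"

text \<open>In the two schemas the values of the assignment \<open>s\<close> at the remaining variables are the parameters.\<close>

locale zf_model =
  fixes mem :: "'v \<Rightarrow> 'v \<Rightarrow> bool"
  assumes Extensionality: "\<And>A B. zf_elts mem A = zf_elts mem B \<Longrightarrow> A = B"
    and Foundation: "\<And>A. zf_elts mem A \<noteq> {} \<Longrightarrow> \<exists>x\<in>zf_elts mem A. zf_elts mem x \<inter> zf_elts mem A = {}"
    and Pairing: "\<And>a b. \<exists>c. zf_elts mem c = {a, b}"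
    and Union: "\<And>A. \<exists>u. zf_elts mem u = (\<Union>x\<in>zf_elts mem A. zf_elts mem x)"
    and Powerset: "\<And>A. \<exists>p. zf_elts mem p = {x. zf_elts mem x \<subseteq> zf_elts mem A}"
    and Infinity: "\<exists>I. (\<exists>e\<in>zf_elts mem I. zf_elts mem e = {}) \<and>
      (\<forall>x\<in>zf_elts mem I. \<exists>y\<in>zf_elts mem I. zf_elts mem y = insert x (zf_elts mem x))"
    and Separation: "\<And>p s A. \<exists>B. zf_elts mem B = {x \<in> zf_elts mem A. zf_sat mem p (s(0 := x))}"
    and Replacement: "\<And>p s A.
      (\<And>x y z. x \<in> zf_elts mem A \<Longrightarrow> zf_sat mem p (s(0 := x, 1 := y)) \<Longrightarrow>
        zf_sat mem p (s(0 := x, 1 := z)) \<Longrightarrow> y = z) \<Longrightarrow>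
      \<exists>B. zf_elts mem B = {y. \<exists>x\<in>zf_elts mem A. zf_sat mem p (s(0 := x, 1 := y))}"

section \<open>Basic set theory inside a model\<close>

text \<open>Spaces and real number systems in the model.  These are mere tuples; the laws are stated below.\<close>

datatype 'v zf_space = Zf_Space (zf_pts: 'v) (zf_opens: 'v)

datatype 'v zf_reals =
  Zf_Reals (zf_R: 'v) (zf_zero: 'v) (zf_one: 'v) (zf_add: 'v) (zf_mul: 'v) (zf_less: 'v)

context
  fixes mem :: "'v \<Rightarrow> 'v \<Rightarrow> bool"
begin

abbreviation elts :: "'v \<Rightarrow> 'v set" where
  "elts \<equiv> zf_elts mem"

text \<open>The element of the model with extension \<open>S\<close>.  Below, \<open>S\<close> is always a class that ZF proves
  to be a set, so that the description is proper in every model.\<close>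

definition zf_set :: "'v set \<Rightarrow> 'v" where
  "zf_set S = (THE a. elts a = S)"

definition zf_pair :: "'v \<Rightarrow> 'v \<Rightarrow> 'v" where
  "zf_pair a b = zf_set {zf_set {a}, zf_set {a, b}}"

definition zf_Union :: "'v \<Rightarrow> 'v" where
  "zf_Union A = zf_set (\<Union>x\<in>elts A. elts x)"

definition zf_prod :: "'v \<Rightarrow> 'v \<Rightarrow> 'v" where
  "zf_prod A B = zf_set {zf_pair a b | a b. a \<in> elts A \<and> b \<in> elts B}"

definition zf_fun :: "'v \<Rightarrow> 'v \<Rightarrow> 'v \<Rightarrow> bool" where
  "zf_fun A B f \<longleftrightarrow> elts f \<subseteq> elts (zf_prod A B) \<and> (\<forall>a\<in>elts A. \<exists>!b. zf_pair a b \<in> elts f)"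

definition zf_app :: "'v \<Rightarrow> 'v \<Rightarrow> 'v" where
  "zf_app f a = (THE b. zf_pair a b \<in> elts f)"

definition zf_image :: "'v \<Rightarrow> 'v \<Rightarrow> 'v" where
  "zf_image f A = zf_set (zf_app f ` elts A)"

definition zf_bij :: "'v \<Rightarrow> 'v \<Rightarrow> 'v \<Rightarrow> bool" where
  "zf_bij A B f \<longleftrightarrow> zf_fun A B f \<and> bij_betw (zf_app f) (elts A) (elts B)"

definition zf_inductive :: "'v \<Rightarrow> bool" where
  "zf_inductive I \<longleftrightarrow> zf_set {} \<in> elts I \<and> (\<forall>x\<in>elts I. zf_set (insert x (elts x)) \<in> elts I)"

definition zf_omega :: 'v where
  "zf_omega = zf_set {n. \<forall>I. zf_inductive I \<longrightarrow> n \<in> elts I}"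

text \<open>Finiteness and countability in the sense of the model; its \<open>\<omega>\<close> may be non-standard.\<close>

definition zf_finite :: "'v \<Rightarrow> bool" where
  "zf_finite A \<longleftrightarrow> (\<exists>n\<in>elts zf_omega. \<exists>f. zf_bij A n f)"

definition zf_countable :: "'v \<Rightarrow> bool" where
  "zf_countable A \<longleftrightarrow> (\<exists>B f. elts B \<subseteq> elts zf_omega \<and> zf_bij A B f)"

definition zf_CMC :: bool where
  "zf_CMC \<longleftrightarrow>
    (\<forall>A B. zf_fun zf_omega B A \<and> (\<forall>n\<in>elts zf_omega. elts (zf_app A n) \<noteq> {}) \<longrightarrow>
      (\<exists>F C. zf_fun zf_omega C F \<and>
        (\<forall>n\<in>elts zf_omega. elts (zf_app F n) \<noteq> {} \<and> zf_finite (zf_app F n) \<and>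
          elts (zf_app F n) \<subseteq> elts (zf_app A n))))"

section \<open>Topological spaces inside a model\<close>

definition zf_topological :: "'v zf_space \<Rightarrow> bool" where
  "zf_topological S \<longleftrightarrow>
    (\<forall>U\<in>elts (zf_opens S). elts U \<subseteq> elts (zf_pts S)) \<and>
    zf_set {} \<in> elts (zf_opens S) \<and> zf_pts S \<in> elts (zf_opens S) \<and>
    (\<forall>U\<in>elts (zf_opens S). \<forall>V\<in>elts (zf_opens S). zf_set (elts U \<inter> elts V) \<in> elts (zf_opens S)) \<and>
    (\<forall>C. elts C \<subseteq> elts (zf_opens S) \<longrightarrow> zf_Union C \<in> elts (zf_opens S))"

definition zf_nonempty :: "'v zf_space \<Rightarrow> bool" where
  "zf_nonempty S \<longleftrightarrow> elts (zf_pts S) \<noteq> {}"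

definition zf_clopen :: "'v zf_space \<Rightarrow> 'v \<Rightarrow> bool" where
  "zf_clopen S A \<longleftrightarrow> A \<in> elts (zf_opens S) \<and> zf_set (elts (zf_pts S) - elts A) \<in> elts (zf_opens S)"

definition zf_base :: "'v zf_space \<Rightarrow> 'v set \<Rightarrow> bool" where
  "zf_base S \<B> \<longleftrightarrow> \<B> \<subseteq> elts (zf_opens S) \<and>
    (\<forall>U\<in>elts (zf_opens S). \<exists>C. elts C \<subseteq> \<B> \<and> U = zf_Union C)"

definition zf_T1 :: "'v zf_space \<Rightarrow> bool" where
  "zf_T1 S \<longleftrightarrow> (\<forall>x\<in>elts (zf_pts S). \<forall>y\<in>elts (zf_pts S). x \<noteq> y \<longrightarrow>
    (\<exists>U\<in>elts (zf_opens S). x \<in> elts U \<and> y \<notin> elts U))"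

definition zf_zero_dimensional :: "'v zf_space \<Rightarrow> bool" where
  "zf_zero_dimensional S \<longleftrightarrow> zf_base S {A. zf_clopen S A}"

definition zf_compact :: "'v zf_space \<Rightarrow> bool" where
  "zf_compact S \<longleftrightarrow>
    (\<forall>C. elts C \<subseteq> elts (zf_opens S) \<and> zf_Union C = zf_pts S \<longrightarrow>
      (\<exists>D. elts D \<subseteq> elts C \<and> zf_finite D \<and> zf_Union D = zf_pts S))"

definition zf_continuous :: "'v zf_space \<Rightarrow> 'v zf_space \<Rightarrow> 'v \<Rightarrow> bool" where
  "zf_continuous S T f \<longleftrightarrow> zf_fun (zf_pts S) (zf_pts T) f \<and>
    (\<forall>V\<in>elts (zf_opens T). zf_set {x \<in> elts (zf_pts S). zf_app f x \<in> elts V} \<in> elts (zf_opens S))"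

definition zf_homeomorphism :: "'v zf_space \<Rightarrow> 'v zf_space \<Rightarrow> 'v \<Rightarrow> bool" where
  "zf_homeomorphism S T f \<longleftrightarrow> zf_continuous S T f \<and>
    (\<exists>g. zf_continuous T S g \<and>
      (\<forall>x\<in>elts (zf_pts S). zf_app g (zf_app f x) = x) \<and>
      (\<forall>y\<in>elts (zf_pts T). zf_app f (zf_app g y) = y))"

definition zf_homeomorphic :: "'v zf_space \<Rightarrow> 'v zf_space \<Rightarrow> bool" where
  "zf_homeomorphic S T \<longleftrightarrow> (\<exists>f. zf_homeomorphism S T f)"

definition zf_subspace :: "'v zf_space \<Rightarrow> 'v \<Rightarrow> 'v zf_space" where
  "zf_subspace S A = Zf_Space A (zf_set {zf_set (elts U \<inter> elts A) | U. U \<in> elts (zf_opens S)})"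

definition zf_embedding :: "'v zf_space \<Rightarrow> 'v zf_space \<Rightarrow> 'v \<Rightarrow> bool" where
  "zf_embedding S T f \<longleftrightarrow> zf_fun (zf_pts S) (zf_pts T) f \<and>
    zf_homeomorphism S (zf_subspace T (zf_image f (zf_pts S))) f"

definition zf_dense :: "'v zf_space \<Rightarrow> 'v \<Rightarrow> bool" where
  "zf_dense S A \<longleftrightarrow> elts A \<subseteq> elts (zf_pts S) \<and>
    (\<forall>U\<in>elts (zf_opens S). elts U \<noteq> {} \<longrightarrow> elts U \<inter> elts A \<noteq> {})"

definition zf_compactification :: "'v zf_space \<Rightarrow> 'v zf_space \<Rightarrow> 'v \<Rightarrow> bool" where
  "zf_compactification X Z b \<longleftrightarrow> zf_topological Z \<and> zf_compact Z \<and>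
    zf_embedding X Z b \<and> zf_dense Z (zf_image b (zf_pts X))"

definition zf_extends_to :: "'v zf_space \<Rightarrow> 'v zf_space \<Rightarrow> 'v \<Rightarrow> 'v zf_space \<Rightarrow> bool" where
  "zf_extends_to X Z b K \<longleftrightarrow>
    (\<forall>f. zf_continuous X K f \<longrightarrow>
      (\<exists>g. zf_continuous Z K g \<and> (\<forall>x\<in>elts (zf_pts X). zf_app g (zf_app b x) = zf_app f x)))"

definition zf_Banaschewski :: "'v zf_space \<Rightarrow> 'v zf_space \<Rightarrow> 'v \<Rightarrow> bool" where
  "zf_Banaschewski X Z b \<longleftrightarrow> zf_compactification X Z b \<and> zf_zero_dimensional Z \<and> zf_T1 Z \<and>
    (\<forall>K. zf_topological K \<and> zf_compact K \<and> zf_zero_dimensional K \<and> zf_T1 K \<longrightarrow>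
      zf_extends_to X Z b K)"

section \<open>The reals of the model\<close>

text \<open>ZF proves that a Dedekind-complete ordered field exists and is unique up to isomorphism.
  Instead of fixing one construction, everything takes such a field \<open>\<R>\<close> of the model
  as a parameter.  Its elements need not correspond to HOL reals.\<close>

context
  fixes \<R> :: "'v zf_reals"
begin

definition zf_plus :: "'v \<Rightarrow> 'v \<Rightarrow> 'v" where
  "zf_plus x y = zf_app (zf_add \<R>) (zf_pair x y)"

definition zf_times :: "'v \<Rightarrow> 'v \<Rightarrow> 'v" where
  "zf_times x y = zf_app (zf_mul \<R>) (zf_pair x y)"

definition zf_lt :: "'v \<Rightarrow> 'v \<Rightarrow> bool" where
  "zf_lt x y \<longleftrightarrow> zf_pair x y \<in> elts (zf_less \<R>)"

definition zf_le :: "'v \<Rightarrow> 'v \<Rightarrow> bool" where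
  "zf_le x y \<longleftrightarrow> zf_lt x y \<or> x = y"

definition zf_minus :: "'v \<Rightarrow> 'v \<Rightarrow> 'v" where
  "zf_minus x y = (THE z. z \<in> elts (zf_R \<R>) \<and> zf_plus z y = x)"

definition zf_abs :: "'v \<Rightarrow> 'v" where
  "zf_abs x = (if zf_lt x (zf_zero \<R>) then zf_minus (zf_zero \<R>) x else x)"

definition zf_is_sup :: "'v set \<Rightarrow> 'v \<Rightarrow> bool" where
  "zf_is_sup D s \<longleftrightarrow> s \<in> elts (zf_R \<R>) \<and> (\<forall>x\<in>D. zf_le x s) \<and>
    (\<forall>t\<in>elts (zf_R \<R>). (\<forall>x\<in>D. zf_le x t) \<longrightarrow> zf_le s t)"

definition zf_complete_ordered_field :: bool where
  "zf_complete_ordered_field \<longleftrightarrow>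
    (let R = elts (zf_R \<R>); zero = zf_zero \<R>; one = zf_one \<R> in
      zf_fun (zf_prod (zf_R \<R>) (zf_R \<R>)) (zf_R \<R>) (zf_add \<R>) \<and>
      zf_fun (zf_prod (zf_R \<R>) (zf_R \<R>)) (zf_R \<R>) (zf_mul \<R>) \<and>
      elts (zf_less \<R>) \<subseteq> elts (zf_prod (zf_R \<R>) (zf_R \<R>)) \<and>
      zero \<in> R \<and> one \<in> R \<and> zero \<noteq> one \<and>
      (\<forall>x\<in>R. \<forall>y\<in>R. \<forall>z\<in>R. zf_plus (zf_plus x y) z = zf_plus x (zf_plus y z)) \<and>
      (\<forall>x\<in>R. \<forall>y\<in>R. zf_plus x y = zf_plus y x) \<and>
      (\<forall>x\<in>R. zf_plus zero x = x) \<and>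
      (\<forall>x\<in>R. \<exists>y\<in>R. zf_plus x y = zero) \<and>
      (\<forall>x\<in>R. \<forall>y\<in>R. \<forall>z\<in>R. zf_times (zf_times x y) z = zf_times x (zf_times y z)) \<and>
      (\<forall>x\<in>R. \<forall>y\<in>R. zf_times x y = zf_times y x) \<and>
      (\<forall>x\<in>R. zf_times one x = x) \<and>
      (\<forall>x\<in>R. x \<noteq> zero \<longrightarrow> (\<exists>y\<in>R. zf_times x y = one)) \<and>
      (\<forall>x\<in>R. \<forall>y\<in>R. \<forall>z\<in>R. zf_times x (zf_plus y z) = zf_plus (zf_times x y) (zf_times x z)) \<and>
      (\<forall>x\<in>R. \<not> zf_lt x x) \<and>
      (\<forall>x\<in>R. \<forall>y\<in>R. \<forall>z\<in>R. zf_lt x y \<and> zf_lt y z \<longrightarrow> zf_lt x z) \<and>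
      (\<forall>x\<in>R. \<forall>y\<in>R. zf_lt x y \<or> x = y \<or> zf_lt y x) \<and>
      (\<forall>x\<in>R. \<forall>y\<in>R. \<forall>z\<in>R. zf_lt x y \<longrightarrow> zf_lt (zf_plus x z) (zf_plus y z)) \<and>
      (\<forall>x\<in>R. \<forall>y\<in>R. zf_lt zero x \<and> zf_lt zero y \<longrightarrow> zf_lt zero (zf_times x y)) \<and>
      (\<forall>D. elts D \<subseteq> R \<and> elts D \<noteq> {} \<and> (\<exists>u\<in>R. \<forall>x\<in>elts D. zf_le x u) \<longrightarrow>
        (\<exists>s. zf_is_sup (elts D) s)))"

definition zf_real_line :: "'v zf_space" where
  "zf_real_line = Zf_Space (zf_R \<R>)
    (zf_set {U. elts U \<subseteq> elts (zf_R \<R>) \<and>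
      (\<forall>x\<in>elts U. \<exists>a\<in>elts (zf_R \<R>). \<exists>b\<in>elts (zf_R \<R>). zf_lt a x \<and> zf_lt x b \<and>
        (\<forall>y\<in>elts (zf_R \<R>). zf_lt a y \<and> zf_lt y b \<longrightarrow> y \<in> elts U))})"

section \<open>Rings of functions and compactifications\<close>

definition zf_C :: "'v zf_space \<Rightarrow> 'v" where
  "zf_C S = zf_set {f. zf_continuous S zf_real_line f}"

definition zf_bounded :: "'v zf_space \<Rightarrow> 'v \<Rightarrow> bool" where
  "zf_bounded S f \<longleftrightarrow>
    (\<exists>m\<in>elts (zf_R \<R>). \<forall>x\<in>elts (zf_pts S). zf_le (zf_abs (zf_app f x)) m)"

definition zf_cozero_set :: "'v zf_space \<Rightarrow> 'v \<Rightarrow> 'v" where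
  "zf_cozero_set S f = zf_set {x \<in> elts (zf_pts S). zf_app f x \<noteq> zf_zero \<R>}"

definition zf_Tychonoff :: "'v zf_space \<Rightarrow> bool" where
  "zf_Tychonoff S \<longleftrightarrow> zf_T1 S \<and> zf_base S (zf_cozero_set S ` elts (zf_C S))"

definition zf_max_Tychonoff_compactification :: "'v zf_space \<Rightarrow> 'v zf_space \<Rightarrow> 'v \<Rightarrow> bool" where
  "zf_max_Tychonoff_compactification Y W t \<longleftrightarrow> zf_compactification Y W t \<and> zf_Tychonoff W \<and>
    (\<forall>K. zf_topological K \<and> zf_compact K \<and> zf_Tychonoff K \<longrightarrow> zf_extends_to Y W t K)"

text \<open>The oscillation is a partial notion: it has no value in the reals if the supremum is infinite.\<close>

definition zf_is_osc :: "'v \<Rightarrow> 'v \<Rightarrow> 'v \<Rightarrow> bool" where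
  "zf_is_osc A f s \<longleftrightarrow>
    (if elts A = {} then s = zf_zero \<R>
     else zf_is_sup {zf_abs (zf_minus (zf_app f x) (zf_app f y)) | x y. x \<in> elts A \<and> y \<in> elts A} s)"

definition zf_U :: "'v zf_space \<Rightarrow> 'v" where
  "zf_U S = zf_set {f \<in> elts (zf_C S).
    \<forall>e\<in>elts (zf_R \<R>). zf_lt (zf_zero \<R>) e \<longrightarrow>
      (\<exists>\<A>. zf_countable \<A> \<and> (\<forall>A\<in>elts \<A>. zf_clopen S A) \<and> zf_Union \<A> = zf_pts S \<and>
        (\<forall>A\<in>elts \<A>. \<exists>s. zf_is_osc A f s \<and> zf_le s e))}"

definition zf_U_bounded :: "'v zf_space \<Rightarrow> 'v" where
  "zf_U_bounded S = zf_set {f \<in> elts (zf_U S). zf_bounded S f}"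

definition zf_is_sum :: "'v zf_space \<Rightarrow> 'v \<Rightarrow> 'v \<Rightarrow> 'v \<Rightarrow> bool" where
  "zf_is_sum S f g k \<longleftrightarrow>
    (\<forall>x\<in>elts (zf_pts S). zf_app k x = zf_plus (zf_app f x) (zf_app g x))"

definition zf_is_product :: "'v zf_space \<Rightarrow> 'v \<Rightarrow> 'v \<Rightarrow> 'v \<Rightarrow> bool" where
  "zf_is_product S f g k \<longleftrightarrow>
    (\<forall>x\<in>elts (zf_pts S). zf_app k x = zf_times (zf_app f x) (zf_app g x))"

text \<open>\<open>P\<close> and \<open>Q\<close> are rings, under the pointwise operations, of real functions on \<open>X\<close> and on \<open>Y\<close>.\<close>

definition zf_ring_isomorphic :: "'v zf_space \<Rightarrow> 'v \<Rightarrow> 'v zf_space \<Rightarrow> 'v \<Rightarrow> bool" where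
  "zf_ring_isomorphic X P Y Q \<longleftrightarrow>
    (\<exists>h. zf_bij P Q h \<and>
      (\<forall>f\<in>elts P. \<forall>g\<in>elts P. \<forall>k\<in>elts P.
        (zf_is_sum X f g k \<longrightarrow> zf_is_sum Y (zf_app h f) (zf_app h g) (zf_app h k)) \<and>
        (zf_is_product X f g k \<longrightarrow> zf_is_product Y (zf_app h f) (zf_app h g) (zf_app h k))))"

end

end

end

theory Submission
  imports Defs
begin

text \<open>Write \<open>Z\<close> for the Banaschewski compactification of \<open>X\<close>, \<open>P\<close> for either of the two rings of functions
on \<open>X\<close>, and \<open>h\<close> for an isomorphism from \<open>P\<close> onto \<open>C(Y)\<close>.  The proof produces a map \<open>t\<close> from \<open>Y\<close> to \<open>Z\<close>
and shows that \<open>Z\<close> with \<open>t\<close> is a maximal Tychonoff compactification of \<open>Y\<close>; since any two of these are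
homeomorphic (\<open>max_Tychonoff_compactification_unique\<close>), both parts of the theorem follow.

The map comes from the idempotents.  A clopen subset of \<open>X\<close> is the trace of a clopen subset of \<open>Z\<close>, by the
universal property of \<open>Z\<close> applied to the two-point space (\<open>clopen_extends\<close>).  For a point \<open>y\<close> of \<open>Y\<close>, the
clopen sets \<open>A\<close> of \<open>Z\<close> for which \<open>h\<close> sends the characteristic function of the trace of \<open>A\<close> to a function
with value 1 at \<open>y\<close> form an ultrafilter of the Boolean algebra of clopen sets.  It converges to exactly one
point \<open>t y\<close> because \<open>Z\<close> is compact, zero-dimensional and \<open>T\<^sub>1\<close> (\<open>point_exists\<close>).  The map \<open>t\<close> is
continuous by construction, and its image is dense because \<open>h\<close> is injective.

Everything else rests on \<open>separating_clopen\<close>: if \<open>g\<close> is continuous on \<open>Y\<close> and \<open>z\<close> is a point of \<open>Z\<close>, then \<open>z\<close> has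
a clopen neighbourhood \<open>A\<close> such that \<open>g\<close> omits the value 0 on the preimage of \<open>A\<close> under \<open>t\<close>, or omits the
value 1 there.  Let \<open>f\<close> be the member of \<open>P\<close> with image \<open>g\<close>.  A countable clopen cover on whose members
\<open>f\<close> oscillates little gives a clopen set \<open>C\<close> and a real \<open>q > 0\<close> with \<open>f \<ge> q\<close> on \<open>C\<close> and \<open>1 - f \<ge> q\<close> off \<open>C\<close>
(\<open>U_separation\<close>).  On \<open>C\<close> the function \<open>f\<close> is invertible within \<open>P\<close>, so \<open>g\<close> cannot vanish where the image of
the characteristic function of \<open>C\<close> is 1 (\<open>nonvanishing\<close>); off \<open>C\<close> the same holds for \<open>1 - f\<close> and \<open>1 - g\<close>.
Apart from this separation, the argument uses of \<open>P\<close> only that it contains the characteristic functions of clopen sets and is closed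
under composition with uniformly continuous functions that map bounded sets to bounded sets
(\<open>U_chi\<close>, \<open>U_unif\<close>), which is why it serves both rings at once.

In a Tychonoff space, a point and the complement of a neighbourhood of it are separated by a continuous
function that is constantly 0 near the point and constantly 1 near the complement
(\<open>Tychonoff_separation\<close>).  With such functions on \<open>Y\<close>, the key fact says that \<open>t\<close> is an embedding.  With such
functions on a compact Tychonoff space \<open>K\<close>, composed with a continuous map \<open>f\<close> from \<open>Y\<close> to \<open>K\<close>, it says that the
images under \<open>f\<close> of the traces of the clopen neighbourhoods of a point of \<open>Z\<close> cluster at a single point of
\<open>K\<close>, and sending the one point to the other extends \<open>f\<close> continuously to \<open>Z\<close> (\<open>rep_extension\<close>).

All of this happens inside an arbitrary model of ZF, where a set may be formed only by Separation for a
first-order formula.  The first section therefore isolates the definable predicates by closure rules,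
so that the definability of each set comprehension is checked by backward chaining.  No point of the proof
chooses: a set is always taken with all the witnesses there are, and values of functions are always unique.\<close>

section \<open>Definable classes of a structure\<close>

text \<open>A predicate on assignments is definable with parameters if it is the truth of a formula under the
assignment that carries the arguments at the even indices and the parameters at the odd ones.  The
interleaving leaves infinitely many indices of each kind, so that finitely many definitions can be merged by
renaming.\<close>

definition weave :: "(nat \<Rightarrow> 'a) \<Rightarrow> (nat \<Rightarrow> 'a) \<Rightarrow> nat \<Rightarrow> 'a" where
  "weave s t i = (if even i then s (i div 2) else t (i div 2))"

primrec fm_rename :: "(nat \<Rightarrow> nat) \<Rightarrow> zf_fm \<Rightarrow> zf_fm" where
  "fm_rename f (Zf_Mem i j) = Zf_Mem (f i) (f j)"
| "fm_rename f (Zf_Eq i j) = Zf_Eq (f i) (f j)"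
| "fm_rename f (Zf_Neg p) = Zf_Neg (fm_rename f p)"
| "fm_rename f (Zf_And p q) = Zf_And (fm_rename f p) (fm_rename f q)"
| "fm_rename f (Zf_Ex i p) = Zf_Ex (f i) (fm_rename f p)"

text \<open>The renaming also acts on bound variables.  Injectivity keeps an update of a bound variable from
disturbing any other variable.\<close>

lemma sat_fm_rename:
  assumes "inj f"
  shows "zf_sat mem (fm_rename f p) s = zf_sat mem p (\<lambda>i. s (f i))"
proof (induction p arbitrary: s)
  case (Zf_Ex i p)
  have "(\<lambda>j. (s(f i := a)) (f j)) = (\<lambda>j. s (f j))(i := a)" for a
    using assms by (auto simp: fun_eq_iff inj_eq)
  then show ?case using Zf_Ex by simp
qed auto

definition dfn :: "('v \<Rightarrow> 'v \<Rightarrow> bool) \<Rightarrow> ((nat \<Rightarrow> 'v) \<Rightarrow> bool) \<Rightarrow> bool" where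
  "dfn mem P \<longleftrightarrow> (\<exists>p t. \<forall>s. P s = zf_sat mem p (weave s t))"

text \<open>A term is definable if its graph is, with the value at index 0.  Indices count as in de Bruijn notation:
below a quantifier the bound variable is index 0 and every other index moves up by one.\<close>

definition trm :: "('v \<Rightarrow> 'v \<Rightarrow> bool) \<Rightarrow> ((nat \<Rightarrow> 'v) \<Rightarrow> 'v) \<Rightarrow> bool" where
  "trm mem t \<longleftrightarrow> dfn mem (\<lambda>s. s 0 = t (\<lambda>i. s (Suc i)))"

lemma dfn_rename:
  assumes "dfn mem P" "inj f"
  shows "dfn mem (\<lambda>s. P (\<lambda>i. s (f i)))"
proof -
  obtain p t where p: "\<And>s. P s = zf_sat mem p (weave s t)" using assms(1) unfolding dfn_def by blast
  define g where "g i = (if even i then 2 * f (i div 2) else i)" for i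
  have "inj g"
  proof (rule injI)
    fix i j assume eq: "g i = g j"
    have par: "even (g k) \<longleftrightarrow> even k" for k by (simp add: g_def)
    show "i = j"
    proof (cases "even i")
      case True
      then have "even j" using par[of i] par[of j] eq by simp
      then have "f (i div 2) = f (j div 2)" using True eq by (simp add: g_def)
      then have "i div 2 = j div 2" using assms(2) by (simp add: inj_eq)
      then show ?thesis using True \<open>even j\<close> by (metis dvd_mult_div_cancel)
    next
      case False
      then have "odd j" using par[of i] par[of j] eq by simp
      then show ?thesis using False eq by (simp add: g_def)
    qed
  qed
  moreover have "(\<lambda>i. weave s t (g i)) = weave (\<lambda>i. s (f i)) t" for s
    by (auto simp: fun_eq_iff weave_def g_def)
  ultimately have "P (\<lambda>i. s (f i)) = zf_sat mem (fm_rename g p) (weave s t)" for s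
    by (simp add: p sat_fm_rename)
  then show ?thesis unfolding dfn_def by blast
qed

lemma dfn_not: "dfn mem P \<Longrightarrow> dfn mem (\<lambda>s. \<not> P s)"
  unfolding dfn_def by (elim exE, rule_tac x = "Zf_Neg p" in exI, rule_tac x = t in exI) simp

text \<open>The parameters of the two conjuncts are interleaved once more, and the formulas are renamed so that
each of them reads its own parameters.\<close>

lemma dfn_and:
  assumes "dfn mem P" "dfn mem Q"
  shows "dfn mem (\<lambda>s. P s \<and> Q s)"
proof -
  obtain p t where p: "\<And>s. P s = zf_sat mem p (weave s t)" using assms(1) unfolding dfn_def by blast
  obtain q u where q: "\<And>s. Q s = zf_sat mem q (weave s u)" using assms(2) unfolding dfn_def by blast
  \<comment> \<open>the parameter at odd index \<open>2 k + 1\<close> moves to \<open>4 k + 1\<close> for the first formula, to \<open>4 k + 3\<close> for the second\<close>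
  define f where "f i = (if even i then i else i + 2 * (i div 2))" for i :: nat
  define g where "g i = (if even i then i else 2 * i + 1)" for i :: nat
  have "inj f"
  proof (rule injI)
    fix i j assume eq: "f i = f j"
    have par: "even (f k) \<longleftrightarrow> even k" for k by (simp add: f_def)
    show "i = j"
    proof (cases "even i")
      case True
      then show ?thesis using par[of i] par[of j] eq by (simp add: f_def)
    next
      case False
      then have "odd j" using par[of i] par[of j] eq by simp
      with False obtain k l where "i = 2 * k + 1" "j = 2 * l + 1" by (metis oddE)
      then show ?thesis using eq by (simp add: f_def)
    qed
  qed
  moreover have "inj g"
  proof (rule injI)
    fix i j assume eq: "g i = g j"
    have par: "even (g k) \<longleftrightarrow> even k" for k by (simp add: g_def)
    show "i = j"
    proof (cases "even i")
      case True
      then show ?thesis using par[of i] par[of j] eq by (simp add: g_def)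
    next
      case False
      then have "odd j" using par[of i] par[of j] eq by simp
      then show ?thesis using False eq by (simp add: g_def)
    qed
  qed
  moreover have "weave s (weave t u) (f i) = weave s t i" for s i
  proof (cases "even i")
    case False
    then obtain k where "i = 2 * k + 1" by (rule oddE)
    then show ?thesis by (simp add: weave_def f_def)
  qed (simp add: weave_def f_def)
  moreover have "weave s (weave t u) (g i) = weave s u i" for s i
    by (simp add: weave_def g_def)
  ultimately have "(P s \<and> Q s) = zf_sat mem (Zf_And (fm_rename f p) (fm_rename g q)) (weave s (weave t u))" for s
    by (simp only: p q sat_fm_rename zf_sat.simps)
  then show ?thesis unfolding dfn_def by (intro exI allI)
qed

text \<open>The bound variable takes the index of a parameter that is put in front of the others, so the free
variables return to the indices that they have outside the quantifier.\<close>

lemma dfn_ex: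
  assumes "dfn mem (\<lambda>s. P (s 0) (\<lambda>i. s (Suc i)))"
  shows "dfn mem (\<lambda>s. \<exists>x. P x s)"
proof -
  obtain p t where p: "\<And>s. P (s 0) (\<lambda>i. s (Suc i)) = zf_sat mem p (weave s t)"
    using assms unfolding dfn_def by blast
  have p': "P a s = zf_sat mem p (weave (case_nat a s) t)" for a s
    using p[of "case_nat a s"] by simp
  \<comment> \<open>the bound variable becomes the first parameter\<close>
  define f where "f i = (if i = 0 then 1 else if even i then i - 2 else i + 2)" for i :: nat
  have cases: "i = 0 \<or> (\<exists>k. i = 2 * k + 2) \<or> (\<exists>k. i = 2 * k + 1)" for i :: nat
  proof (cases "even i")
    case True
    then obtain k where "i = 2 * k" by (rule evenE)
    then show ?thesis by (cases k) auto
  next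
    case False
    then show ?thesis by (metis oddE)
  qed
  have f: "f 0 = 1" "f (2 * k + 2) = 2 * k" "f (2 * k + 1) = 2 * k + 3" for k
    by (auto simp: f_def)
  have "inj f"
  proof (rule inj_on_inverseI)
    fix i
    show "(\<lambda>j. if j = 1 then 0 else if even j then j + 2 else j - 2) (f i) = i"
      using cases[of i] by (auto simp: f_def)
  qed
  moreover have "((weave s (case_nat (t 0) t))(1 := a)) (f i) = weave (case_nat a s) t i" for s a i
    using cases[of i]
  proof (elim disjE exE)
    fix k assume i: "i = 2 * k + 1"
    show ?thesis unfolding i f by (simp add: weave_def)
  next
    fix k assume i: "i = 2 * k + 2"
    show ?thesis unfolding i f by (simp add: weave_def)
  qed (simp add: f weave_def)
  then have "(\<lambda>i. ((weave s (case_nat (t 0) t))(1 := a)) (f i)) = weave (case_nat a s) t" for s a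
    by (rule ext)
  ultimately have "(\<exists>x. P x s) = zf_sat mem (Zf_Ex 1 (fm_rename f p)) (weave s (case_nat (t 0) t))" for s
    by (simp only: p' sat_fm_rename zf_sat.simps)
  then show ?thesis unfolding dfn_def by (intro exI allI)
qed

lemma dfn_all:
  assumes "dfn mem (\<lambda>s. P (s 0) (\<lambda>i. s (Suc i)))"
  shows "dfn mem (\<lambda>s. \<forall>x. P x s)"
proof -
  have "dfn mem (\<lambda>s. \<not> (\<exists>x. \<not> P x s))" by (intro dfn_not dfn_ex assms)
  then show ?thesis by simp
qed

lemma dfn_or: assumes "dfn mem P" "dfn mem Q" shows "dfn mem (\<lambda>s. P s \<or> Q s)"
proof -
  have "dfn mem (\<lambda>s. \<not> (\<not> P s \<and> \<not> Q s))" by (intro dfn_not dfn_and assms)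
  then show ?thesis by simp
qed

lemma dfn_imp: assumes "dfn mem P" "dfn mem Q" shows "dfn mem (\<lambda>s. P s \<longrightarrow> Q s)"
proof -
  have "dfn mem (\<lambda>s. \<not> P s \<or> Q s)" by (intro dfn_not dfn_or assms)
  then show ?thesis by (simp only: imp_conv_disj)
qed

lemma dfn_iff: assumes "dfn mem P" "dfn mem Q" shows "dfn mem (\<lambda>s. P s \<longleftrightarrow> Q s)"
proof -
  have "dfn mem (\<lambda>s. (P s \<longrightarrow> Q s) \<and> (Q s \<longrightarrow> P s))" by (intro dfn_and dfn_imp assms)
  moreover have "(\<lambda>s. (P s \<longrightarrow> Q s) \<and> (Q s \<longrightarrow> P s)) = (\<lambda>s. P s \<longleftrightarrow> Q s)" by (auto simp: fun_eq_iff)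
  ultimately show ?thesis by simp
qed

lemma dfn_var_eq: "dfn mem (\<lambda>s. s i = s j)"
  unfolding dfn_def by (rule exI[of _ "Zf_Eq (2 * i) (2 * j)"]) (simp add: weave_def)

lemma dfn_var_mem: "dfn mem (\<lambda>s. mem (s i) (s j))"
  unfolding dfn_def by (rule exI[of _ "Zf_Mem (2 * i) (2 * j)"]) (simp add: weave_def)

lemma dfn_True: "dfn mem (\<lambda>s. True)"
  using dfn_var_eq[of mem 0 0] by simp

lemma dfn_closed: "dfn mem (\<lambda>s. Q)"
  using dfn_True[of mem] dfn_not[OF dfn_True, of mem] by (cases Q) auto

lemma trm_var: "trm mem (\<lambda>s. s i)"
  unfolding trm_def by (rule dfn_var_eq)

lemma trm_const: "trm mem (\<lambda>s. c)"
  unfolding trm_def dfn_def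
  by (rule exI[of _ "Zf_Eq 0 1"], rule exI[of _ "\<lambda>_. c"]) (simp add: weave_def)

lemma trm_weaken:
  assumes "trm mem t"
  shows "trm mem (\<lambda>s. t (\<lambda>i. s (Suc i)))"
proof -
  have "inj (case_nat 0 (\<lambda>i. Suc (Suc i)))"
    by (rule inj_on_inverseI[of _ "\<lambda>i. i - 1"]) (simp split: nat.split)
  from dfn_rename[OF assms[unfolded trm_def] this] show ?thesis by (simp add: trm_def)
qed

text \<open>Substitution needs no renaming of formulas: a predicate holds of a term iff it holds of some value of
the term.\<close>

lemma dfn_subst:
  assumes "trm mem t" "dfn mem (\<lambda>s. Q (s 0) (\<lambda>i. s (Suc i)))"
  shows "dfn mem (\<lambda>s. Q (t s) s)"
  using dfn_ex[of mem "\<lambda>x s. x = t s \<and> Q x s"] dfn_and[OF assms(1)[unfolded trm_def] assms(2)] by simp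

lemma dfn_subst2:
  assumes "trm mem t" "trm mem u" "dfn mem (\<lambda>s. Q (s (Suc 0)) (s 0))"
  shows "dfn mem (\<lambda>s. Q (t s) (u s))"
  by (rule dfn_subst[OF assms(1)], rule dfn_subst[OF trm_weaken[OF assms(2)]], rule assms(3))

lemma dfn_eq: "trm mem t \<Longrightarrow> trm mem u \<Longrightarrow> dfn mem (\<lambda>s. t s = u s)"
  by (erule (1) dfn_subst2) (rule dfn_var_eq)

lemma dfn_mem: "trm mem t \<Longrightarrow> trm mem u \<Longrightarrow> dfn mem (\<lambda>s. t s \<in> zf_elts mem (u s))"
  unfolding zf_elts_def mem_Collect_eq by (erule (1) dfn_subst2) (rule dfn_var_mem)

lemma dfn_ball:
  assumes "trm mem t" "dfn mem (\<lambda>s. P (s 0) (\<lambda>i. s (Suc i)))"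
  shows "dfn mem (\<lambda>s. \<forall>x\<in>zf_elts mem (t s). P x s)"
  unfolding Ball_def by (intro dfn_all dfn_imp dfn_mem assms trm_var trm_weaken)

lemma dfn_bex:
  assumes "trm mem t" "dfn mem (\<lambda>s. P (s 0) (\<lambda>i. s (Suc i)))"
  shows "dfn mem (\<lambda>s. \<exists>x\<in>zf_elts mem (t s). P x s)"
  unfolding Bex_def by (intro dfn_ex dfn_and dfn_mem assms trm_var trm_weaken)

lemma dfn_subset: "trm mem t \<Longrightarrow> trm mem u \<Longrightarrow> dfn mem (\<lambda>s. zf_elts mem (t s) \<subseteq> zf_elts mem (u s))"
  unfolding subset_eq by (intro dfn_ball dfn_mem trm_var trm_weaken)

lemma dfn_ex1:
  assumes "dfn mem (\<lambda>s. P (s 0) (\<lambda>i. s (Suc i)))"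
  shows "dfn mem (\<lambda>s. \<exists>!x. P x s)"
proof -
  have "inj (case_nat 0 (\<lambda>i. Suc (Suc i)))"
    by (rule inj_on_inverseI[of _ "\<lambda>i. i - 1"]) (simp split: nat.split)
  from dfn_rename[OF assms this] have "dfn mem (\<lambda>s. P (s 0) (\<lambda>i. s (Suc (Suc i))))" by simp
  then show ?thesis unfolding Ex1_def by (intro dfn_ex dfn_all dfn_and dfn_imp dfn_eq trm_var assms)
qed

lemma trm_if:
  assumes "dfn mem P" "trm mem t" "trm mem u"
  shows "trm mem (\<lambda>s. if P s then t s else u s)"
proof -
  have "dfn mem (\<lambda>s. P (\<lambda>i. s (Suc i)))" by (rule dfn_rename[OF assms(1)]) simp
  then have "dfn mem (\<lambda>s. (P (\<lambda>i. s (Suc i)) \<and> s 0 = t (\<lambda>i. s (Suc i))) \<or> (\<not> P (\<lambda>i. s (Suc i)) \<and> s 0 = u (\<lambda>i. s (Suc i))))"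
    by (intro dfn_or dfn_and dfn_not assms(2,3)[unfolded trm_def])
  moreover have "(\<lambda>s. (P (\<lambda>i. s (Suc i)) \<and> s 0 = t (\<lambda>i. s (Suc i))) \<or> (\<not> P (\<lambda>i. s (Suc i)) \<and> s 0 = u (\<lambda>i. s (Suc i))))
     = (\<lambda>s. s 0 = (if P (\<lambda>i. s (Suc i)) then t (\<lambda>i. s (Suc i)) else u (\<lambda>i. s (Suc i))))" by (auto simp: fun_eq_iff)
  ultimately show ?thesis unfolding trm_def by simp
qed

text \<open>A definite description whose value is fixed also when nothing, or more than one thing, satisfies the
predicate.  This makes it definable for every assignment, as the description operator of the logic is not.\<close>

definition zthe :: "('v \<Rightarrow> 'v \<Rightarrow> bool) \<Rightarrow> ('v \<Rightarrow> bool) \<Rightarrow> 'v" where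
  "zthe mem P = (if \<exists>!x. P x then THE x. P x else zf_set mem {})"

lemma zthe_eq: "P a \<Longrightarrow> (\<And>x. P x \<Longrightarrow> x = a) \<Longrightarrow> zthe mem P = a"
  unfolding zthe_def by (subst if_P) (blast, rule the_equality)

lemma trm_zthe:
  assumes "dfn mem (\<lambda>s. P (s 0) (\<lambda>i. s (Suc i)))"
  shows "trm mem (\<lambda>s. zthe mem (\<lambda>x. P x s))"
proof -
  have 1: "dfn mem (\<lambda>s. \<exists>!x. P x (\<lambda>i. s (Suc i)))" 
    by (rule dfn_rename[OF dfn_ex1[OF assms] inj_Suc])
  have "dfn mem (\<lambda>s. ((\<exists>!x. P x (\<lambda>i. s (Suc i))) \<and> P (s 0) (\<lambda>i. s (Suc i))) \<or>
     (\<not> (\<exists>!x. P x (\<lambda>i. s (Suc i))) \<and> s 0 = zf_set mem {}))"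
    by (intro dfn_or dfn_and dfn_not 1 assms dfn_eq trm_var trm_const)
  moreover have "((\<exists>!x. P x s) \<and> P c s \<or> \<not> (\<exists>!x. P x s) \<and> c = zf_set mem {}) = (c = zthe mem (\<lambda>x. P x s))" for c s
  proof (cases "\<exists>!x. P x s")
    case True
    then obtain a where a: "P a s" "\<And>x. P x s \<Longrightarrow> x = a" by (elim ex1E) blast
    have z: "zthe mem (\<lambda>x. P x s) = a" by (rule zthe_eq) (rule a, erule a)
    have "P c s \<longleftrightarrow> c = a" using a by (metis (no_types))
    with True show ?thesis unfolding z by (simp only: simp_thms)
  next
    case False
    then show ?thesis unfolding zthe_def by (simp only: simp_thms if_False)
  qed
  ultimately show ?thesis unfolding trm_def by (simp only:)
qed

section \<open>Sets and functions in a model of ZF\<close>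

context zf_model
begin

abbreviation E :: "'v \<Rightarrow> 'v set" where "E \<equiv> zf_elts mem"
abbreviation pr :: "'v \<Rightarrow> 'v \<Rightarrow> 'v" where "pr \<equiv> zf_pair mem"
abbreviation df :: "((nat \<Rightarrow> 'v) \<Rightarrow> bool) \<Rightarrow> bool" where "df \<equiv> dfn mem"
abbreviation tm :: "((nat \<Rightarrow> 'v) \<Rightarrow> 'v) \<Rightarrow> bool" where "tm \<equiv> trm mem"
abbreviation fn :: "'v \<Rightarrow> 'v \<Rightarrow> 'v \<Rightarrow> bool" where "fn \<equiv> zf_fun mem"

text \<open>Classes are HOL sets over the model; these are the ones that are the extension of an element.\<close>

definition setlike :: "'v set \<Rightarrow> bool" where
  "setlike S \<longleftrightarrow> (\<exists>a. E a = S)"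

lemma elts_inject: "E a = E b \<longleftrightarrow> a = b"
  using Extensionality by auto

lemma elts_eqI: "(\<And>x. x \<in> E a \<longleftrightarrow> x \<in> E b) \<Longrightarrow> a = b"
  using Extensionality by blast

lemma setlike_elts [simp]: "setlike (E a)"
  unfolding setlike_def by blast

lemma elts_zf_set [simp]: "setlike S \<Longrightarrow> E (zf_set mem S) = S"
  unfolding setlike_def zf_set_def by (metis (mono_tags, lifting) theI_unique elts_inject)

lemma zf_set_elts [simp]: "zf_set mem (E a) = a"
  by (rule elts_eqI) (simp add: elts_zf_set)

lemma zf_set_eqI: "E a = S \<Longrightarrow> zf_set mem S = a"
  using zf_set_elts by blast

text \<open>Separation, in the form in which it is used: the parameters of the definition become the values of the
variables other than the first.\<close>

lemma setlike_sep:
  assumes "df (\<lambda>s. P (s 0))"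
  shows "setlike {x \<in> E A. P x}"
proof -
  obtain p t where p: "\<And>s. P (s 0) = zf_sat mem p (weave s t)" using assms unfolding dfn_def by blast
  have "P x = zf_sat mem p ((weave (\<lambda>_. A) t)(0 := x))" for x
  proof -
    have "(weave (\<lambda>_. A) t)(0 := x) = weave ((\<lambda>_. A)(0 := x)) t"
      by (auto simp: weave_def fun_eq_iff elim!: evenE)
    then show ?thesis using p[of "(\<lambda>_. A)(0 := x)"] by simp
  qed
  then show ?thesis using Separation[of A p "weave (\<lambda>_. A) t"] unfolding setlike_def by simp
qed

lemma setlike_subset:
  assumes "df (\<lambda>s. P (s 0))" "\<And>x. P x \<Longrightarrow> x \<in> E A"
  shows "setlike {x. P x}"
proof -
  have "{x. P x} = {x \<in> E A. P x}" using assms(2) by blast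
  with setlike_sep[OF assms(1)] show ?thesis by simp
qed

lemma setlike_pair [simp]: "setlike {a, b}"
  unfolding setlike_def using Pairing by blast

lemma setlike_singleton [simp]: "setlike {a}"
  using setlike_pair[of a a] by simp

lemma setlike_empty [simp]: "setlike {}"
  unfolding setlike_def using Infinity by blast

lemma setlike_Union: "setlike (\<Union>x\<in>E A. E x)"
  unfolding setlike_def using Union by blast

lemma setlike_Un [simp]: "setlike S \<Longrightarrow> setlike T \<Longrightarrow> setlike (S \<union> T)"
proof -
  assume "setlike S" "setlike T"
  then obtain a b where ab: "E a = S" "E b = T" unfolding setlike_def by blast
  show ?thesis using setlike_Union[of "zf_set mem {a, b}"] by (simp add: elts_zf_set ab)
qed

lemma setlike_insert [simp]: "setlike S \<Longrightarrow> setlike (insert x S)"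
  using setlike_Un[of "{x}" S] by simp

lemma setlike_Pow: "setlike {x. E x \<subseteq> E A}"
  unfolding setlike_def using Powerset by blast

lemma elts_zf_Union [simp]: "E (zf_Union mem A) = (\<Union>x\<in>E A. E x)"
  unfolding zf_Union_def by (rule elts_zf_set[OF setlike_Union])

definition zpow :: "'v \<Rightarrow> 'v" where
  "zpow A = zf_set mem {x. E x \<subseteq> E A}"

lemma elts_zpow [simp]: "E (zpow A) = {x. E x \<subseteq> E A}"
  unfolding zpow_def by (rule elts_zf_set[OF setlike_Pow])

lemma not_mem_self: "x \<notin> E x"
  using Foundation[of "zf_set mem {x}"] by (auto simp: elts_zf_set)

lemma zf_pair_inject [simp]: "pr a b = pr c d \<longleftrightarrow> a = c \<and> b = d"
proof
  assume "pr a b = pr c d"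
  then have "E (pr a b) = E (pr c d)" by simp
  then have "{zf_set mem {a}, zf_set mem {a, b}} = {zf_set mem {c}, zf_set mem {c, d}}"
    by (simp add: zf_pair_def elts_zf_set)
  then have "E ` {zf_set mem {a}, zf_set mem {a, b}} = E ` {zf_set mem {c}, zf_set mem {c, d}}" by simp
  then have "{{a}, {a, b}} = {{c}, {c, d}}" by (simp add: elts_zf_set)
  then show "a = c \<and> b = d" by (metis doubleton_eq_iff insert_absorb2 singleton_insert_inj_eq)
qed simp

lemma trm_pair_set: "tm t \<Longrightarrow> tm u \<Longrightarrow> tm (\<lambda>s. zf_set mem {t s, u s})"
proof -
  have "(c = zf_set mem {a, b}) \<longleftrightarrow> (\<forall>x. x \<in> E c \<longleftrightarrow> x = a \<or> x = b)" for a b c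
    using elts_inject[of c "zf_set mem {a, b}"] by (auto simp: elts_zf_set)
  moreover assume "tm t" "tm u"
  then have "df (\<lambda>s. \<forall>x. x \<in> E (s 0) \<longleftrightarrow> x = t (\<lambda>i. s (Suc i)) \<or> x = u (\<lambda>i. s (Suc i)))"
    by (intro dfn_all dfn_iff dfn_mem dfn_or dfn_eq trm_var trm_weaken)
  ultimately show ?thesis unfolding trm_def by simp
qed

lemma trm_pair: "tm t \<Longrightarrow> tm u \<Longrightarrow> tm (\<lambda>s. pr (t s) (u s))"
  unfolding zf_pair_def by (subst insert_absorb2[symmetric], intro trm_pair_set)

text \<open>Function application, with a default off the domain, so that it may occur in definitions without a guard.\<close>

definition val :: "'v \<Rightarrow> 'v \<Rightarrow> 'v" where
  "val f x = zthe mem (\<lambda>y. pr x y \<in> E f)"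

lemma trm_val: "tm t \<Longrightarrow> tm u \<Longrightarrow> tm (\<lambda>s. val (t s) (u s))"
  unfolding val_def by (intro trm_zthe dfn_mem trm_pair trm_var trm_weaken)

lemmas definability =
  dfn_all dfn_ex dfn_and dfn_or dfn_not dfn_imp dfn_iff dfn_mem dfn_eq dfn_ball dfn_bex dfn_subset
  dfn_closed trm_var trm_const trm_val trm_pair trm_if trm_zthe dfn_ex1

lemma setlike_prod: "setlike {pr a b | a b. a \<in> E A \<and> b \<in> E B}"
proof -
  have "setlike {x. \<exists>a\<in>E A. \<exists>b\<in>E B. x = pr a b}"
  proof (rule setlike_subset[where A = "zpow (zpow (zf_set mem (E A \<union> E B)))"])
    show "df (\<lambda>s. \<exists>a\<in>E A. \<exists>b\<in>E B. s 0 = pr a b)" by (intro definability)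
    show "x \<in> E (zpow (zpow (zf_set mem (E A \<union> E B))))" if "\<exists>a\<in>E A. \<exists>b\<in>E B. x = pr a b" for x
      using that by (auto simp: zf_pair_def elts_zf_set)
  qed
  moreover have "{x. \<exists>a\<in>E A. \<exists>b\<in>E B. x = pr a b} = {pr a b | a b. a \<in> E A \<and> b \<in> E B}" by blast
  ultimately show ?thesis by simp
qed

lemma elts_zf_prod: "E (zf_prod mem A B) = {pr a b | a b. a \<in> E A \<and> b \<in> E B}"
  unfolding zf_prod_def by (rule elts_zf_set[OF setlike_prod])

lemma pair_mem_prod [simp]: "pr a b \<in> E (zf_prod mem A B) \<longleftrightarrow> a \<in> E A \<and> b \<in> E B"
  by (auto simp: elts_zf_prod)

lemma fun_ex1: "fn A B f \<Longrightarrow> x \<in> E A \<Longrightarrow> \<exists>!y. pr x y \<in> E f"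
  unfolding zf_fun_def by blast

lemma fun_val: 
  assumes "fn A B f" "x \<in> E A"
  shows zf_app_eq_val: "zf_app mem f x = val f x" and pair_val: "pr x (val f x) \<in> E f"
    and val_in: "val f x \<in> E B"
proof -
  show a: "zf_app mem f x = val f x"
    using fun_ex1[OF assms] by (simp add: zf_app_def val_def zthe_def)
  show b: "pr x (val f x) \<in> E f"
    using theI'[OF fun_ex1[OF assms]] fun_ex1[OF assms] by (simp add: val_def zthe_def)
  show "val f x \<in> E B" using b assms(1) unfolding zf_fun_def by (metis pair_mem_prod subsetD)
qed

lemma val_eqI: "fn A B f \<Longrightarrow> pr x y \<in> E f \<Longrightarrow> val f x = y"
proof -
  assume f: "fn A B f" and p: "pr x y \<in> E f"
  have "x \<in> E A" using f p unfolding zf_fun_def by (metis pair_mem_prod subsetD)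
  then show ?thesis using fun_ex1[OF f] pair_val[OF f] p by blast
qed

text \<open>A function of the model is a subset of a product, so it has no pairs beside its graph.\<close>

lemma fun_eqI:
  assumes "fn A B f" "fn A C g" "\<And>x. x \<in> E A \<Longrightarrow> val f x = val g x"
  shows "f = g"
proof -
  have sub: "E f \<subseteq> E g" if fg: "fn A B f" "fn A C g" "\<And>x. x \<in> E A \<Longrightarrow> val f x = val g x" for f g B C
  proof
    fix p assume p: "p \<in> E f"
    then obtain x y where xy: "p = pr x y" "x \<in> E A" using fg(1) unfolding zf_fun_def elts_zf_prod by blast
    then have "val f x = y" using val_eqI[OF fg(1)] p by simp
    then show "p \<in> E g" using fg(3)[OF xy(2)] pair_val[OF fg(2) xy(2)] xy(1) by simp
  qed
  show ?thesis by (rule elts_eqI) (metis sub[OF assms] sub[OF assms(2,1)] assms(3) subsetD)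
qed

text \<open>The only way in which functions of the model are built: from a definable relation that is functional
on the domain.  Uniqueness of the value takes the place of choice.\<close>

lemma fun_existsI:
  assumes "df (\<lambda>s. R (s 0) (s (Suc 0)))" "\<And>x. x \<in> E A \<Longrightarrow> \<exists>!y. y \<in> E B \<and> R x y"
  shows "\<exists>f. fn A B f \<and> (\<forall>x\<in>E A. val f x \<in> E B \<and> R x (val f x))"
proof -
  have R: "df (\<lambda>s. R (t s) (u s))" if "tm t" "tm u" for t u
  proof -
    have "inj (\<lambda>i. if i = 0 then Suc 0 else if i = Suc 0 then 0 else i)" by (auto simp: inj_def)
    from dfn_rename[OF assms(1) this] show ?thesis
      by (intro dfn_subst2[OF that, of "\<lambda>a b. R a b"]) simp
  qed
  have "setlike {p \<in> E (zf_prod mem A B). \<exists>x y. p = pr x y \<and> R x y}"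
    by (rule setlike_sep, intro definability R)
  then obtain f where f: "E f = {p \<in> E (zf_prod mem A B). \<exists>x y. p = pr x y \<and> R x y}"
    unfolding setlike_def by blast
  have pf: "pr x y \<in> E f \<longleftrightarrow> x \<in> E A \<and> y \<in> E B \<and> R x y" for x y unfolding f by auto
  have "fn A B f" unfolding zf_fun_def
  proof (intro conjI ballI)
    show "E f \<subseteq> E (zf_prod mem A B)" unfolding f by blast
    show "\<exists>!y. pr x y \<in> E f" if "x \<in> E A" for x using assms(2)[OF that] unfolding pf using that by blast
  qed
  moreover have "val f x \<in> E B \<and> R x (val f x)" if "x \<in> E A" for x
    using pair_val[OF \<open>fn A B f\<close> that] unfolding pf by blast
  ultimately show ?thesis by blast
qed

lemma fun_exists_trm:
  assumes "tm (\<lambda>s. F (s 0))" "\<And>x. x \<in> E A \<Longrightarrow> F x \<in> E B"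
  shows "\<exists>f. fn A B f \<and> (\<forall>x\<in>E A. val f x = F x)"
proof -
  have "df (\<lambda>s. s (Suc 0) = F (s 0))"
    by (intro dfn_eq trm_var assms(1))
  from fun_existsI[of "\<lambda>x y. y = F x", OF this, of A B] assms(2) show ?thesis by auto
qed

lemma dfn_fun: "tm a \<Longrightarrow> tm b \<Longrightarrow> tm f \<Longrightarrow> df (\<lambda>s. fn (a s) (b s) (f s))"
proof -
  have *: "fn a b f \<longleftrightarrow> (\<forall>p\<in>E f. \<exists>x\<in>E a. \<exists>y\<in>E b. p = pr x y) \<and> (\<forall>x\<in>E a. \<exists>!y. pr x y \<in> E f)" for a b f
    unfolding zf_fun_def elts_zf_prod by blast
  assume "tm a" "tm b" "tm f"
  then show ?thesis unfolding * by (intro definability trm_weaken)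
qed

lemma fun_in_pow_prod: "fn A B f \<Longrightarrow> f \<in> E (zpow (zf_prod mem A B))"
  unfolding zf_fun_def by simp

lemma zf_bij_iff: "zf_bij mem A B f \<longleftrightarrow> fn A B f \<and> inj_on (val f) (E A) \<and> val f ` E A = E B"
  unfolding zf_bij_def bij_betw_def using zf_app_eq_val
  by (metis (no_types, lifting) image_cong inj_on_cong)

section \<open>Natural numbers and finiteness in the model\<close>

abbreviation emp :: 'v where "emp \<equiv> zf_set mem {}"
abbreviation zsucc :: "'v \<Rightarrow> 'v" where "zsucc x \<equiv> zf_set mem (insert x (E x))"
abbreviation om :: 'v where "om \<equiv> zf_omega mem"

lemma elts_emp [simp]: "E emp = {}" by (simp add: elts_zf_set)
lemma elts_zsucc [simp]: "E (zsucc x) = insert x (E x)" by (simp add: elts_zf_set)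

lemma trm_zsucc: "tm t \<Longrightarrow> tm (\<lambda>s. zsucc (t s))"
proof -
  have "(c = zsucc a) \<longleftrightarrow> (\<forall>x. x \<in> E c \<longleftrightarrow> x = a \<or> x \<in> E a)" for a c
    using elts_inject[of c "zsucc a"] by auto
  moreover assume "tm t"
  then have "df (\<lambda>s. \<forall>x. x \<in> E (s 0) \<longleftrightarrow> x = t (\<lambda>i. s (Suc i)) \<or> x \<in> E (t (\<lambda>i. s (Suc i))))"
    by (intro definability trm_weaken)
  ultimately show ?thesis unfolding trm_def by simp
qed

lemma setlike_Diff [simp]: "setlike (E A - E B)"
proof -
  have "setlike {x \<in> E A. x \<notin> E B}" by (rule setlike_sep, intro definability)
  then show ?thesis by (simp add: set_diff_eq)
qed

lemma setlike_Int [simp]: "setlike (E A \<inter> E B)"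
proof -
  have "setlike {x \<in> E A. x \<in> E B}" by (rule setlike_sep, intro definability)
  then show ?thesis by (simp add: Int_def)
qed

lemma zf_inductive_exists: "\<exists>I. zf_inductive mem I"
proof -
  obtain I e where I: "e \<in> E I" "E e = {}" "\<And>x. x \<in> E I \<Longrightarrow> \<exists>y\<in>E I. E y = insert x (E x)"
    using Infinity by blast
  have "e = emp" using I(2) by (intro elts_eqI) simp
  moreover have "zsucc x \<in> E I" if x: "x \<in> E I" for x
    using I(3)[OF x] zf_set_eqI by blast
  ultimately show ?thesis using I(1) unfolding zf_inductive_def by auto
qed

lemma elts_omega: "E om = {n. \<forall>I. zf_inductive mem I \<longrightarrow> n \<in> E I}"
proof -
  obtain I where I: "zf_inductive mem I" using zf_inductive_exists by blast
  have "setlike {n. \<forall>I. zf_inductive mem I \<longrightarrow> n \<in> E I}"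
  proof (rule setlike_subset[where A = I])
    show "df (\<lambda>s. \<forall>I. zf_inductive mem I \<longrightarrow> s 0 \<in> E I)"
      unfolding zf_inductive_def by (intro definability trm_zsucc)
  qed (use I in blast)
  then show ?thesis unfolding zf_omega_def by (rule elts_zf_set)
qed

lemma omega_0 [simp]: "emp \<in> E om" and omega_succ: "n \<in> E om \<Longrightarrow> zsucc n \<in> E om"
  unfolding elts_omega zf_inductive_def by blast+

text \<open>Induction over the natural numbers of the model, which need not be standard, holds for definable
predicates only.\<close>

lemma omega_induct [consumes 1, case_names dfn zero succ]:
  assumes "n \<in> E om" "df (\<lambda>s. P (s 0))" "P emp" "\<And>n. n \<in> E om \<Longrightarrow> P n \<Longrightarrow> P (zsucc n)"
  shows "P n"
proof -
  obtain I where I: "E I = {n \<in> E om. P n}" using setlike_sep[OF assms(2)] unfolding setlike_def by blast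
  have "zf_inductive mem I" unfolding zf_inductive_def I using assms(3,4) omega_succ by auto
  then have "n \<in> E I" using assms(1) unfolding elts_omega by blast
  then show ?thesis unfolding I by blast
qed

lemma omega_subset: 
  assumes "n \<in> E om" shows "E n \<subseteq> E om"
  using assms
proof (induction n rule: omega_induct)
  case dfn show ?case by (intro definability)
qed auto

text \<open>Linearity makes the first member of a countable family that contains a given point unique.\<close>

lemma omega_linear:
  assumes "n \<in> E om" shows "\<forall>m\<in>E om. m \<in> E n \<or> m = n \<or> n \<in> E m"
  using assms
proof (induction n rule: omega_induct)
  case dfn show ?case by (intro definability)
next
  case zero
  have "emp = m \<or> emp \<in> E m" if "m \<in> E om" for m
    using that
  proof (induction m rule: omega_induct)
    case dfn show ?case by (intro definability)
  qed auto
  then show ?case by auto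
next
  case (succ n)
  have *: "n \<in> E m \<longrightarrow> zsucc n = m \<or> zsucc n \<in> E m" if "m \<in> E om" for m
    using that
  proof (induction m rule: omega_induct)
    case dfn show ?case by (intro definability)
  qed auto
  show ?case
  proof
    fix m assume m: "m \<in> E om"
    with succ.IH * show "m \<in> E (zsucc n) \<or> m = zsucc n \<or> zsucc n \<in> E m" by auto
  qed
qed

lemma zf_finite_countable: "zf_finite mem A \<Longrightarrow> zf_countable mem A"
  unfolding zf_finite_def zf_countable_def using omega_subset by blast

lemma zf_finite_pair: "zf_finite mem (zf_set mem {a, b})"
proof -
  let ?n = "if a = b then zsucc emp else zsucc (zsucc emp)"
  have el: "E (zf_set mem {a, b}) = {a, b}" by (simp add: elts_zf_set)
  have ne: "emp \<noteq> zsucc emp" using not_mem_self[of emp] by (metis elts_zsucc insertI1)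
  have tm: "tm (\<lambda>s. if s 0 = a then emp else zsucc emp)" by (intro definability)
  have "(if x = a then emp else zsucc emp) \<in> E ?n" if "x \<in> E (zf_set mem {a, b})" for x
    using that unfolding el by auto
  from fun_exists_trm[where F = "\<lambda>x. if x = a then emp else zsucc emp" and A = "zf_set mem {a, b}", OF tm this]
  obtain f where f: "fn (zf_set mem {a, b}) ?n f"
      "\<forall>x\<in>{a, b}. val f x = (if x = a then emp else zsucc emp)"
    unfolding el by blast
  have "zf_bij mem (zf_set mem {a, b}) ?n f"
    unfolding zf_bij_iff el
  proof (intro conjI)
    show "fn (zf_set mem {a, b}) ?n f" by (rule f(1))
    show "inj_on (val f) {a, b}" using f(2) ne by (simp add: inj_on_def)
    show "val f ` {a, b} = E ?n" using f(2) by (simp add: insert_commute)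
  qed
  moreover have "?n \<in> E om" by (rule if_split[THEN iffD2]) (blast intro: omega_0 omega_succ)
  ultimately show ?thesis unfolding zf_finite_def by blast
qed

text \<open>By induction on \<open>m\<close>, the members of \<open>D\<close> that are numbered below \<open>m\<close> have a bound in \<open>C\<close>.  Only the numbering
of \<open>D\<close> is a parameter, so that the induction hypothesis is a simple formula.\<close>

lemma finite_directed_bound:
  assumes "zf_finite mem D" "E D \<subseteq> E C" "E C \<noteq> {}"
    and dir: "\<And>u v. u \<in> E C \<Longrightarrow> v \<in> E C \<Longrightarrow> \<exists>w\<in>E C. E u \<union> E v \<subseteq> E w"
  shows "\<exists>u\<in>E C. \<forall>d\<in>E D. E d \<subseteq> E u"
proof -
  obtain n f where n: "n \<in> E om" and f: "fn D n f" "inj_on (val f) (E D)" 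
    using assms(1) unfolding zf_finite_def zf_bij_iff by blast
  have "\<exists>u\<in>E C. \<forall>d\<in>E D. val f d \<in> E m \<longrightarrow> E d \<subseteq> E u" if "m \<in> E om" for m
    using that
  proof (induction m rule: omega_induct)
    case dfn show ?case by (intro definability)
  next
    case zero then show ?case using assms(3) by auto
  next
    case (succ m)
    then obtain u where u: "u \<in> E C" "\<And>d. d \<in> E D \<Longrightarrow> val f d \<in> E m \<Longrightarrow> E d \<subseteq> E u" by blast
    show ?case
    proof (cases "\<exists>e\<in>E D. val f e = m")
      case True
      then obtain e where e: "e \<in> E D" "val f e = m" by blast
      obtain w where w: "w \<in> E C" "E u \<union> E e \<subseteq> E w" using dir u(1) e(1) assms(2) by blast
      have "E d \<subseteq> E w" if "d \<in> E D" "val f d \<in> E (zsucc m)" for d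
        using that u(2)[of d] w(2) e inj_onD[OF f(2), of d e] by auto
      then show ?thesis using w(1) by blast
    next
      case False then show ?thesis using u by auto
    qed
  qed
  from this[OF n] show ?thesis using val_in[OF f(1)] by blast
qed

lemma omega_minimal:
  assumes "setlike S" "S \<noteq> {}" "S \<subseteq> E om"
  shows "\<exists>n\<in>S. \<forall>m\<in>S. m \<notin> E n"
proof -
  obtain a where "E a = S" using assms(1) unfolding setlike_def by blast
  then show ?thesis using Foundation[of a] assms(2) by blast
qed

section \<open>Topology in a model\<close>

abbreviation pts :: "'v zf_space \<Rightarrow> 'v set" where "pts S \<equiv> E (zf_pts S)"

text \<open>Openness of a HOL set: it spares the translation of every union, intersection and preimage into an
element of the model.\<close>

definition opn :: "'v zf_space \<Rightarrow> 'v set \<Rightarrow> bool" where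
  "opn S U \<longleftrightarrow> (\<exists>u\<in>E (zf_opens S). E u = U)"

definition clp :: "'v zf_space \<Rightarrow> 'v set \<Rightarrow> bool" where
  "clp S U \<longleftrightarrow> opn S U \<and> opn S (pts S - U)"

abbreviation top :: "'v zf_space \<Rightarrow> bool" where "top \<equiv> zf_topological mem"

lemma opn_elts [simp]: "opn S (E u) \<longleftrightarrow> u \<in> E (zf_opens S)"
  unfolding opn_def by (auto simp: elts_inject)

lemma opn_setlike: "opn S U \<Longrightarrow> setlike U"
  unfolding opn_def setlike_def by blast

lemma opn_zf_set: "setlike U \<Longrightarrow> zf_set mem U \<in> E (zf_opens S) \<longleftrightarrow> opn S U"
  using opn_elts[of S "zf_set mem U"] by (simp add: elts_zf_set)

lemma opn_subset: "top S \<Longrightarrow> opn S U \<Longrightarrow> U \<subseteq> pts S"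
  unfolding zf_topological_def opn_def by blast

lemma opn_empty: "top S \<Longrightarrow> opn S {}"
  unfolding zf_topological_def using opn_zf_set[of "{}" S] by simp

lemma opn_pts: "top S \<Longrightarrow> opn S (pts S)"
  unfolding zf_topological_def by simp

lemma opn_Int: "top S \<Longrightarrow> opn S U \<Longrightarrow> opn S V \<Longrightarrow> opn S (U \<inter> V)"
  unfolding zf_topological_def opn_def[of S U] opn_def[of S V] using opn_zf_set[OF setlike_Int] by blast

text \<open>The union of all open subsets of \<open>D\<close> is \<open>D\<close>, so no neighbourhood has to be chosen for each point.\<close>

lemma opn_nbhd:
  assumes S: "top S" and D: "setlike D" and nb: "\<And>x. x \<in> D \<Longrightarrow> \<exists>U. opn S U \<and> x \<in> U \<and> U \<subseteq> D"
  shows "opn S D"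
proof -
  obtain d where d: "E d = D" using D unfolding setlike_def by blast
  have "setlike {u \<in> E (zf_opens S). E u \<subseteq> E d}" by (rule setlike_sep, intro definability)
  then obtain C where C: "E C = {u \<in> E (zf_opens S). E u \<subseteq> E d}" unfolding setlike_def by blast
  have "zf_Union mem C \<in> E (zf_opens S)" using S C unfolding zf_topological_def by blast
  moreover have "E (zf_Union mem C) = D"
    using nb unfolding elts_zf_Union C d opn_def by fastforce
  ultimately show ?thesis unfolding opn_def by blast
qed

lemma opn_Un: "top S \<Longrightarrow> opn S U \<Longrightarrow> opn S V \<Longrightarrow> opn S (U \<union> V)"
  by (rule opn_nbhd) (blast intro: setlike_Un opn_setlike)+

lemma zf_clopen_iff: "top S \<Longrightarrow> zf_clopen mem S A \<longleftrightarrow> clp S (E A)"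
  unfolding zf_clopen_def clp_def by (simp add: opn_zf_set)

lemma clp_setlike: "clp S U \<Longrightarrow> setlike U" and clp_subset: "top S \<Longrightarrow> clp S U \<Longrightarrow> U \<subseteq> pts S"
  unfolding clp_def using opn_setlike opn_subset by blast+

lemma clp_compl: "top S \<Longrightarrow> clp S U \<Longrightarrow> clp S (pts S - U)"
  unfolding clp_def by (simp add: double_diff opn_subset)

lemma clp_pts: "top S \<Longrightarrow> clp S (pts S)"
  unfolding clp_def using opn_empty opn_pts by simp

lemma clp_empty: "top S \<Longrightarrow> clp S {}"
  unfolding clp_def using opn_empty opn_pts by simp

lemma clp_Int: "top S \<Longrightarrow> clp S U \<Longrightarrow> clp S V \<Longrightarrow> clp S (U \<inter> V)"
  unfolding clp_def by (simp add: opn_Int opn_Un Diff_Int)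

lemma clp_Un: "top S \<Longrightarrow> clp S U \<Longrightarrow> clp S V \<Longrightarrow> clp S (U \<union> V)"
  unfolding clp_def by (simp add: opn_Int opn_Un Diff_Un)

lemma clp_separates: "clp S A \<Longrightarrow> x \<in> pts S \<Longrightarrow> \<exists>U. opn S U \<and> x \<in> U \<and> (\<forall>y\<in>U. y \<in> A \<longleftrightarrow> x \<in> A)"
  unfolding clp_def by (cases "x \<in> A") blast+

lemma setlike_preimage: "setlike {x \<in> E A. val f x \<in> E B}"
  by (rule setlike_sep, intro definability)

lemma zf_continuous_iff: 
  "zf_continuous mem S T f \<longleftrightarrow> fn (zf_pts S) (zf_pts T) f \<and>
    (\<forall>V. opn T V \<longrightarrow> opn S {x \<in> pts S. val f x \<in> V})"
proof -
  have "zf_set mem {x \<in> pts S. zf_app mem f x \<in> E v} \<in> E (zf_opens S) \<longleftrightarrow>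
      opn S {x \<in> pts S. val f x \<in> E v}" if "fn (zf_pts S) (zf_pts T) f" for v
  proof -
    have "{x \<in> pts S. zf_app mem f x \<in> E v} = {x \<in> pts S. val f x \<in> E v}"
      using zf_app_eq_val[OF that] by auto
    then show ?thesis by (simp add: opn_zf_set setlike_preimage)
  qed
  then show ?thesis unfolding zf_continuous_def by (auto simp: opn_def[of T])
qed

lemma dfn_continuous: "tm f \<Longrightarrow> df (\<lambda>s. zf_continuous mem S T (f s))"
proof -
  have *: "zf_continuous mem S T f \<longleftrightarrow> fn (zf_pts S) (zf_pts T) f \<and>
    (\<forall>v\<in>E (zf_opens T). \<exists>u\<in>E (zf_opens S). \<forall>x. x \<in> E u \<longleftrightarrow> x \<in> pts S \<and> val f x \<in> E v)" for f
  proof -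
    have "(\<forall>V. opn T V \<longrightarrow> opn S {x \<in> pts S. val f x \<in> V}) \<longleftrightarrow>
        (\<forall>v\<in>E (zf_opens T). opn S {x \<in> pts S. val f x \<in> E v})"
      unfolding opn_def[of T] by blast
    moreover have "opn S W \<longleftrightarrow> (\<exists>u\<in>E (zf_opens S). \<forall>x. x \<in> E u \<longleftrightarrow> x \<in> W)" for W
      unfolding opn_def set_eq_iff ..
    ultimately show ?thesis unfolding zf_continuous_iff by simp
  qed
  assume "tm f"
  then show ?thesis unfolding * by (intro definability dfn_fun trm_weaken)
qed

lemma zf_base_nbhd: "zf_base mem S \<B> \<Longrightarrow> opn S U \<Longrightarrow> x \<in> U \<Longrightarrow> \<exists>B\<in>\<B>. x \<in> E B \<and> E B \<subseteq> U"
proof -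
  assume b: "zf_base mem S \<B>" and U: "opn S U" and x: "x \<in> U"
  obtain u where u: "u \<in> E (zf_opens S)" "E u = U" using U unfolding opn_def by blast
  then obtain C where C: "E C \<subseteq> \<B>" "u = zf_Union mem C" using b unfolding zf_base_def by blast
  then have "U = (\<Union>x\<in>E C. E x)" using u by simp
  then show ?thesis using C(1) x by blast
qed

lemma zf_baseI:
  assumes "\<And>B. B \<in> \<B> \<Longrightarrow> opn S (E B)" "df (\<lambda>s. s 0 \<in> \<B>)"
    and nb: "\<And>U x. opn S U \<Longrightarrow> x \<in> U \<Longrightarrow> \<exists>B\<in>\<B>. x \<in> E B \<and> E B \<subseteq> U"
  shows "zf_base mem S \<B>"
  unfolding zf_base_def
proof (intro conjI ballI)
  show "\<B> \<subseteq> E (zf_opens S)" using assms(1) by auto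
  fix u assume u: "u \<in> E (zf_opens S)"
  have "setlike {b \<in> E (zf_opens S). b \<in> \<B> \<and> E b \<subseteq> E u}"
    by (rule setlike_sep, intro definability assms(2))
  then obtain C where C: "E C = {b \<in> E (zf_opens S). b \<in> \<B> \<and> E b \<subseteq> E u}" unfolding setlike_def by blast
  have "u = zf_Union mem C"
  proof (rule elts_eqI)
    fix x
    show "x \<in> E u \<longleftrightarrow> x \<in> E (zf_Union mem C)"
      using nb[of "E u" x] u assms(1) unfolding elts_zf_Union C by auto
  qed
  then show "\<exists>C. E C \<subseteq> \<B> \<and> u = zf_Union mem C" using C by blast
qed

lemma zero_dim_nbhd: 
  assumes "top S" "zf_zero_dimensional mem S" "opn S U" "x \<in> U"
  shows "\<exists>A. clp S (E A) \<and> x \<in> E A \<and> E A \<subseteq> U"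
  using zf_base_nbhd[OF assms(2)[unfolded zf_zero_dimensional_def] assms(3,4)] zf_clopen_iff[OF assms(1)] by blast

lemma dfn_clp: "tm a \<Longrightarrow> df (\<lambda>s. clp S (E (a s)))"
proof -
  have *: "clp S (E a) \<longleftrightarrow> a \<in> E (zf_opens S) \<and> (\<exists>u\<in>E (zf_opens S). \<forall>x. x \<in> E u \<longleftrightarrow> x \<in> pts S \<and> x \<notin> E a)" for a
    unfolding clp_def opn_elts opn_def[of S "pts S - E a"] by (auto simp: set_eq_iff)
  assume "tm a"
  then show ?thesis unfolding * by (intro definability trm_weaken)
qed

text \<open>All uses of compactness go through directed covers, which spares intersections of finite families.\<close>

lemma compact_directed:
  assumes "zf_compact mem S" "E C \<subseteq> E (zf_opens S)" "E C \<noteq> {}" "top S"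
    and "\<And>x. x \<in> pts S \<Longrightarrow> \<exists>u\<in>E C. x \<in> E u"
    and dir: "\<And>u v. u \<in> E C \<Longrightarrow> v \<in> E C \<Longrightarrow> \<exists>w\<in>E C. E u \<union> E v \<subseteq> E w"
  shows "\<exists>u\<in>E C. E u = pts S"
proof -
  have sub: "E u \<subseteq> pts S" if "u \<in> E C" for u using assms(2) that opn_subset[OF assms(4), of "E u"] by auto
  have "zf_Union mem C = zf_pts S"
    by (rule elts_eqI) (use assms(5) sub in auto)
  then obtain D where D: "E D \<subseteq> E C" "zf_finite mem D" "zf_Union mem D = zf_pts S"
    using assms(1,2) unfolding zf_compact_def by blast
  obtain u where u: "u \<in> E C" "\<forall>d\<in>E D. E d \<subseteq> E u"
    using finite_directed_bound[OF D(2,1) assms(3) dir] by blast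
  have "pts S = (\<Union>x\<in>E D. E x)" using D(3) elts_zf_Union by metis
  then have "E u = pts S" using u sub by blast
  then show ?thesis using u by blast
qed

end

lemma Collect_pairs_cong:
  assumes "\<And>x y. x \<in> S \<Longrightarrow> y \<in> S \<Longrightarrow> F x y = G x y"
  shows "{F x y | x y. x \<in> S \<and> y \<in> S} = {G x y | x y. x \<in> S \<and> y \<in> S}"
proof -
  have "(z = F x y \<and> x \<in> S \<and> y \<in> S) = (z = G x y \<and> x \<in> S \<and> y \<in> S)" for x y z
    using assms[of x y] by auto
  then show ?thesis by simp
qed

section \<open>The reals of the model as an ordered field\<close>

locale zf_real_model = zf_model mem for mem :: "'v \<Rightarrow> 'v \<Rightarrow> bool" +
  fixes \<R> :: "'v zf_reals"
  assumes complete_ordered_field: "zf_complete_ordered_field mem \<R>"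
begin

abbreviation R :: "'v set" where "R \<equiv> E (zf_R \<R>)"
abbreviation rzero :: 'v ("\<zero>") where "\<zero> \<equiv> zf_zero \<R>"
abbreviation rone :: 'v ("\<one>") where "\<one> \<equiv> zf_one \<R>"

definition radd :: "'v \<Rightarrow> 'v \<Rightarrow> 'v" (infixl "\<oplus>" 65) where
  "x \<oplus> y = val (zf_add \<R>) (pr x y)"

definition rmul :: "'v \<Rightarrow> 'v \<Rightarrow> 'v" (infixl "\<otimes>" 70) where
  "x \<otimes> y = val (zf_mul \<R>) (pr x y)"

abbreviation rlt :: "'v \<Rightarrow> 'v \<Rightarrow> bool" (infix "\<sqsubset>" 50) where
  "x \<sqsubset> y \<equiv> zf_lt mem \<R> x y"

abbreviation rle :: "'v \<Rightarrow> 'v \<Rightarrow> bool" (infix "\<sqsubseteq>" 50) where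
  "x \<sqsubseteq> y \<equiv> zf_le mem \<R> x y"

definition rneg :: "'v \<Rightarrow> 'v" where
  "rneg x = zthe mem (\<lambda>y. y \<in> R \<and> x \<oplus> y = \<zero>)"

definition rinv :: "'v \<Rightarrow> 'v" where
  "rinv x = zthe mem (\<lambda>y. y \<in> R \<and> x \<otimes> y = \<one>)"

lemma trm_radd: "tm t \<Longrightarrow> tm u \<Longrightarrow> tm (\<lambda>s. t s \<oplus> u s)"
  unfolding radd_def by (intro definability)

lemma trm_rmul: "tm t \<Longrightarrow> tm u \<Longrightarrow> tm (\<lambda>s. t s \<otimes> u s)"
  unfolding rmul_def by (intro definability)

lemma trm_rneg: "tm t \<Longrightarrow> tm (\<lambda>s. rneg (t s))"
  unfolding rneg_def by (intro definability trm_radd trm_weaken)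

lemma trm_rinv: "tm t \<Longrightarrow> tm (\<lambda>s. rinv (t s))"
  unfolding rinv_def by (intro definability trm_rmul trm_weaken)

lemma dfn_rlt: "tm t \<Longrightarrow> tm u \<Longrightarrow> df (\<lambda>s. t s \<sqsubset> u s)"
  unfolding zf_lt_def by (intro definability)

lemma dfn_rle: "tm t \<Longrightarrow> tm u \<Longrightarrow> df (\<lambda>s. t s \<sqsubseteq> u s)"
  unfolding zf_le_def by (intro definability dfn_rlt)

lemmas real_definability = definability trm_radd trm_rmul trm_rneg trm_rinv dfn_rlt dfn_rle

lemma radd_fun: "fn (zf_prod mem (zf_R \<R>) (zf_R \<R>)) (zf_R \<R>) (zf_add \<R>)"
  and rmul_fun: "fn (zf_prod mem (zf_R \<R>) (zf_R \<R>)) (zf_R \<R>) (zf_mul \<R>)"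
  using complete_ordered_field unfolding zf_complete_ordered_field_def Let_def by blast+

lemma zero_in [simp]: "\<zero> \<in> R" and one_in [simp]: "\<one> \<in> R" and zero_neq_one: "\<zero> \<noteq> \<one>"
  using complete_ordered_field unfolding zf_complete_ordered_field_def Let_def by blast+

lemma radd_in [simp]: "x \<in> R \<Longrightarrow> y \<in> R \<Longrightarrow> x \<oplus> y \<in> R"
  unfolding radd_def by (rule val_in[OF radd_fun]) simp

lemma rmul_in [simp]: "x \<in> R \<Longrightarrow> y \<in> R \<Longrightarrow> x \<otimes> y \<in> R"
  unfolding rmul_def by (rule val_in[OF rmul_fun]) simp

lemma zf_plus_eq: "x \<in> R \<Longrightarrow> y \<in> R \<Longrightarrow> zf_plus mem \<R> x y = x \<oplus> y"
  unfolding radd_def zf_plus_def by (rule zf_app_eq_val[OF radd_fun]) simp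

lemma zf_times_eq: "x \<in> R \<Longrightarrow> y \<in> R \<Longrightarrow> zf_times mem \<R> x y = x \<otimes> y"
  unfolding rmul_def zf_times_def by (rule zf_app_eq_val[OF rmul_fun]) simp

lemma radd_assoc: "x \<in> R \<Longrightarrow> y \<in> R \<Longrightarrow> z \<in> R \<Longrightarrow> x \<oplus> y \<oplus> z = x \<oplus> (y \<oplus> z)"
proof -
  have "\<forall>x\<in>R. \<forall>y\<in>R. \<forall>z\<in>R. zf_plus mem \<R> (zf_plus mem \<R> x y) z = zf_plus mem \<R> x (zf_plus mem \<R> y z)"
    using complete_ordered_field unfolding zf_complete_ordered_field_def Let_def by (elim conjE) assumption
  then show "x \<in> R \<Longrightarrow> y \<in> R \<Longrightarrow> z \<in> R \<Longrightarrow> x \<oplus> y \<oplus> z = x \<oplus> (y \<oplus> z)" by (simp add: zf_plus_eq)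
qed

lemma rmul_assoc: "x \<in> R \<Longrightarrow> y \<in> R \<Longrightarrow> z \<in> R \<Longrightarrow> x \<otimes> y \<otimes> z = x \<otimes> (y \<otimes> z)"
proof -
  have "\<forall>x\<in>R. \<forall>y\<in>R. \<forall>z\<in>R. zf_times mem \<R> (zf_times mem \<R> x y) z = zf_times mem \<R> x (zf_times mem \<R> y z)"
    using complete_ordered_field unfolding zf_complete_ordered_field_def Let_def by (elim conjE) assumption
  then show "x \<in> R \<Longrightarrow> y \<in> R \<Longrightarrow> z \<in> R \<Longrightarrow> x \<otimes> y \<otimes> z = x \<otimes> (y \<otimes> z)" by (simp add: zf_times_eq)
qed

lemma radd_commute: "x \<in> R \<Longrightarrow> y \<in> R \<Longrightarrow> x \<oplus> y = y \<oplus> x"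
proof -
  have "\<forall>x\<in>R. \<forall>y\<in>R. zf_plus mem \<R> x y = zf_plus mem \<R> y x"
    using complete_ordered_field unfolding zf_complete_ordered_field_def Let_def by (elim conjE) assumption
  then show "x \<in> R \<Longrightarrow> y \<in> R \<Longrightarrow> x \<oplus> y = y \<oplus> x" using zf_plus_eq[of x y] zf_plus_eq[of y x] by simp
qed

lemma rmul_commute: "x \<in> R \<Longrightarrow> y \<in> R \<Longrightarrow> x \<otimes> y = y \<otimes> x"
proof -
  have "\<forall>x\<in>R. \<forall>y\<in>R. zf_times mem \<R> x y = zf_times mem \<R> y x"
    using complete_ordered_field unfolding zf_complete_ordered_field_def Let_def by (elim conjE) assumption
  then show "x \<in> R \<Longrightarrow> y \<in> R \<Longrightarrow> x \<otimes> y = y \<otimes> x" using zf_times_eq[of x y] zf_times_eq[of y x] by simp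
qed

lemma radd_zero [simp]: "x \<in> R \<Longrightarrow> \<zero> \<oplus> x = x"
proof -
  have "\<forall>x\<in>R. zf_plus mem \<R> \<zero> x = x"
    using complete_ordered_field unfolding zf_complete_ordered_field_def Let_def by (elim conjE) assumption
  then show "x \<in> R \<Longrightarrow> \<zero> \<oplus> x = x" by (simp add: zf_plus_eq)
qed

lemma radd_zero_right [simp]: "x \<in> R \<Longrightarrow> x \<oplus> \<zero> = x"
  using radd_commute[of x \<zero>] by simp

lemma rmul_one [simp]: "x \<in> R \<Longrightarrow> \<one> \<otimes> x = x"
proof -
  have "\<forall>x\<in>R. zf_times mem \<R> \<one> x = x"
    using complete_ordered_field unfolding zf_complete_ordered_field_def Let_def by (elim conjE) assumption
  then show "x \<in> R \<Longrightarrow> \<one> \<otimes> x = x" by (simp add: zf_times_eq)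
qed

lemma rmul_one_right [simp]: "x \<in> R \<Longrightarrow> x \<otimes> \<one> = x"
  using rmul_commute[of x \<one>] by simp

lemma distrib_left: "x \<in> R \<Longrightarrow> y \<in> R \<Longrightarrow> z \<in> R \<Longrightarrow> x \<otimes> (y \<oplus> z) = x \<otimes> y \<oplus> x \<otimes> z"
proof -
  have "\<forall>x\<in>R. \<forall>y\<in>R. \<forall>z\<in>R. zf_times mem \<R> x (zf_plus mem \<R> y z) = zf_plus mem \<R> (zf_times mem \<R> x y) (zf_times mem \<R> x z)"
    using complete_ordered_field unfolding zf_complete_ordered_field_def Let_def by (elim conjE) assumption
  then show "x \<in> R \<Longrightarrow> y \<in> R \<Longrightarrow> z \<in> R \<Longrightarrow> x \<otimes> (y \<oplus> z) = x \<otimes> y \<oplus> x \<otimes> z" by (simp add: zf_plus_eq zf_times_eq)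
qed

lemma neg_exists: "x \<in> R \<Longrightarrow> \<exists>y\<in>R. x \<oplus> y = \<zero>"
proof -
  have "\<forall>x\<in>R. \<exists>y\<in>R. zf_plus mem \<R> x y = \<zero>"
    using complete_ordered_field unfolding zf_complete_ordered_field_def Let_def by (elim conjE) assumption
  then show "x \<in> R \<Longrightarrow> \<exists>y\<in>R. x \<oplus> y = \<zero>" using zf_plus_eq by metis
qed

lemma inv_exists: "x \<in> R \<Longrightarrow> x \<noteq> \<zero> \<Longrightarrow> \<exists>y\<in>R. x \<otimes> y = \<one>"
proof -
  have "\<forall>x\<in>R. x \<noteq> \<zero> \<longrightarrow> (\<exists>y\<in>R. zf_times mem \<R> x y = \<one>)"
    using complete_ordered_field unfolding zf_complete_ordered_field_def Let_def by (elim conjE) assumption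
  then show "x \<in> R \<Longrightarrow> x \<noteq> \<zero> \<Longrightarrow> \<exists>y\<in>R. x \<otimes> y = \<one>" using zf_times_eq by metis
qed

lemma lt_irrefl [simp]: "x \<in> R \<Longrightarrow> \<not> x \<sqsubset> x"
proof -
  have "\<forall>x\<in>R. \<not> x \<sqsubset> x"
    using complete_ordered_field unfolding zf_complete_ordered_field_def Let_def by (elim conjE) assumption
  then show "x \<in> R \<Longrightarrow> \<not> x \<sqsubset> x" by blast
qed

lemma lt_trans: "x \<sqsubset> y \<Longrightarrow> y \<sqsubset> z \<Longrightarrow> x \<in> R \<Longrightarrow> y \<in> R \<Longrightarrow> z \<in> R \<Longrightarrow> x \<sqsubset> z"
proof -
  have "\<forall>x\<in>R. \<forall>y\<in>R. \<forall>z\<in>R. x \<sqsubset> y \<and> y \<sqsubset> z \<longrightarrow> x \<sqsubset> z"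
    using complete_ordered_field unfolding zf_complete_ordered_field_def Let_def by (elim conjE) assumption
  then show "x \<sqsubset> y \<Longrightarrow> y \<sqsubset> z \<Longrightarrow> x \<in> R \<Longrightarrow> y \<in> R \<Longrightarrow> z \<in> R \<Longrightarrow> x \<sqsubset> z" by blast
qed

lemma lt_linear: "x \<in> R \<Longrightarrow> y \<in> R \<Longrightarrow> x \<sqsubset> y \<or> x = y \<or> y \<sqsubset> x"
proof -
  have "\<forall>x\<in>R. \<forall>y\<in>R. x \<sqsubset> y \<or> x = y \<or> y \<sqsubset> x"
    using complete_ordered_field unfolding zf_complete_ordered_field_def Let_def by (elim conjE) assumption
  then show "x \<in> R \<Longrightarrow> y \<in> R \<Longrightarrow> x \<sqsubset> y \<or> x = y \<or> y \<sqsubset> x" by blast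
qed

lemma lt_add: "x \<sqsubset> y \<Longrightarrow> x \<in> R \<Longrightarrow> y \<in> R \<Longrightarrow> z \<in> R \<Longrightarrow> x \<oplus> z \<sqsubset> y \<oplus> z"
proof -
  have "\<forall>x\<in>R. \<forall>y\<in>R. \<forall>z\<in>R. x \<sqsubset> y \<longrightarrow> zf_plus mem \<R> x z \<sqsubset> zf_plus mem \<R> y z"
    using complete_ordered_field unfolding zf_complete_ordered_field_def Let_def by (elim conjE) assumption
  then show "x \<sqsubset> y \<Longrightarrow> x \<in> R \<Longrightarrow> y \<in> R \<Longrightarrow> z \<in> R \<Longrightarrow> x \<oplus> z \<sqsubset> y \<oplus> z" by (simp add: zf_plus_eq)
qed

lemma mul_pos: "\<zero> \<sqsubset> x \<Longrightarrow> \<zero> \<sqsubset> y \<Longrightarrow> x \<in> R \<Longrightarrow> y \<in> R \<Longrightarrow> \<zero> \<sqsubset> x \<otimes> y"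
proof -
  have "\<forall>x\<in>R. \<forall>y\<in>R. \<zero> \<sqsubset> x \<and> \<zero> \<sqsubset> y \<longrightarrow> \<zero> \<sqsubset> zf_times mem \<R> x y"
    using complete_ordered_field unfolding zf_complete_ordered_field_def Let_def by (elim conjE) assumption
  then show "\<zero> \<sqsubset> x \<Longrightarrow> \<zero> \<sqsubset> y \<Longrightarrow> x \<in> R \<Longrightarrow> y \<in> R \<Longrightarrow> \<zero> \<sqsubset> x \<otimes> y" by (simp add: zf_times_eq)
qed

lemma sup_exists:
  "E D \<subseteq> R \<Longrightarrow> E D \<noteq> {} \<Longrightarrow> u \<in> R \<Longrightarrow> \<forall>x\<in>E D. x \<sqsubseteq> u \<Longrightarrow> \<exists>s. zf_is_sup mem \<R> (E D) s"
proof -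
  have "\<forall>D. E D \<subseteq> R \<and> E D \<noteq> {} \<and> (\<exists>u\<in>R. \<forall>x\<in>E D. x \<sqsubseteq> u) \<longrightarrow> (\<exists>s. zf_is_sup mem \<R> (E D) s)"
    using complete_ordered_field unfolding zf_complete_ordered_field_def Let_def by (elim conjE) assumption
  then show "E D \<subseteq> R \<Longrightarrow> E D \<noteq> {} \<Longrightarrow> u \<in> R \<Longrightarrow> \<forall>x\<in>E D. x \<sqsubseteq> u \<Longrightarrow> \<exists>s. zf_is_sup mem \<R> (E D) s" by blast
qed

lemma radd_left_commute: "x \<in> R \<Longrightarrow> y \<in> R \<Longrightarrow> z \<in> R \<Longrightarrow> x \<oplus> (y \<oplus> z) = y \<oplus> (x \<oplus> z)"
  using radd_assoc[of x y z] radd_assoc[of y x z] radd_commute[of x y] by simp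

lemma rmul_left_commute: "x \<in> R \<Longrightarrow> y \<in> R \<Longrightarrow> z \<in> R \<Longrightarrow> x \<otimes> (y \<otimes> z) = y \<otimes> (x \<otimes> z)"
  using rmul_assoc[of x y z] rmul_assoc[of y x z] rmul_commute[of x y] by simp

lemmas radd_ac = radd_assoc radd_commute radd_left_commute

lemma radd_cancel: "x \<oplus> z = y \<oplus> z \<Longrightarrow> x \<in> R \<Longrightarrow> y \<in> R \<Longrightarrow> z \<in> R \<Longrightarrow> x = y"
proof -
  assume *: "x \<oplus> z = y \<oplus> z" "x \<in> R" "y \<in> R" "z \<in> R"
  obtain w where w: "w \<in> R" "z \<oplus> w = \<zero>" using neg_exists *(4) by blast
  have "x \<oplus> (z \<oplus> w) = y \<oplus> (z \<oplus> w)" using * w(1) by (simp only: radd_assoc[symmetric])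
  then show "x = y" using w * by simp
qed

lemma rneg_in [simp]: "x \<in> R \<Longrightarrow> rneg x \<in> R" and radd_neg [simp]: "x \<in> R \<Longrightarrow> x \<oplus> rneg x = \<zero>"
proof -
  assume x: "x \<in> R"
  then obtain y where y: "y \<in> R" "x \<oplus> y = \<zero>" using neg_exists by blast
  have u: "z = y" if "z \<in> R" "x \<oplus> z = \<zero>" for z
    using radd_cancel[of z x y] radd_commute[of x] x y that by simp
  have "rneg x = y" unfolding rneg_def
  proof (rule zthe_eq)
    show "y \<in> R \<and> x \<oplus> y = \<zero>" using y by blast
  qed (use u in blast)
  with y show "rneg x \<in> R" "x \<oplus> rneg x = \<zero>" by auto
qed

lemma rinv_in: "x \<in> R \<Longrightarrow> x \<noteq> \<zero> \<Longrightarrow> rinv x \<in> R" and rmul_inv: "x \<in> R \<Longrightarrow> x \<noteq> \<zero> \<Longrightarrow> x \<otimes> rinv x = \<one>"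
proof -
  assume x: "x \<in> R" "x \<noteq> \<zero>"
  then obtain y where y: "y \<in> R" "x \<otimes> y = \<one>" using inv_exists by blast
  have "z = y" if "z \<in> R" "x \<otimes> z = \<one>" for z
  proof -
    have "z = (x \<otimes> y) \<otimes> z" using y that by simp
    also have "\<dots> = y \<otimes> (x \<otimes> z)" using x y(1) that(1) rmul_assoc[of x y z] rmul_left_commute[of x y z] by simp
    also have "\<dots> = y" using y that by simp
    finally show ?thesis .
  qed
  then have u: "z = y" if "z \<in> R \<and> x \<otimes> z = \<one>" for z using that by blast
  have "rinv x = y" unfolding rinv_def
  proof (rule zthe_eq)
    show "y \<in> R \<and> x \<otimes> y = \<one>" using y by blast
  qed (rule u)
  with y show "rinv x \<in> R" "x \<otimes> rinv x = \<one>" by auto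
qed

lemma neg_eqI: "x \<oplus> y = \<zero> \<Longrightarrow> x \<in> R \<Longrightarrow> y \<in> R \<Longrightarrow> rneg x = y"
  using radd_cancel[of "rneg x" x y] radd_commute[of x "rneg x"] radd_commute[of x y] by simp

lemma neg_neg [simp]: "x \<in> R \<Longrightarrow> rneg (rneg x) = x"
  by (rule neg_eqI) (simp_all add: radd_commute)

lemma mul_zero [simp]: "x \<in> R \<Longrightarrow> \<zero> \<otimes> x = \<zero>"
proof -
  assume x: "x \<in> R"
  have "x \<otimes> \<zero> \<oplus> x \<otimes> \<zero> = x \<otimes> (\<zero> \<oplus> \<zero>)" using x by (simp only: distrib_left zero_in)
  also have "\<dots> = \<zero> \<oplus> x \<otimes> \<zero>" using x by simp
  finally have "x \<otimes> \<zero> = \<zero>" by (rule radd_cancel) (simp_all add: x)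
  then show ?thesis using rmul_commute[of x \<zero>] x by simp
qed

lemma mul_zero_right [simp]: "x \<in> R \<Longrightarrow> x \<otimes> \<zero> = \<zero>"
  using mul_zero rmul_commute[of x \<zero>] by simp

lemma mul_eq_zero: "x \<otimes> y = \<zero> \<Longrightarrow> x \<in> R \<Longrightarrow> y \<in> R \<Longrightarrow> x = \<zero> \<or> y = \<zero>"
proof (rule disjCI)
  assume *: "x \<otimes> y = \<zero>" "x \<in> R" "y \<in> R" "y \<noteq> \<zero>"
  have "x = x \<otimes> (y \<otimes> rinv y)" using * by (simp add: rmul_inv)
  also have "\<dots> = (x \<otimes> y) \<otimes> rinv y" using *(2-4) rmul_assoc[of x y "rinv y"] rinv_in by simp
  also have "\<dots> = \<zero>" using * by (simp add: rinv_in)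
  finally show "x = \<zero>" .
qed

lemma mul_neg: "x \<in> R \<Longrightarrow> y \<in> R \<Longrightarrow> x \<otimes> rneg y = rneg (x \<otimes> y)"
proof -
  assume x: "x \<in> R" "y \<in> R"
  have "x \<otimes> y \<oplus> x \<otimes> rneg y = x \<otimes> (y \<oplus> rneg y)" using x by (simp only: distrib_left rneg_in)
  also have "\<dots> = \<zero>" using x by simp
  finally show ?thesis using neg_eqI[of "x \<otimes> y" "x \<otimes> rneg y"] x by simp
qed

text \<open>This is what makes the images of characteristic functions two-valued.\<close>

lemma idempotent_cases: "x \<otimes> x = x \<Longrightarrow> x \<in> R \<Longrightarrow> x = \<zero> \<or> x = \<one>"
proof (rule disjCI)
  assume *: "x \<otimes> x = x" "x \<in> R" "x \<noteq> \<one>"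
  show "x = \<zero>"
  proof (rule ccontr)
    assume n: "x \<noteq> \<zero>"
    have "x = x \<otimes> (x \<otimes> rinv x)" using * n by (simp add: rmul_inv)
    also have "\<dots> = (x \<otimes> x) \<otimes> rinv x" using *(2) n rmul_assoc[of x x "rinv x"] rinv_in by simp
    also have "\<dots> = \<one>" using * n by (simp add: rmul_inv)
    finally show False using *(3) by simp
  qed
qed

lemma le_refl [simp]: "x \<sqsubseteq> x" unfolding zf_le_def by simp
lemma lt_imp_le: "x \<sqsubset> y \<Longrightarrow> x \<sqsubseteq> y" unfolding zf_le_def by simp
lemma le_trans: "x \<sqsubseteq> y \<Longrightarrow> y \<sqsubseteq> z \<Longrightarrow> x \<in> R \<Longrightarrow> y \<in> R \<Longrightarrow> z \<in> R \<Longrightarrow> x \<sqsubseteq> z"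
  unfolding zf_le_def using lt_trans by blast
lemma lt_le_trans: "x \<sqsubset> y \<Longrightarrow> y \<sqsubseteq> z \<Longrightarrow> x \<in> R \<Longrightarrow> y \<in> R \<Longrightarrow> z \<in> R \<Longrightarrow> x \<sqsubset> z"
  unfolding zf_le_def using lt_trans by blast
lemma le_lt_trans: "x \<sqsubseteq> y \<Longrightarrow> y \<sqsubset> z \<Longrightarrow> x \<in> R \<Longrightarrow> y \<in> R \<Longrightarrow> z \<in> R \<Longrightarrow> x \<sqsubset> z"
  unfolding zf_le_def using lt_trans by blast
lemma le_antisym: "x \<sqsubseteq> y \<Longrightarrow> y \<sqsubseteq> x \<Longrightarrow> x \<in> R \<Longrightarrow> y \<in> R \<Longrightarrow> x = y"
  unfolding zf_le_def using lt_trans lt_irrefl by blast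
lemma not_lt: "x \<in> R \<Longrightarrow> y \<in> R \<Longrightarrow> \<not> x \<sqsubset> y \<longleftrightarrow> y \<sqsubseteq> x"
  unfolding zf_le_def using lt_linear[of x y] lt_trans[of x y x] lt_irrefl[of x] by blast
lemma not_le: "x \<in> R \<Longrightarrow> y \<in> R \<Longrightarrow> \<not> x \<sqsubseteq> y \<longleftrightarrow> y \<sqsubset> x"
  using not_lt by blast
lemma le_linear: "x \<in> R \<Longrightarrow> y \<in> R \<Longrightarrow> x \<sqsubseteq> y \<or> y \<sqsubseteq> x"
  unfolding zf_le_def using lt_linear by blast

lemma le_add: "x \<sqsubseteq> y \<Longrightarrow> x \<in> R \<Longrightarrow> y \<in> R \<Longrightarrow> z \<in> R \<Longrightarrow> x \<oplus> z \<sqsubseteq> y \<oplus> z"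
  unfolding zf_le_def using lt_add by blast

lemma add_mono: "a \<sqsubseteq> b \<Longrightarrow> c \<sqsubseteq> d \<Longrightarrow> a \<in> R \<Longrightarrow> b \<in> R \<Longrightarrow> c \<in> R \<Longrightarrow> d \<in> R \<Longrightarrow> a \<oplus> c \<sqsubseteq> b \<oplus> d"
  using le_add[of a b c] le_add[of c d b] le_trans[of "a \<oplus> c" "b \<oplus> c" "b \<oplus> d"] radd_commute[of _ b] by simp

lemma add_le_cancel: "x \<oplus> z \<sqsubseteq> y \<oplus> z \<Longrightarrow> x \<in> R \<Longrightarrow> y \<in> R \<Longrightarrow> z \<in> R \<Longrightarrow> x \<sqsubseteq> y"
  using lt_add[of y x z] not_lt[of y x] not_lt[of "y \<oplus> z" "x \<oplus> z"] by auto

lemma add_lt_cancel: "x \<oplus> z \<sqsubset> y \<oplus> z \<Longrightarrow> x \<in> R \<Longrightarrow> y \<in> R \<Longrightarrow> z \<in> R \<Longrightarrow> x \<sqsubset> y"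
  using le_add[of y x z] not_lt[of x y] not_lt[of "x \<oplus> z" "y \<oplus> z"] by auto

lemma lt_add_pos: "\<zero> \<sqsubset> e \<Longrightarrow> x \<in> R \<Longrightarrow> e \<in> R \<Longrightarrow> x \<sqsubset> x \<oplus> e"
  using lt_add[of \<zero> e x] radd_commute[of e x] by simp

lemma diff_pos: "a \<sqsubset> b \<Longrightarrow> a \<in> R \<Longrightarrow> b \<in> R \<Longrightarrow> \<exists>d\<in>R. \<zero> \<sqsubset> d \<and> b = a \<oplus> d"
proof (rule bexI[of _ "b \<oplus> rneg a"], rule conjI)
  assume *: "a \<sqsubset> b" "a \<in> R" "b \<in> R"
  show "\<zero> \<sqsubset> b \<oplus> rneg a" using lt_add[OF *, of "rneg a"] * by simp
  show "b = a \<oplus> (b \<oplus> rneg a)" using * radd_left_commute[of a b "rneg a"] by simp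
  show "b \<oplus> rneg a \<in> R" using * by simp
qed

lemma mul_lt: "a \<sqsubset> b \<Longrightarrow> \<zero> \<sqsubset> c \<Longrightarrow> a \<in> R \<Longrightarrow> b \<in> R \<Longrightarrow> c \<in> R \<Longrightarrow> c \<otimes> a \<sqsubset> c \<otimes> b"
proof -
  assume *: "a \<sqsubset> b" "\<zero> \<sqsubset> c" "a \<in> R" "b \<in> R" "c \<in> R"
  then obtain d where d: "d \<in> R" "\<zero> \<sqsubset> d" "b = a \<oplus> d" using diff_pos by blast
  show ?thesis unfolding d(3) using * d by (simp add: distrib_left lt_add_pos mul_pos)
qed

lemma mul_le: "a \<sqsubseteq> b \<Longrightarrow> \<zero> \<sqsubseteq> c \<Longrightarrow> a \<in> R \<Longrightarrow> b \<in> R \<Longrightarrow> c \<in> R \<Longrightarrow> c \<otimes> a \<sqsubseteq> c \<otimes> b"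
  using mul_lt[of a b c] unfolding zf_le_def by auto

lemma neg_le: "a \<sqsubseteq> b \<Longrightarrow> a \<in> R \<Longrightarrow> b \<in> R \<Longrightarrow> rneg b \<sqsubseteq> rneg a"
proof -
  assume *: "a \<sqsubseteq> b" "a \<in> R" "b \<in> R"
  have "a \<oplus> (rneg a \<oplus> rneg b) \<sqsubseteq> b \<oplus> (rneg a \<oplus> rneg b)" using * by (intro le_add) auto
  moreover have "a \<oplus> (rneg a \<oplus> rneg b) = rneg b" using * radd_assoc[of a "rneg a" "rneg b"] by simp
  moreover have "b \<oplus> (rneg a \<oplus> rneg b) = rneg a" using * radd_left_commute[of b "rneg a" "rneg b"] by simp
  ultimately show ?thesis by simp
qed

lemma one_pos: "\<zero> \<sqsubset> \<one>"
proof (rule ccontr)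
  assume "\<not> \<zero> \<sqsubset> \<one>"
  then have "\<one> \<sqsubset> \<zero>" using lt_linear[of \<zero> \<one>] zero_neq_one by auto
  then have *: "\<zero> \<sqsubset> rneg \<one>" using lt_add[of \<one> \<zero> "rneg \<one>"] by simp
  have "rneg \<one> \<otimes> rneg \<one> = \<one>" by (simp add: mul_neg)
  then have "\<zero> \<sqsubset> \<one>" using mul_pos[OF * *] by simp
  with \<open>\<not> \<zero> \<sqsubset> \<one>\<close> show False ..
qed

lemma pos_neq_zero: "\<zero> \<sqsubset> x \<Longrightarrow> x \<noteq> \<zero>"
  using lt_irrefl[of \<zero>] by auto

lemma inv_pos: "\<zero> \<sqsubset> x \<Longrightarrow> x \<in> R \<Longrightarrow> \<zero> \<sqsubset> rinv x"
proof (rule ccontr)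
  assume *: "\<zero> \<sqsubset> x" "x \<in> R" "\<not> \<zero> \<sqsubset> rinv x"
  then have i: "rinv x \<in> R" "x \<otimes> rinv x = \<one>" using rinv_in rmul_inv pos_neq_zero by auto
  then have "rinv x \<sqsubseteq> \<zero>" using *(3) not_lt by auto
  then have "\<one> \<sqsubseteq> \<zero>" using mul_le[of "rinv x" \<zero> x] i * lt_imp_le by simp
  then show False using one_pos le_lt_trans[of \<one> \<zero> \<one>] by simp
qed

lemma add_pos: "\<zero> \<sqsubset> x \<Longrightarrow> \<zero> \<sqsubset> y \<Longrightarrow> x \<in> R \<Longrightarrow> y \<in> R \<Longrightarrow> \<zero> \<sqsubset> x \<oplus> y"
  using lt_add_pos[of y x] lt_trans[of \<zero> x "x \<oplus> y"] by simp

lemma half_exists: "\<zero> \<sqsubset> d \<Longrightarrow> d \<in> R \<Longrightarrow> \<exists>e\<in>R. \<zero> \<sqsubset> e \<and> e \<oplus> e = d"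
proof -
  assume d: "\<zero> \<sqsubset> d" "d \<in> R"
  let ?t = "\<one> \<oplus> \<one>"
  have t: "\<zero> \<sqsubset> ?t" by (simp add: add_pos one_pos)
  then have i: "rinv ?t \<in> R" "?t \<otimes> rinv ?t = \<one>" "\<zero> \<sqsubset> rinv ?t"
    using rinv_in rmul_inv inv_pos pos_neq_zero by auto
  let ?e = "d \<otimes> rinv ?t"
  have "?e \<oplus> ?e = d \<otimes> (rinv ?t \<otimes> \<one> \<oplus> rinv ?t \<otimes> \<one>)" using d i by (simp add: distrib_left)
  also have "\<dots> = d \<otimes> (rinv ?t \<otimes> ?t)" using i by (simp only: distrib_left one_in)
  also have "\<dots> = d" using d i by (simp add: rmul_commute[of "rinv ?t"])
  finally show ?thesis using d i mul_pos by (intro bexI[of _ ?e]) auto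
qed

lemma dense: "a \<sqsubset> x \<Longrightarrow> a \<in> R \<Longrightarrow> x \<in> R \<Longrightarrow> \<exists>e\<in>R. \<zero> \<sqsubset> e \<and> a \<oplus> e \<sqsubset> x"
proof -
  assume *: "a \<sqsubset> x" "a \<in> R" "x \<in> R"
  obtain d where d: "d \<in> R" "\<zero> \<sqsubset> d" "x = a \<oplus> d" using diff_pos[OF *] by blast
  obtain e where e: "e \<in> R" "\<zero> \<sqsubset> e" "e \<oplus> e = d" using half_exists d by blast
  have "a \<oplus> e \<sqsubset> (a \<oplus> e) \<oplus> e" using e * by (intro lt_add_pos) auto
  then have "a \<oplus> e \<sqsubset> x" using d e * by (simp add: radd_assoc)
  then show ?thesis using e by blast
qed

lemma pos_min: "\<zero> \<sqsubset> a \<Longrightarrow> \<zero> \<sqsubset> b \<Longrightarrow> a \<in> R \<Longrightarrow> b \<in> R \<Longrightarrow> \<exists>e\<in>R. \<zero> \<sqsubset> e \<and> e \<sqsubseteq> a \<and> e \<sqsubseteq> b"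
  using le_linear[of a b] le_refl by blast

text \<open>The distance of \<open>a\<close> and \<open>b\<close> is at most \<open>e\<close>, expressed without subtraction.\<close>

definition close :: "'v \<Rightarrow> 'v \<Rightarrow> 'v \<Rightarrow> bool" where
  "close e a b \<longleftrightarrow> a \<sqsubseteq> b \<oplus> e \<and> b \<sqsubseteq> a \<oplus> e"

lemma close_refl: "\<zero> \<sqsubset> e \<Longrightarrow> a \<in> R \<Longrightarrow> e \<in> R \<Longrightarrow> close e a a"
  unfolding close_def using lt_add_pos lt_imp_le by blast

lemma close_sym: "close e a b \<longleftrightarrow> close e b a"
  unfolding close_def by auto

text \<open>The bridge from the oscillation, which is defined by absolute values of differences; the explicit
formula is there because the set of these values must be definable.\<close>

lemma abs_minus_le:
  assumes "a \<in> R" "b \<in> R" "e \<in> R"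
  shows "zf_abs mem \<R> (zf_minus mem \<R> a b) \<sqsubseteq> e \<longleftrightarrow> close e a b"
    and "zf_abs mem \<R> (zf_minus mem \<R> a b) \<in> R"
    and "zf_abs mem \<R> (zf_minus mem \<R> a b) = 
      (if a \<oplus> rneg b \<sqsubset> \<zero> then rneg (a \<oplus> rneg b) else a \<oplus> rneg b)"
proof -
  have minus: "zf_minus mem \<R> x y = x \<oplus> rneg y" if "x \<in> R" "y \<in> R" for x y
    unfolding zf_minus_def
  proof (rule the_equality, intro conjI)
    show "zf_plus mem \<R> (x \<oplus> rneg y) y = x"
      using that by (simp add: zf_plus_eq radd_assoc radd_commute[of "rneg y"])
    fix z assume "z \<in> R \<and> zf_plus mem \<R> z y = x"
    then have z: "z \<in> R" "x = z \<oplus> y" using that by (auto simp: zf_plus_eq)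
    then show "z = x \<oplus> rneg y" using that by (simp add: radd_assoc)
  qed (use that in simp)
  show 3: "zf_abs mem \<R> (zf_minus mem \<R> a b) = 
      (if a \<oplus> rneg b \<sqsubset> \<zero> then rneg (a \<oplus> rneg b) else a \<oplus> rneg b)"
    using assms by (simp add: zf_abs_def minus)
  show "zf_abs mem \<R> (zf_minus mem \<R> a b) \<in> R" unfolding 3 using assms by simp
  let ?d = "a \<oplus> rneg b"
  have d: "?d \<in> R" using assms by simp
  have 1: "a \<sqsubseteq> b \<oplus> e \<longleftrightarrow> ?d \<sqsubseteq> e"
  proof
    assume "a \<sqsubseteq> b \<oplus> e"
    then have "?d \<sqsubseteq> b \<oplus> e \<oplus> rneg b" using assms by (intro le_add) auto
    also have "b \<oplus> e \<oplus> rneg b = e" using assms radd_left_commute[of b e "rneg b"] by (simp add: radd_assoc)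
    finally show "?d \<sqsubseteq> e" .
  next
    assume "?d \<sqsubseteq> e"
    then have "?d \<oplus> b \<sqsubseteq> e \<oplus> b" using assms by (intro le_add) auto
    moreover have "?d \<oplus> b = a" using assms radd_assoc[of a "rneg b" b] radd_commute[of "rneg b" b] by simp
    ultimately show "a \<sqsubseteq> b \<oplus> e" using assms radd_commute[of e b] by simp
  qed
  have 2: "b \<sqsubseteq> a \<oplus> e \<longleftrightarrow> rneg ?d \<sqsubseteq> e"
  proof
    assume "b \<sqsubseteq> a \<oplus> e"
    then have "b \<oplus> (rneg ?d \<oplus> rneg b) \<sqsubseteq> a \<oplus> e \<oplus> (rneg ?d \<oplus> rneg b)" using assms by (intro le_add) auto
    also have "a \<oplus> e \<oplus> (rneg ?d \<oplus> rneg b) = (?d \<oplus> rneg ?d) \<oplus> e" using assms by (simp only: radd_ac radd_in rneg_in)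
    also have "\<dots> = e" using assms by simp
    also have "b \<oplus> (rneg ?d \<oplus> rneg b) = (b \<oplus> rneg b) \<oplus> rneg ?d" using assms by (simp only: radd_ac radd_in rneg_in)
    also have "\<dots> = rneg ?d" using assms by simp
    finally show "rneg ?d \<sqsubseteq> e" .
  next
    assume "rneg ?d \<sqsubseteq> e"
    then have "rneg ?d \<oplus> a \<sqsubseteq> e \<oplus> a" using assms by (intro le_add) auto
    moreover have "rneg ?d \<oplus> a = b"
    proof -
      have "?d \<oplus> b = a" using assms radd_assoc[of a "rneg b" b] radd_commute[of "rneg b" b] by simp
      then have "rneg ?d \<oplus> a = rneg ?d \<oplus> (?d \<oplus> b)" by simp
      also have "\<dots> = (?d \<oplus> rneg ?d) \<oplus> b" using assms by (simp only: radd_ac radd_in rneg_in)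
      finally show ?thesis using assms by simp
    qed
    ultimately show "b \<sqsubseteq> a \<oplus> e" using assms by (simp add: radd_commute[of _ a])
  qed
  show "zf_abs mem \<R> (zf_minus mem \<R> a b) \<sqsubseteq> e \<longleftrightarrow> close e a b"
  proof (cases "?d \<sqsubset> \<zero>")
    case True
    have "\<zero> \<sqsubseteq> rneg ?d" using neg_le[of ?d \<zero>] lt_imp_le[OF True] d neg_eqI[of \<zero> \<zero>] by simp
    then have "?d \<sqsubseteq> rneg ?d" using lt_imp_le[OF True] le_trans[of ?d \<zero> "rneg ?d"] d by simp
    then show ?thesis unfolding 3 close_def 1 2 using True le_trans[of ?d "rneg ?d" e] d assms by auto
  next
    case False
    then have "\<zero> \<sqsubseteq> ?d" using not_lt d by simp
    then have "rneg ?d \<sqsubseteq> \<zero>" using neg_le[of \<zero> ?d] d neg_eqI[of \<zero> \<zero>] by simp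
    then have "rneg ?d \<sqsubseteq> ?d" using \<open>\<zero> \<sqsubseteq> ?d\<close> le_trans[of "rneg ?d" \<zero> ?d] d by simp
    then show ?thesis unfolding 3 close_def 1 2 using False le_trans[of "rneg ?d" ?d e] d assms by auto
  qed
qed

section \<open>Uniformly continuous real functions\<close>

lemma trm_compose: 
  assumes "tm (\<lambda>s. F (s 0))" "tm t"
  shows "tm (\<lambda>s. F (t s))"
  unfolding trm_def
proof (rule dfn_subst[OF trm_weaken[OF assms(2)]])
  show "df (\<lambda>s. s (Suc 0) = F (s 0))" by (intro dfn_eq trm_var assms(1))
qed

text \<open>The functions that operate on both rings: uniform continuity preserves the covers of small
oscillation, and boundedness on bounded intervals preserves boundedness.\<close>

definition unif :: "('v \<Rightarrow> 'v) \<Rightarrow> bool" where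
  "unif F \<longleftrightarrow> tm (\<lambda>s. F (s 0)) \<and> (\<forall>a\<in>R. F a \<in> R) \<and>
    (\<forall>e\<in>R. \<zero> \<sqsubset> e \<longrightarrow> (\<exists>d\<in>R. \<zero> \<sqsubset> d \<and> (\<forall>a\<in>R. \<forall>b\<in>R. close d a b \<longrightarrow> close e (F a) (F b)))) \<and>
    (\<forall>u\<in>R. \<forall>v\<in>R. \<exists>u'\<in>R. \<exists>v'\<in>R. \<forall>a\<in>R. u \<sqsubseteq> a \<and> a \<sqsubseteq> v \<longrightarrow> u' \<sqsubseteq> F a \<and> F a \<sqsubseteq> v')"

lemma unif_trm: "unif F \<Longrightarrow> tm (\<lambda>s. F (s 0))" and unif_in: "unif F \<Longrightarrow> a \<in> R \<Longrightarrow> F a \<in> R"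
  and unif_close: "unif F \<Longrightarrow> e \<in> R \<Longrightarrow> \<zero> \<sqsubset> e \<Longrightarrow>
    \<exists>d\<in>R. \<zero> \<sqsubset> d \<and> (\<forall>a\<in>R. \<forall>b\<in>R. close d a b \<longrightarrow> close e (F a) (F b))"
  and unif_bounded: "unif F \<Longrightarrow> u \<in> R \<Longrightarrow> v \<in> R \<Longrightarrow>
    \<exists>u'\<in>R. \<exists>v'\<in>R. \<forall>a\<in>R. u \<sqsubseteq> a \<and> a \<sqsubseteq> v \<longrightarrow> u' \<sqsubseteq> F a \<and> F a \<sqsubseteq> v'"
  unfolding unif_def by blast+

lemma unifI:
  assumes "tm (\<lambda>s. F (s 0))" "\<And>a. a \<in> R \<Longrightarrow> F a \<in> R"
    and "\<And>e. e \<in> R \<Longrightarrow> \<zero> \<sqsubset> e \<Longrightarrow> \<exists>d\<in>R. \<zero> \<sqsubset> d \<and> (\<forall>a\<in>R. \<forall>b\<in>R. close d a b \<longrightarrow> F a \<sqsubseteq> F b \<oplus> e)"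
    and "\<And>u v. u \<in> R \<Longrightarrow> v \<in> R \<Longrightarrow> \<exists>u'\<in>R. \<exists>v'\<in>R. \<forall>a\<in>R. u \<sqsubseteq> a \<and> a \<sqsubseteq> v \<longrightarrow> u' \<sqsubseteq> F a \<and> F a \<sqsubseteq> v'"
  shows "unif F"
  unfolding unif_def
proof (intro conjI ballI impI assms(1,2,4))
  fix e assume "e \<in> R" "\<zero> \<sqsubset> e"
  from assms(3)[OF this] obtain d where d: "d \<in> R" "\<zero> \<sqsubset> d" "\<And>a b. a \<in> R \<Longrightarrow> b \<in> R \<Longrightarrow> close d a b \<Longrightarrow> F a \<sqsubseteq> F b \<oplus> e" by blast
  have "close e (F a) (F b)" if "a \<in> R" "b \<in> R" "close d a b" for a b
    using d(3)[of a b] d(3)[of b a] that close_sym[of d a b] unfolding close_def[of e] by blast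
  with d show "\<exists>d\<in>R. \<zero> \<sqsubset> d \<and> (\<forall>a\<in>R. \<forall>b\<in>R. close d a b \<longrightarrow> close e (F a) (F b))" by blast
qed

lemma unif_reflect:
  assumes c: "c \<in> R"
  shows "unif (\<lambda>a. c \<oplus> rneg a)"
proof (rule unifI)
  show "tm (\<lambda>s. c \<oplus> rneg (s 0))" by (intro real_definability)
  show "c \<oplus> rneg a \<in> R" if "a \<in> R" for a using that c by simp
next
  fix e assume e: "e \<in> R" "\<zero> \<sqsubset> e"
  have "c \<oplus> rneg a \<sqsubseteq> c \<oplus> rneg b \<oplus> e" if ab: "a \<in> R" "b \<in> R" "close e a b" for a b
  proof -
    let ?t = "c \<oplus> (rneg a \<oplus> rneg b)"
    have t: "?t \<in> R" using ab c by simp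
    have "b \<oplus> ?t \<sqsubseteq> (a \<oplus> e) \<oplus> ?t" using ab e t unfolding close_def by (intro le_add) auto
    moreover have "b \<oplus> ?t = c \<oplus> rneg a"
    proof -
      have "b \<oplus> ?t = c \<oplus> (b \<oplus> (rneg a \<oplus> rneg b))" by (rule radd_left_commute) (use ab c in auto)
      also have "b \<oplus> (rneg a \<oplus> rneg b) = rneg a \<oplus> (b \<oplus> rneg b)" by (rule radd_left_commute) (use ab in auto)
      finally show ?thesis using ab by simp
    qed
    moreover have "(a \<oplus> e) \<oplus> ?t = c \<oplus> rneg b \<oplus> e"
    proof -
      have "(a \<oplus> e) \<oplus> ?t = c \<oplus> ((a \<oplus> e) \<oplus> (rneg a \<oplus> rneg b))" by (rule radd_left_commute) (use ab c e in auto)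
      also have "(a \<oplus> e) \<oplus> (rneg a \<oplus> rneg b) = (e \<oplus> (a \<oplus> rneg a)) \<oplus> rneg b"
        using ab e radd_commute[of a e] radd_assoc[of a "rneg a" "rneg b"] by (simp add: radd_assoc)
      also have "\<dots> = rneg b \<oplus> e" using ab e radd_commute[of e "rneg b"] by simp
      finally show ?thesis using ab c e by (simp add: radd_assoc)
    qed
    ultimately show ?thesis by simp
  qed
  then show "\<exists>d\<in>R. \<zero> \<sqsubset> d \<and> (\<forall>a\<in>R. \<forall>b\<in>R. close d a b \<longrightarrow> c \<oplus> rneg a \<sqsubseteq> c \<oplus> rneg b \<oplus> e)"
    using e by blast
next
  fix u v assume uv: "u \<in> R" "v \<in> R"
  have mono: "c \<oplus> rneg b \<sqsubseteq> c \<oplus> rneg a" if "a \<sqsubseteq> b" "a \<in> R" "b \<in> R" for a b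
    using add_mono[of c c "rneg b" "rneg a"] neg_le[OF that] that c by simp
  show "\<exists>u'\<in>R. \<exists>v'\<in>R. \<forall>a\<in>R. u \<sqsubseteq> a \<and> a \<sqsubseteq> v \<longrightarrow> u' \<sqsubseteq> c \<oplus> rneg a \<and> c \<oplus> rneg a \<sqsubseteq> v'"
    by (rule bexI[of _ "c \<oplus> rneg v"], rule bexI[of _ "c \<oplus> rneg u"]) (use mono uv c in auto)
qed

lemma unif_monotone:
  assumes "tm (\<lambda>s. F (s 0))" "\<And>a. a \<in> R \<Longrightarrow> F a \<in> R"
    and "\<And>e. e \<in> R \<Longrightarrow> \<zero> \<sqsubset> e \<Longrightarrow> \<exists>d\<in>R. \<zero> \<sqsubset> d \<and> (\<forall>a\<in>R. \<forall>b\<in>R. close d a b \<longrightarrow> F a \<sqsubseteq> F b \<oplus> e)"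
    and mono: "\<And>a b. a \<in> R \<Longrightarrow> b \<in> R \<Longrightarrow> a \<sqsubseteq> b \<Longrightarrow> F a \<sqsubseteq> F b"
  shows "unif F"
proof (rule unifI)
  fix u v assume uv: "u \<in> R" "v \<in> R"
  show "\<exists>u'\<in>R. \<exists>v'\<in>R. \<forall>a\<in>R. u \<sqsubseteq> a \<and> a \<sqsubseteq> v \<longrightarrow> u' \<sqsubseteq> F a \<and> F a \<sqsubseteq> v'"
    by (rule bexI[of _ "F u"], rule bexI[of _ "F v"]) (use mono uv assms(2) in blast)+
qed (fact assms(1-3))+

definition rmax :: "'v \<Rightarrow> 'v \<Rightarrow> 'v" where "rmax c a = (if c \<sqsubseteq> a then a else c)"
definition rmin :: "'v \<Rightarrow> 'v \<Rightarrow> 'v" where "rmin c a = (if a \<sqsubseteq> c then a else c)"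

lemma rmax_in [simp]: "a \<in> R \<Longrightarrow> c \<in> R \<Longrightarrow> rmax c a \<in> R" unfolding rmax_def by simp
lemma rmin_in [simp]: "a \<in> R \<Longrightarrow> c \<in> R \<Longrightarrow> rmin c a \<in> R" unfolding rmin_def by simp

lemma rmax_le_iff: "a \<in> R \<Longrightarrow> c \<in> R \<Longrightarrow> b \<in> R \<Longrightarrow> rmax c a \<sqsubseteq> b \<longleftrightarrow> c \<sqsubseteq> b \<and> a \<sqsubseteq> b"
  unfolding rmax_def using le_linear[of a c] le_trans[of c a b] le_trans[of a c b] by auto

lemma rmax_ge: "a \<in> R \<Longrightarrow> c \<in> R \<Longrightarrow> c \<sqsubseteq> rmax c a" "a \<in> R \<Longrightarrow> c \<in> R \<Longrightarrow> a \<sqsubseteq> rmax c a"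
  using rmax_le_iff[of a c "rmax c a"] by auto

lemma rmin_ge_iff: "a \<in> R \<Longrightarrow> c \<in> R \<Longrightarrow> b \<in> R \<Longrightarrow> b \<sqsubseteq> rmin c a \<longleftrightarrow> b \<sqsubseteq> c \<and> b \<sqsubseteq> a"
  unfolding rmin_def using le_linear[of a c] le_trans[of b a c] le_trans[of b c a] by auto

lemma rmin_le: "a \<in> R \<Longrightarrow> c \<in> R \<Longrightarrow> rmin c a \<sqsubseteq> c" "a \<in> R \<Longrightarrow> c \<in> R \<Longrightarrow> rmin c a \<sqsubseteq> a"
  using rmin_ge_iff[of a c "rmin c a"] by auto

lemma trm_rmax: "tm t \<Longrightarrow> tm u \<Longrightarrow> tm (\<lambda>s. rmax (t s) (u s))"
  unfolding rmax_def by (intro real_definability)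

lemma trm_rmin: "tm t \<Longrightarrow> tm u \<Longrightarrow> tm (\<lambda>s. rmin (t s) (u s))"
  unfolding rmin_def by (intro real_definability)

lemma unif_max:
  assumes c: "c \<in> R"
  shows "unif (rmax c)"
proof (rule unif_monotone)
  show "tm (\<lambda>s. rmax c (s 0))" by (intro trm_rmax real_definability)
  fix e assume e: "e \<in> R" "\<zero> \<sqsubset> e"
  have "rmax c a \<sqsubseteq> rmax c b \<oplus> e" if ab: "a \<in> R" "b \<in> R" "close e a b" for a b
  proof -
    have "a \<sqsubseteq> b \<oplus> e" using ab(3) unfolding close_def by simp
    moreover have "b \<oplus> e \<sqsubseteq> rmax c b \<oplus> e" using rmax_ge(2)[of b c] le_add ab c e by simp
    ultimately have 1: "a \<sqsubseteq> rmax c b \<oplus> e" using le_trans[of a "b \<oplus> e"] ab c e by simp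
    have "c \<oplus> e \<sqsubseteq> rmax c b \<oplus> e" using rmax_ge(1)[of b c] le_add ab c e by simp
    moreover have "c \<sqsubseteq> c \<oplus> e" using lt_add_pos[of e c] lt_imp_le c e by simp
    ultimately have "c \<sqsubseteq> rmax c b \<oplus> e" using le_trans[of c "c \<oplus> e"] ab c e by simp
    with 1 show ?thesis using rmax_le_iff ab c e by simp
  qed
  then show "\<exists>d\<in>R. \<zero> \<sqsubset> d \<and> (\<forall>a\<in>R. \<forall>b\<in>R. close d a b \<longrightarrow> rmax c a \<sqsubseteq> rmax c b \<oplus> e)"
    using e by blast
next
  fix a b assume ab: "a \<in> R" "b \<in> R" "a \<sqsubseteq> b"
  show "rmax c a \<sqsubseteq> rmax c b"
    using rmax_ge[of b c] le_trans[of a b "rmax c b"] rmax_le_iff[of a c "rmax c b"] ab c by simp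
qed (use c in simp)

lemma unif_min:
  assumes c: "c \<in> R"
  shows "unif (rmin c)"
proof (rule unif_monotone)
  show "tm (\<lambda>s. rmin c (s 0))" by (intro trm_rmin real_definability)
  fix e assume e: "e \<in> R" "\<zero> \<sqsubset> e"
  have "rmin c a \<sqsubseteq> rmin c b \<oplus> e" if ab: "a \<in> R" "b \<in> R" "close e a b" for a b
  proof (cases "b \<sqsubseteq> c")
    case True
    have "rmin c a \<sqsubseteq> a" "a \<sqsubseteq> b \<oplus> e" using rmin_le ab c unfolding close_def by auto
    then have "rmin c a \<sqsubseteq> b \<oplus> e" using le_trans[of "rmin c a" a "b \<oplus> e"] ab c e by simp
    then show ?thesis using True by (simp add: rmin_def[of c b])
  next
    case False
    have "rmin c a \<sqsubseteq> c" "c \<sqsubseteq> c \<oplus> e" using rmin_le ab c e lt_add_pos lt_imp_le by auto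
    then have "rmin c a \<sqsubseteq> c \<oplus> e" using le_trans[of "rmin c a" c "c \<oplus> e"] ab c e by simp
    then show ?thesis using False by (simp add: rmin_def[of c b])
  qed
  then show "\<exists>d\<in>R. \<zero> \<sqsubset> d \<and> (\<forall>a\<in>R. \<forall>b\<in>R. close d a b \<longrightarrow> rmin c a \<sqsubseteq> rmin c b \<oplus> e)"
    using e by blast
next
  fix a b assume ab: "a \<in> R" "b \<in> R" "a \<sqsubseteq> b"
  show "rmin c a \<sqsubseteq> rmin c b"
    using rmin_le[of a c] le_trans[of "rmin c a" a b] rmin_ge_iff[of b c "rmin c a"] ab c by simp
qed (use c in simp)

lemma unif_scale:
  assumes m: "m \<in> R" "\<zero> \<sqsubset> m"
  shows "unif (\<lambda>a. m \<otimes> a)"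
proof (rule unif_monotone)
  show "tm (\<lambda>s. m \<otimes> s 0)" by (intro real_definability)
  have i: "rinv m \<in> R" "m \<otimes> rinv m = \<one>" "\<zero> \<sqsubset> rinv m"
    using m rinv_in rmul_inv inv_pos pos_neq_zero by auto
  fix e assume e: "e \<in> R" "\<zero> \<sqsubset> e"
  let ?d = "rinv m \<otimes> e"
  have d: "?d \<in> R" "\<zero> \<sqsubset> ?d" using i e mul_pos by auto
  have md: "m \<otimes> ?d = e" using i e m rmul_assoc[of m "rinv m" e] by simp
  have "m \<otimes> a \<sqsubseteq> m \<otimes> b \<oplus> e" if ab: "a \<in> R" "b \<in> R" "close ?d a b" for a b
  proof -
    have "m \<otimes> a \<sqsubseteq> m \<otimes> (b \<oplus> ?d)" using ab d m lt_imp_le unfolding close_def by (intro mul_le) auto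
    then show ?thesis using distrib_left[of m b ?d] ab d m md by simp
  qed
  then show "\<exists>d\<in>R. \<zero> \<sqsubset> d \<and> (\<forall>a\<in>R. \<forall>b\<in>R. close d a b \<longrightarrow> m \<otimes> a \<sqsubseteq> m \<otimes> b \<oplus> e)"
    using d by blast
next
  fix a b assume "a \<in> R" "b \<in> R" "a \<sqsubseteq> b"
  then show "m \<otimes> a \<sqsubseteq> m \<otimes> b" using mul_le m lt_imp_le by simp
qed (use m in simp)

lemma inv_antimono: "\<zero> \<sqsubset> a \<Longrightarrow> a \<sqsubseteq> b \<Longrightarrow> a \<in> R \<Longrightarrow> b \<in> R \<Longrightarrow> rinv b \<sqsubseteq> rinv a"
proof -
  assume *: "\<zero> \<sqsubset> a" "a \<sqsubseteq> b" "a \<in> R" "b \<in> R"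
  have b: "\<zero> \<sqsubset> b" using lt_le_trans[of \<zero> a b] * by simp
  have i: "rinv a \<in> R" "a \<otimes> rinv a = \<one>" "\<zero> \<sqsubset> rinv a" "rinv b \<in> R" "b \<otimes> rinv b = \<one>" "\<zero> \<sqsubset> rinv b"
    using * b rinv_in rmul_inv inv_pos pos_neq_zero by auto
  let ?p = "rinv a \<otimes> rinv b"
  have "?p \<otimes> a \<sqsubseteq> ?p \<otimes> b" using * i mul_pos lt_imp_le by (intro mul_le) auto
  moreover have "?p \<otimes> a = rinv b \<otimes> (rinv a \<otimes> a)" 
    using * i rmul_commute[of "rinv a" "rinv b"] by (simp add: rmul_assoc)
  moreover have "rinv a \<otimes> a = \<one>" using i * rmul_commute by simp
  moreover have "?p \<otimes> b = rinv a" using * i rmul_commute[of "rinv b" b] by (simp add: rmul_assoc)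
  ultimately show ?thesis using i by simp
qed

text \<open>For \<open>a, b \<ge> q\<close> the identity \<open>1/a - 1/b = (b - a)/(a b)\<close> shows that \<open>q\<^sup>2 e\<close> is a modulus for \<open>e\<close>.  Cutting off
below \<open>q\<close> gives a function on the whole line, so that it can be composed with every member of the ring.\<close>

lemma unif_inv_max:
  assumes q: "q \<in> R" "\<zero> \<sqsubset> q"
  shows "unif (\<lambda>a. rinv (rmax q a))"
proof (rule unifI)
  show "tm (\<lambda>s. rinv (rmax q (s 0)))" by (intro trm_rmax real_definability)
  have pos: "\<zero> \<sqsubset> rmax q a" if "a \<in> R" for a using lt_le_trans[of \<zero> q "rmax q a"] rmax_ge that q by simp
  show inR: "rinv (rmax q a) \<in> R" if "a \<in> R" for a
    using pos[OF that] that q rinv_in pos_neq_zero by simp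
  fix e assume e: "e \<in> R" "\<zero> \<sqsubset> e"
  let ?d = "(q \<otimes> q) \<otimes> e"
  have d: "?d \<in> R" "\<zero> \<sqsubset> ?d" using q e mul_pos by auto
  obtain d' where d': "d' \<in> R" "\<zero> \<sqsubset> d'" "\<And>a b. a \<in> R \<Longrightarrow> b \<in> R \<Longrightarrow> close d' a b \<Longrightarrow> close ?d (rmax q a) (rmax q b)"
    using unif_close[OF unif_max[OF q(1)] d] by blast
  have "rinv (rmax q a) \<sqsubseteq> rinv (rmax q b) \<oplus> e" if ab: "a \<in> R" "b \<in> R" "close d' a b" for a b
  proof -
    let ?a = "rmax q a" and ?b = "rmax q b"
    have A: "?a \<in> R" "?b \<in> R" "\<zero> \<sqsubset> ?a" "\<zero> \<sqsubset> ?b" using ab q pos by auto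
    have i: "rinv ?a \<in> R" "?a \<otimes> rinv ?a = \<one>" "\<zero> \<sqsubset> rinv ?a" "rinv ?b \<in> R" "?b \<otimes> rinv ?b = \<one>" "\<zero> \<sqsubset> rinv ?b"
      using A rinv_in rmul_inv inv_pos pos_neq_zero by auto
    have qi: "rinv q \<in> R" "q \<otimes> rinv q = \<one>" "\<zero> \<sqsubset> rinv q" using q rinv_in rmul_inv inv_pos pos_neq_zero by auto
    have bound: "rinv c \<otimes> q \<sqsubseteq> \<one>" if "q \<sqsubseteq> c" "c \<in> R" "rinv c \<in> R" for c
    proof -
      have "q \<otimes> rinv c \<sqsubseteq> q \<otimes> rinv q" using inv_antimono[of q c] that q qi lt_imp_le by (intro mul_le) auto
      then show ?thesis using qi that q rmul_commute[of q "rinv c"] by simp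
    qed
    let ?p = "rinv ?a \<otimes> rinv ?b"
    have p: "?p \<in> R" "\<zero> \<sqsubset> ?p" using i mul_pos by auto
    have "?b \<sqsubseteq> ?a \<oplus> ?d" using d'(3)[OF ab] unfolding close_def by simp
    then have "?p \<otimes> ?b \<sqsubseteq> ?p \<otimes> (?a \<oplus> ?d)" using p A d lt_imp_le by (intro mul_le) auto
    also have "?p \<otimes> (?a \<oplus> ?d) = ?p \<otimes> ?a \<oplus> ?p \<otimes> ?d" using p A d by (intro distrib_left) auto
    finally have 1: "?p \<otimes> ?b \<sqsubseteq> ?p \<otimes> ?a \<oplus> ?p \<otimes> ?d" .
    have 2: "?p \<otimes> ?b = rinv ?a" using i A rmul_assoc[of "rinv ?a" "rinv ?b" ?b] rmul_commute[of "rinv ?b" ?b] by simp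
    have 3: "?p \<otimes> ?a = rinv ?b"
      using i A rmul_commute[of "rinv ?a" "rinv ?b"] rmul_assoc[of "rinv ?b" "rinv ?a" ?a] rmul_commute[of "rinv ?a" ?a] by simp
    have 4: "?p \<otimes> ?d \<sqsubseteq> e"
    proof -
      let ?x = "rinv ?a \<otimes> q" and ?y = "rinv ?b \<otimes> q"
      have xy: "?x \<in> R" "?y \<in> R" using i q by auto
      have "?x \<sqsubseteq> \<one>" "?y \<sqsubseteq> \<one>" using bound rmax_ge ab q i A by auto
      moreover have "\<zero> \<sqsubset> ?x" "\<zero> \<sqsubset> ?y" using i q mul_pos by auto
      ultimately have "?x \<otimes> ?y \<sqsubseteq> ?x \<otimes> \<one>" using xy lt_imp_le by (intro mul_le) auto
      then have "?x \<otimes> ?y \<sqsubseteq> ?x" using xy by simp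
      then have "?x \<otimes> ?y \<sqsubseteq> \<one>" using le_trans[of "?x \<otimes> ?y" ?x \<one>] \<open>?x \<sqsubseteq> \<one>\<close> xy by simp
      then have "e \<otimes> (?x \<otimes> ?y) \<sqsubseteq> e \<otimes> \<one>" using e xy lt_imp_le by (intro mul_le) auto
      moreover have "e \<otimes> (?x \<otimes> ?y) = ?p \<otimes> ?d"
      proof -
        have "?x \<otimes> ?y = rinv ?a \<otimes> (q \<otimes> (rinv ?b \<otimes> q))" using i q by (simp add: rmul_assoc)
        also have "q \<otimes> (rinv ?b \<otimes> q) = rinv ?b \<otimes> (q \<otimes> q)" by (rule rmul_left_commute) (use i q in auto)
        finally have "?x \<otimes> ?y = ?p \<otimes> (q \<otimes> q)" using i q by (simp add: rmul_assoc)
        then show ?thesis using p q e rmul_commute[of e "?p \<otimes> (q \<otimes> q)"] by (simp add: rmul_assoc)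
      qed
      ultimately show ?thesis using e by simp
    qed
    have "rinv ?b \<oplus> ?p \<otimes> ?d \<sqsubseteq> rinv ?b \<oplus> e" using 4 i p d e by (intro add_mono) auto
    then show ?thesis using 1 le_trans[of "rinv ?a" "rinv ?b \<oplus> ?p \<otimes> ?d" "rinv ?b \<oplus> e"] i p d e unfolding 2 3 by simp
  qed
  then show "\<exists>d\<in>R. \<zero> \<sqsubset> d \<and> (\<forall>a\<in>R. \<forall>b\<in>R. close d a b \<longrightarrow> rinv (rmax q a) \<sqsubseteq> rinv (rmax q b) \<oplus> e)"
    using d' by blast
next
  fix u v assume uv: "u \<in> R" "v \<in> R"
  have qi: "rinv q \<in> R" using q rinv_in pos_neq_zero by auto
  have "\<zero> \<sqsubseteq> rinv (rmax q a) \<and> rinv (rmax q a) \<sqsubseteq> rinv q" if "a \<in> R" for a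
    using inv_antimono[of q "rmax q a"] inv_pos[of "rmax q a"] lt_le_trans[of \<zero> q "rmax q a"] rmax_ge[of a q] that q lt_imp_le by simp
  then show "\<exists>u'\<in>R. \<exists>v'\<in>R. \<forall>a\<in>R. u \<sqsubseteq> a \<and> a \<sqsubseteq> v \<longrightarrow> u' \<sqsubseteq> rinv (rmax q a) \<and> rinv (rmax q a) \<sqsubseteq> v'"
    using qi zero_in by blast
qed

text \<open>The right side is uniformly continuous in \<open>a\<close>, so a member of either ring times its truncated inverse is again
a member.\<close>

lemma inv_max_mult:
  assumes "q \<in> R" "\<zero> \<sqsubset> q" "a \<in> R"
  shows "rinv (rmax q a) \<otimes> a = rmin \<one> (rinv q \<otimes> a)"
proof -
  have qi: "rinv q \<in> R" "q \<otimes> rinv q = \<one>" "\<zero> \<sqsubset> rinv q" using assms rinv_in rmul_inv inv_pos pos_neq_zero by auto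
  have iq: "rinv q \<otimes> q = \<one>" using qi assms rmul_commute by simp
  show ?thesis
  proof (cases "q \<sqsubseteq> a")
    case True
    then have "\<zero> \<sqsubset> a" using lt_le_trans[of \<zero> q a] assms by simp
    then have "rinv a \<otimes> a = \<one>" using rmul_inv rinv_in pos_neq_zero rmul_commute[of a "rinv a"] assms by simp
    moreover have "rinv q \<otimes> q \<sqsubseteq> rinv q \<otimes> a" using True qi assms lt_imp_le by (intro mul_le) auto
    ultimately show ?thesis
      using True iq le_antisym[of "rinv q \<otimes> a" \<one>] qi assms unfolding rmax_def rmin_def by auto
  next
    case False
    then have "a \<sqsubset> q" using not_le assms by simp
    then have "rinv q \<otimes> a \<sqsubset> rinv q \<otimes> q" using qi assms by (intro mul_lt) auto
    then show ?thesis using False iq lt_imp_le unfolding rmax_def rmin_def by simp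
  qed
qed

section \<open>Continuous real functions and Tychonoff spaces\<close>

abbreviation line :: "'v zf_space" where "line \<equiv> zf_real_line mem \<R>"

lemma pts_line [simp]: "pts line = R" "zf_pts line = zf_R \<R>"
  unfolding zf_real_line_def by simp_all

lemma opn_line_iff:
  "opn line V \<longleftrightarrow> setlike V \<and> V \<subseteq> R \<and>
    (\<forall>x\<in>V. \<exists>a\<in>R. \<exists>b\<in>R. a \<sqsubset> x \<and> x \<sqsubset> b \<and> (\<forall>y\<in>R. a \<sqsubset> y \<and> y \<sqsubset> b \<longrightarrow> y \<in> V))"
proof -
  let ?P = "\<lambda>U. E U \<subseteq> R \<and> (\<forall>x\<in>E U. \<exists>a\<in>R. \<exists>b\<in>R. a \<sqsubset> x \<and> x \<sqsubset> b \<and> (\<forall>y\<in>R. a \<sqsubset> y \<and> y \<sqsubset> b \<longrightarrow> y \<in> E U))"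
  have "setlike {U. ?P U}"
  proof (rule setlike_subset[where A = "zpow (zf_R \<R>)"])
    show "df (\<lambda>s. ?P (s 0))" by (intro real_definability)
  qed simp
  then have "E (zf_opens line) = {U. ?P U}" unfolding zf_real_line_def by simp
  then show ?thesis unfolding opn_def setlike_def by auto
qed

lemma opn_interval:
  assumes "a \<in> R" "b \<in> R"
  shows "opn line {y \<in> R. a \<sqsubset> y \<and> y \<sqsubset> b}"
  unfolding opn_line_iff
proof (intro conjI)
  show "setlike {y \<in> R. a \<sqsubset> y \<and> y \<sqsubset> b}" by (rule setlike_sep, intro real_definability)
qed (use assms in blast)+

lemma lt_diff_iff: "x \<oplus> rneg e \<sqsubset> y \<longleftrightarrow> x \<sqsubset> y \<oplus> e" if "x \<in> R" "y \<in> R" "e \<in> R"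
proof
  assume "x \<oplus> rneg e \<sqsubset> y"
  then have "x \<oplus> rneg e \<oplus> e \<sqsubset> y \<oplus> e" using that by (intro lt_add) auto
  then show "x \<sqsubset> y \<oplus> e" using that radd_commute[of "rneg e" e] by (simp add: radd_assoc)
next
  assume "x \<sqsubset> y \<oplus> e"
  then have "x \<oplus> rneg e \<sqsubset> y \<oplus> e \<oplus> rneg e" using that by (intro lt_add) auto
  then show "x \<oplus> rneg e \<sqsubset> y" using that by (simp add: radd_assoc)
qed

text \<open>Continuity at a point in terms of \<open>close\<close>; the half-distance to the end points of an interval turns the
weak inequalities into strict ones.\<close>

lemma continuous_real_iff:
  assumes S: "top S"
  shows "zf_continuous mem S line f \<longleftrightarrow> fn (zf_pts S) (zf_R \<R>) f \<and>
    (\<forall>x\<in>pts S. \<forall>e\<in>R. \<zero> \<sqsubset> e \<longrightarrow> (\<exists>U. opn S U \<and> x \<in> U \<and> (\<forall>y\<in>U. close e (val f x) (val f y))))"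
proof (intro iffI conjI ballI impI)
  assume c: "zf_continuous mem S line f"
  show f: "fn (zf_pts S) (zf_R \<R>) f" using c unfolding zf_continuous_iff by simp
  fix x e assume x: "x \<in> pts S" and e: "e \<in> R" "\<zero> \<sqsubset> e"
  let ?x = "val f x"
  have xR: "?x \<in> R" using val_in[OF f x] .
  let ?V = "{y \<in> R. ?x \<oplus> rneg e \<sqsubset> y \<and> y \<sqsubset> ?x \<oplus> e}"
  let ?U = "{y \<in> pts S. val f y \<in> ?V}"
  have "opn line ?V" using xR e by (intro opn_interval) auto
  then have "opn S ?U" using c unfolding zf_continuous_iff by blast
  moreover have "x \<in> ?U" using x xR e lt_add_pos lt_diff_iff by auto
  moreover have "close e ?x (val f y)" if "y \<in> ?U" for y
    using that xR e lt_diff_iff[of ?x "val f y" e] lt_imp_le unfolding close_def by auto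
  ultimately show "\<exists>U. opn S U \<and> x \<in> U \<and> (\<forall>y\<in>U. close e ?x (val f y))" by blast
next
  assume *: "fn (zf_pts S) (zf_R \<R>) f \<and>
    (\<forall>x\<in>pts S. \<forall>e\<in>R. \<zero> \<sqsubset> e \<longrightarrow> (\<exists>U. opn S U \<and> x \<in> U \<and> (\<forall>y\<in>U. close e (val f x) (val f y))))"
  then have f: "fn (zf_pts S) (zf_R \<R>) f" by blast
  have "opn S {x \<in> pts S. val f x \<in> V}" if V: "opn line V" for V
  proof (rule opn_nbhd[OF S])
    obtain v where "E v = V" using opn_setlike[OF V] unfolding setlike_def by blast
    then show "setlike {x \<in> pts S. val f x \<in> V}" using setlike_preimage[of "zf_pts S" f v] by simp
    fix x assume "x \<in> {x \<in> pts S. val f x \<in> V}"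
    then have x: "x \<in> pts S" "val f x \<in> V" by auto
    let ?x = "val f x"
    have xR: "?x \<in> R" using val_in[OF f x(1)] .
    obtain a b where ab: "a \<in> R" "b \<in> R" "a \<sqsubset> ?x" "?x \<sqsubset> b" "\<And>y. y \<in> R \<Longrightarrow> a \<sqsubset> y \<Longrightarrow> y \<sqsubset> b \<Longrightarrow> y \<in> V"
      using V x(2) unfolding opn_line_iff by blast
    obtain e1 where e1: "e1 \<in> R" "\<zero> \<sqsubset> e1" "a \<oplus> e1 \<sqsubset> ?x" using dense[OF ab(3) ab(1) xR] by blast
    obtain e2 where e2: "e2 \<in> R" "\<zero> \<sqsubset> e2" "?x \<oplus> e2 \<sqsubset> b" using dense[OF ab(4) xR ab(2)] by blast
    obtain e where e: "e \<in> R" "\<zero> \<sqsubset> e" "e \<sqsubseteq> e1" "e \<sqsubseteq> e2" using pos_min[OF e1(2) e2(2) e1(1) e2(1)] by blast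
    obtain U where U: "opn S U" "x \<in> U" "\<And>y. y \<in> U \<Longrightarrow> close e ?x (val f y)" using * x(1) e(1,2) by blast
    have "y \<in> {x \<in> pts S. val f x \<in> V}" if y: "y \<in> U" for y
    proof -
      have yS: "y \<in> pts S" using opn_subset[OF S U(1)] y by blast
      let ?y = "val f y"
      have yR: "?y \<in> R" using val_in[OF f yS] .
      have c: "?x \<sqsubseteq> ?y \<oplus> e" "?y \<sqsubseteq> ?x \<oplus> e" using U(3)[OF y] unfolding close_def by auto
      have "?y \<oplus> e \<sqsubseteq> ?y \<oplus> e1" using e yR e1 by (intro add_mono) auto
      then have "?x \<sqsubseteq> ?y \<oplus> e1" using le_trans[OF c(1)] xR yR e e1 by simp
      then have "a \<oplus> e1 \<sqsubset> ?y \<oplus> e1" using lt_le_trans[OF e1(3)] ab xR yR e1 by simp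
      then have 1: "a \<sqsubset> ?y" using add_lt_cancel ab yR e1 by blast
      have "?x \<oplus> e \<sqsubseteq> ?x \<oplus> e2" using e xR e2 by (intro add_mono) auto
      then have "?y \<sqsubseteq> ?x \<oplus> e2" using le_trans[OF c(2)] xR yR e e2 by simp
      then have "?y \<sqsubset> b" using le_lt_trans[OF _ e2(3)] ab xR yR e2 by simp
      with 1 show ?thesis using ab yR yS by simp
    qed
    with U show "\<exists>U. opn S U \<and> x \<in> U \<and> U \<subseteq> {x \<in> pts S. val f x \<in> V}" by blast
  qed
  then show "zf_continuous mem S line f" using f unfolding zf_continuous_iff by simp
qed

abbreviation CC :: "'v zf_space \<Rightarrow> 'v set" where "CC S \<equiv> E (zf_C mem \<R> S)"

lemma C_iff: "f \<in> CC S \<longleftrightarrow> zf_continuous mem S line f"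
proof -
  have "setlike {f. zf_continuous mem S line f}"
  proof (rule setlike_subset[where A = "zpow (zf_prod mem (zf_pts S) (zf_R \<R>))"])
    show "df (\<lambda>s. zf_continuous mem S line (s 0))" by (intro dfn_continuous trm_var)
    show "f \<in> E (zpow (zf_prod mem (zf_pts S) (zf_R \<R>)))" if "zf_continuous mem S line f" for f
      using that fun_in_pow_prod unfolding zf_continuous_iff by simp
  qed
  then show ?thesis unfolding zf_C_def by simp
qed

lemma C_fun: "f \<in> CC S \<Longrightarrow> fn (zf_pts S) (zf_R \<R>) f"
  unfolding C_iff zf_continuous_iff by simp

lemma C_val: "f \<in> CC S \<Longrightarrow> x \<in> pts S \<Longrightarrow> val f x \<in> R"
  using val_in C_fun by blast

lemma C_close: "top S \<Longrightarrow> f \<in> CC S \<Longrightarrow> x \<in> pts S \<Longrightarrow> e \<in> R \<Longrightarrow> \<zero> \<sqsubset> e \<Longrightarrow>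
    \<exists>U. opn S U \<and> x \<in> U \<and> (\<forall>y\<in>U. close e (val f x) (val f y))"
  using continuous_real_iff unfolding C_iff by blast

lemma compose_exists:
  assumes "fn A (zf_R \<R>) f" "unif F"
  shows "\<exists>g. fn A (zf_R \<R>) g \<and> (\<forall>x\<in>E A. val g x = F (val f x))"
proof (rule fun_exists_trm)
  show "tm (\<lambda>s. F (val f (s 0)))" by (rule trm_compose[OF unif_trm[OF assms(2)]], intro definability)
  show "F (val f x) \<in> R" if "x \<in> E A" for x using unif_in[OF assms(2)] val_in[OF assms(1) that] by blast
qed

lemma C_unif:
  assumes S: "top S" and f: "f \<in> CC S" and F: "unif F"
  shows "\<exists>g\<in>CC S. \<forall>x\<in>pts S. val g x = F (val f x)"
proof -
  obtain g where g: "fn (zf_pts S) (zf_R \<R>) g" "\<And>x. x \<in> pts S \<Longrightarrow> val g x = F (val f x)"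
    using compose_exists[OF C_fun[OF f] F] by blast
  have "\<exists>U. opn S U \<and> x \<in> U \<and> (\<forall>y\<in>U. close e (val g x) (val g y))" if x: "x \<in> pts S" and e: "e \<in> R" "\<zero> \<sqsubset> e" for x e
  proof -
    obtain d where d: "d \<in> R" "\<zero> \<sqsubset> d" "\<forall>a\<in>R. \<forall>b\<in>R. close d a b \<longrightarrow> close e (F a) (F b)"
      using unif_close[OF F e] by blast
    obtain U where U: "opn S U" "x \<in> U" "\<forall>y\<in>U. close d (val f x) (val f y)" using C_close[OF S f x d(1,2)] by blast
    have "close e (val g x) (val g y)" if y: "y \<in> U" for y
    proof -
      have "y \<in> pts S" using opn_subset[OF S U(1)] y by blast
      then show ?thesis using d(3) U(3) y C_val[OF f] x g(2) by simp
    qed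
    with U show ?thesis by blast
  qed
  then have "g \<in> CC S" unfolding C_iff continuous_real_iff[OF S] using g(1) by blast
  with g(2) show ?thesis by blast
qed

lemma C_locally_constant:
  assumes S: "top S" and "tm (\<lambda>s. F (s 0))" "\<And>x. x \<in> pts S \<Longrightarrow> F x \<in> R"
    and loc: "\<And>x. x \<in> pts S \<Longrightarrow> \<exists>U. opn S U \<and> x \<in> U \<and> (\<forall>y\<in>U. F y = F x)"
  shows "\<exists>g\<in>CC S. \<forall>x\<in>pts S. val g x = F x"
proof -
  obtain g where g: "fn (zf_pts S) (zf_R \<R>) g" "\<And>x. x \<in> pts S \<Longrightarrow> val g x = F x"
    using fun_exists_trm[OF assms(2,3)] by blast
  have "\<exists>U. opn S U \<and> x \<in> U \<and> (\<forall>y\<in>U. close e (val g x) (val g y))" if x: "x \<in> pts S" and e: "e \<in> R" "\<zero> \<sqsubset> e" for x e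
  proof -
    obtain U where U: "opn S U" "x \<in> U" "\<forall>y\<in>U. F y = F x" using loc[OF x] by blast
    have "close e (val g x) (val g y)" if y: "y \<in> U" for y
    proof -
      have "y \<in> pts S" using opn_subset[OF S U(1)] y by blast
      then show ?thesis using U(3) y x g(2) close_refl e assms(3) by simp
    qed
    with U show ?thesis by blast
  qed
  then have "g \<in> CC S" unfolding C_iff continuous_real_iff[OF S] using g(1) by blast
  with g(2) show ?thesis by blast
qed

lemma C_const: "top S \<Longrightarrow> c \<in> R \<Longrightarrow> \<exists>g\<in>CC S. \<forall>x\<in>pts S. val g x = c"
  by (rule C_locally_constant) (auto intro: trm_const opn_pts)

definition chi :: "'v set \<Rightarrow> 'v \<Rightarrow> 'v" where
  "chi A x = (if x \<in> A then \<one> else \<zero>)"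

lemma chi_in [simp]: "chi A x \<in> R" unfolding chi_def by simp

lemma trm_chi: "tm a \<Longrightarrow> tm t \<Longrightarrow> tm (\<lambda>s. chi (E (a s)) (t s))"
  unfolding chi_def by (intro definability)

lemma C_chi:
  assumes "top S" "clp S (E A)"
  shows "\<exists>g\<in>CC S. \<forall>x\<in>pts S. val g x = chi (E A) x"
proof (rule C_locally_constant[OF assms(1)])
  show "tm (\<lambda>s. chi (E A) (s 0))" by (intro trm_chi trm_var trm_const)
  show "\<exists>U. opn S U \<and> x \<in> U \<and> (\<forall>y\<in>U. chi (E A) y = chi (E A) x)" if "x \<in> pts S" for x
    using clp_separates[OF assms(2) that] unfolding chi_def by metis
qed simp

lemma continuous_compose:
  assumes f: "zf_continuous mem S T f" and g: "zf_continuous mem T K g"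
  shows "\<exists>h. zf_continuous mem S K h \<and> (\<forall>x\<in>pts S. val h x = val g (val f x))"
proof -
  have fn: "fn (zf_pts S) (zf_pts T) f" "fn (zf_pts T) (zf_pts K) g"
    using f g unfolding zf_continuous_iff by blast+
  have "\<exists>h. fn (zf_pts S) (zf_pts K) h \<and> (\<forall>x\<in>pts S. val h x = val g (val f x))"
  proof (rule fun_exists_trm)
    show "tm (\<lambda>s. val g (val f (s 0)))" by (intro definability)
    show "val g (val f x) \<in> pts K" if "x \<in> pts S" for x using val_in fn that by blast
  qed
  then obtain h where h: "fn (zf_pts S) (zf_pts K) h" "\<forall>x\<in>pts S. val h x = val g (val f x)" by blast
  have "opn S {x \<in> pts S. val h x \<in> V}" if "opn K V" for V
  proof -
    have "{x \<in> pts S. val h x \<in> V} = {x \<in> pts S. val f x \<in> {y \<in> pts T. val g y \<in> V}}"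
      using h(2) val_in[OF fn(1)] by auto
    moreover have "opn S {x \<in> pts S. val f x \<in> {y \<in> pts T. val g y \<in> V}}"
      using f g that unfolding zf_continuous_iff by blast
    ultimately show ?thesis by simp
  qed
  with h show ?thesis unfolding zf_continuous_iff by blast
qed

lemma C_preimage: "f \<in> CC S \<Longrightarrow> opn line V \<Longrightarrow> opn S {x \<in> pts S. val f x \<in> V}"
  unfolding C_iff zf_continuous_iff by blast

lemma opn_line_rays:
  assumes c: "c \<in> R"
  shows opn_line_below: "opn line {y \<in> R. y \<sqsubset> c}" and opn_line_above: "opn line {y \<in> R. c \<sqsubset> y}"
proof -
  have up: "x \<sqsubset> x \<oplus> \<one>" "x \<oplus> \<one> \<in> R" if "x \<in> R" for x
    using lt_add_pos[OF one_pos that one_in] that by simp_all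
  have down: "x \<oplus> rneg \<one> \<sqsubset> x" "x \<oplus> rneg \<one> \<in> R" if "x \<in> R" for x
    using lt_add_pos[OF one_pos that one_in] lt_diff_iff[OF that that one_in] that by simp_all
  show "opn line {y \<in> R. y \<sqsubset> c}"
    unfolding opn_line_iff
  proof (intro conjI ballI)
    show "setlike {y \<in> R. y \<sqsubset> c}" by (rule setlike_sep, intro real_definability)
    fix x assume x: "x \<in> {y \<in> R. y \<sqsubset> c}"
    show "\<exists>a\<in>R. \<exists>b\<in>R. a \<sqsubset> x \<and> x \<sqsubset> b \<and> (\<forall>y\<in>R. a \<sqsubset> y \<and> y \<sqsubset> b \<longrightarrow> y \<in> {y \<in> R. y \<sqsubset> c})"
      by (rule bexI[of _ "x \<oplus> rneg \<one>"], rule bexI[of _ c]) (use x down c in auto)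
  qed auto
  show "opn line {y \<in> R. c \<sqsubset> y}"
    unfolding opn_line_iff
  proof (intro conjI ballI)
    show "setlike {y \<in> R. c \<sqsubset> y}" by (rule setlike_sep, intro real_definability)
    fix x assume x: "x \<in> {y \<in> R. c \<sqsubset> y}"
    show "\<exists>a\<in>R. \<exists>b\<in>R. a \<sqsubset> x \<and> x \<sqsubset> b \<and> (\<forall>y\<in>R. a \<sqsubset> y \<and> y \<sqsubset> b \<longrightarrow> y \<in> {y \<in> R. c \<sqsubset> y})"
      by (rule bexI[of _ c], rule bexI[of _ "x \<oplus> \<one>"]) (use x up c in auto)
  qed auto
qed

lemma opn_rays:
  assumes f: "f \<in> CC S" and c: "c \<in> R"
  shows "opn S {x \<in> pts S. val f x \<sqsubset> c}" "opn S {x \<in> pts S. c \<sqsubset> val f x}"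
proof -
  have "{x \<in> pts S. val f x \<in> {y \<in> R. y \<sqsubset> c}} = {x \<in> pts S. val f x \<sqsubset> c}"
    "{x \<in> pts S. val f x \<in> {y \<in> R. c \<sqsubset> y}} = {x \<in> pts S. c \<sqsubset> val f x}"
    using C_val[OF f] by auto
  then show "opn S {x \<in> pts S. val f x \<sqsubset> c}" "opn S {x \<in> pts S. c \<sqsubset> val f x}"
    using C_preimage[OF f opn_line_below[OF c]] C_preimage[OF f opn_line_above[OF c]] by (simp_all only:)
qed

lemma elts_cozero: "f \<in> CC S \<Longrightarrow> E (zf_cozero_set mem \<R> S f) = {x \<in> pts S. val f x \<noteq> \<zero>}"
proof -
  assume f: "f \<in> CC S"
  have "{x \<in> pts S. zf_app mem f x \<noteq> \<zero>} = {x \<in> pts S. val f x \<noteq> \<zero>}"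
    using zf_app_eq_val[OF C_fun[OF f]] by auto
  moreover have "setlike {x \<in> pts S. val f x \<noteq> \<zero>}" by (rule setlike_sep, intro definability)
  ultimately show ?thesis unfolding zf_cozero_set_def by simp
qed

text \<open>A function that is not 0 at \<open>x\<close> and is 0 off \<open>V\<close> is scaled to have the value 3 at \<open>x\<close> and then truncated to
the values between 1 and 2 and subtracted from 2.  Before truncation, values above 2 are taken on a neighbourhood of \<open>x\<close> and values below 1 on an
open set that contains the complement of \<open>V\<close>, which is why the function is constant on open sets.\<close>

lemma Tychonoff_separation:
  assumes S: "top S" and T: "zf_Tychonoff mem \<R> S" and V: "opn S V" and x: "x \<in> V"
  shows "\<exists>g\<in>CC S. \<exists>W W'. opn S W \<and> opn S W' \<and> x \<in> W \<and> pts S - V \<subseteq> W' \<and>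
    (\<forall>y\<in>W. val g y = \<zero>) \<and> (\<forall>y\<in>W'. val g y = \<one>)"
proof -
  have xS: "x \<in> pts S" using opn_subset[OF S V] x by blast
  obtain B where B: "B \<in> zf_cozero_set mem \<R> S ` CC S" "x \<in> E B" "E B \<subseteq> V"
    using zf_base_nbhd[OF _ V x] T unfolding zf_Tychonoff_def by blast
  then obtain f where f: "f \<in> CC S" "B = zf_cozero_set mem \<R> S f" by blast
  have fx: "val f x \<noteq> \<zero>" using B(2) f elts_cozero by auto
  have f0: "val f y = \<zero>" if "y \<in> pts S - V" for y using that B(3) f elts_cozero[OF f(1)] by blast
  have "\<exists>f\<in>CC S. \<zero> \<sqsubset> val f x \<and> (\<forall>y\<in>pts S - V. val f y = \<zero>)"
  proof (cases "\<zero> \<sqsubset> val f x")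
    case True then show ?thesis using f f0 by blast
  next
    case False
    then have l: "val f x \<sqsubset> \<zero>" using lt_linear[of \<zero> "val f x"] fx C_val[OF f(1) xS] by auto
    obtain g where g: "g \<in> CC S" "\<forall>y\<in>pts S. val g y = \<zero> \<oplus> rneg (val f y)"
      using C_unif[OF S f(1) unif_reflect[OF zero_in]] by blast
    have "\<zero> \<sqsubset> rneg (val f x)" using lt_add[OF l, of "rneg (val f x)"] C_val[OF f(1) xS] by simp
    then have "\<zero> \<sqsubset> val g x" using g(2) xS C_val[OF f(1) xS] by simp
    moreover have "val g y = \<zero>" if "y \<in> pts S - V" for y
      using that f0[OF that] g(2) radd_neg[OF zero_in] by simp
    ultimately show ?thesis using g(1) by blast
  qed
  then obtain f where f: "f \<in> CC S" "\<zero> \<sqsubset> val f x" "\<And>y. y \<in> pts S - V \<Longrightarrow> val f y = \<zero>" by blast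
  let ?c = "val f x" and ?two = "\<one> \<oplus> \<one>"
  let ?three = "?two \<oplus> \<one>"
  have c: "?c \<in> R" using C_val[OF f(1) xS] .
  have ci: "rinv ?c \<in> R" "?c \<otimes> rinv ?c = \<one>" "\<zero> \<sqsubset> rinv ?c" using c f(2) rinv_in rmul_inv inv_pos pos_neq_zero by auto
  have two: "\<one> \<sqsubset> ?two" "?two \<sqsubset> ?three" "\<zero> \<sqsubset> ?three"
    using lt_add_pos[OF one_pos] add_pos one_pos by auto
  let ?m = "?three \<otimes> rinv ?c"
  have m: "?m \<in> R" "\<zero> \<sqsubset> ?m" using ci two mul_pos by auto
  obtain g1 where g1: "g1 \<in> CC S" "\<And>y. y \<in> pts S \<Longrightarrow> val g1 y = ?m \<otimes> val f y"
    using C_unif[OF S f(1) unif_scale[OF m]] by blast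
  obtain g2 where g2: "g2 \<in> CC S" "\<And>y. y \<in> pts S \<Longrightarrow> val g2 y = rmax \<one> (val g1 y)"
    using C_unif[OF S g1(1) unif_max[OF one_in]] by blast
  obtain g3 where g3: "g3 \<in> CC S" "\<And>y. y \<in> pts S \<Longrightarrow> val g3 y = rmin ?two (val g2 y)"
    using C_unif[OF S g2(1) unif_min[of ?two]] by auto
  obtain g where g: "g \<in> CC S" "\<And>y. y \<in> pts S \<Longrightarrow> val g y = ?two \<oplus> rneg (val g3 y)"
    using C_unif[OF S g3(1) unif_reflect[of ?two]] by auto
  let ?W = "{y \<in> pts S. ?two \<sqsubset> val g1 y}" and ?W' = "{y \<in> pts S. val g1 y \<sqsubset> \<one>}"
  have "opn S ?W" "opn S ?W'" using opn_rays[OF g1(1)] by auto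
  moreover have "x \<in> ?W"
  proof -
    have "val g1 x = ?three" using g1(2)[OF xS] ci c rmul_assoc[of ?three "rinv ?c" ?c] rmul_commute[of "rinv ?c" ?c] by simp
    then show ?thesis using two xS by simp
  qed
  moreover have "pts S - V \<subseteq> ?W'" using g1(2) f(3) m one_pos by auto
  moreover have "val g y = \<zero>" if y: "y \<in> ?W" for y
  proof -
    have yS: "y \<in> pts S" and l: "?two \<sqsubset> val g1 y" using y by auto
    have R: "val g1 y \<in> R" using C_val[OF g1(1) yS] .
    have "\<one> \<sqsubset> val g1 y" using lt_trans[OF two(1) l] R by simp
    then have "val g2 y = val g1 y" using g2(2)[OF yS] lt_imp_le unfolding rmax_def by simp
    then have "val g3 y = ?two"
      using g3(2)[OF yS] l le_antisym[of "val g1 y" ?two] lt_imp_le[OF l] R unfolding rmin_def by auto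
    then show ?thesis using g(2)[OF yS] by simp
  qed
  moreover have "val g y = \<one>" if y: "y \<in> ?W'" for y
  proof -
    have yS: "y \<in> pts S" and l: "val g1 y \<sqsubset> \<one>" using y by auto
    have R: "val g1 y \<in> R" using C_val[OF g1(1) yS] .
    have "\<not> \<one> \<sqsubseteq> val g1 y" using l not_le R by simp
    then have "val g2 y = \<one>" using g2(2)[OF yS] unfolding rmax_def by simp
    then have "val g3 y = \<one>" using g3(2)[OF yS] lt_imp_le[OF two(1)] unfolding rmin_def by simp
    then show ?thesis using g(2)[OF yS] by (simp add: radd_assoc)
  qed
  ultimately show ?thesis using g(1) by blast
qed

text \<open>A clopen set is the cozero set of its characteristic function.\<close>

lemma zero_dimensional_Tychonoff:
  assumes S: "top S" and Z: "zf_zero_dimensional mem S" and T: "zf_T1 mem S"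
  shows "zf_Tychonoff mem \<R> S"
  unfolding zf_Tychonoff_def
proof (intro conjI T zf_baseI)
  let ?B = "zf_cozero_set mem \<R> S ` CC S"
  have mem: "b \<in> ?B \<longleftrightarrow> (\<exists>f\<in>CC S. \<forall>x. x \<in> E b \<longleftrightarrow> x \<in> pts S \<and> val f x \<noteq> \<zero>)" for b
  proof -
    have "b = zf_cozero_set mem \<R> S f \<longleftrightarrow> (\<forall>x. x \<in> E b \<longleftrightarrow> x \<in> pts S \<and> val f x \<noteq> \<zero>)" if "f \<in> CC S" for f
      using elts_cozero[OF that] elts_inject[of b "zf_cozero_set mem \<R> S f"] by (auto simp: set_eq_iff)
    then show ?thesis by blast
  qed
  show "df (\<lambda>s. s 0 \<in> ?B)" unfolding mem by (intro definability)
  show "opn S (E b)" if "b \<in> ?B" for b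
  proof -
    obtain f where f: "f \<in> CC S" "b = zf_cozero_set mem \<R> S f" using \<open>b \<in> ?B\<close> by blast
    have nz: "val f x \<noteq> \<zero> \<longleftrightarrow> val f x \<sqsubset> \<zero> \<or> \<zero> \<sqsubset> val f x" if "x \<in> pts S" for x
      using lt_linear[OF zero_in C_val[OF f(1) that]] lt_irrefl[OF zero_in] by auto
    have "E b = {x \<in> pts S. val f x \<sqsubset> \<zero>} \<union> {x \<in> pts S. \<zero> \<sqsubset> val f x}"
      unfolding f(2) elts_cozero[OF f(1)] using nz by blast
    then show ?thesis using opn_rays[OF f(1) zero_in] opn_Un[OF S] by simp
  qed
  fix U x assume U: "opn S U" "x \<in> U"
  obtain A where A: "clp S (E A)" "x \<in> E A" "E A \<subseteq> U" using zero_dim_nbhd[OF S Z U] by blast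
  obtain g where g: "g \<in> CC S" "\<forall>x\<in>pts S. val g x = chi (E A) x" using C_chi[OF S A(1)] by blast
  have "A \<in> ?B" unfolding mem
    by (rule bexI[OF _ g(1)]) (use g(2) clp_subset[OF S A(1)] zero_neq_one in \<open>auto simp: chi_def split: if_splits\<close>)
  with A show "\<exists>b\<in>?B. x \<in> E b \<and> E b \<subseteq> U" by blast
qed

lemma Tychonoff_Hausdorff:
  assumes S: "top S" and T: "zf_Tychonoff mem \<R> S" and xy: "x \<in> pts S" "y \<in> pts S" "x \<noteq> y"
  shows "\<exists>W W'. opn S W \<and> opn S W' \<and> x \<in> W \<and> y \<in> W' \<and> W \<inter> W' = {}"
proof -
  obtain V where V: "V \<in> E (zf_opens S)" "x \<in> E V" "y \<notin> E V" using T xy unfolding zf_Tychonoff_def zf_T1_def by blast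
  then obtain g W W' where "opn S W" "opn S W'" "x \<in> W" "pts S - E V \<subseteq> W'"
    "\<forall>y\<in>W. val g y = \<zero>" "\<forall>y\<in>W'. val g y = \<one>"
    using Tychonoff_separation[OF S T, of "E V" x] by auto
  then show ?thesis using V(3) xy(2) zero_neq_one by (intro exI[of _ W] exI[of _ W']) auto
qed

section \<open>Functions with countable clopen covers of small oscillation\<close>

abbreviation countable_set :: "'v \<Rightarrow> bool" where "countable_set \<equiv> zf_countable mem"

lemma dfn_countable: "tm t \<Longrightarrow> df (\<lambda>s. countable_set (t s))"
proof -
  have *: "countable_set A \<longleftrightarrow> (\<exists>B f. E B \<subseteq> E om \<and> fn A B f \<and>
      (\<forall>x\<in>E A. \<forall>y\<in>E A. val f x = val f y \<longrightarrow> x = y) \<and> (\<forall>y\<in>E B. \<exists>x\<in>E A. val f x = y))" for A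
  proof -
    have "zf_bij mem A B f \<longleftrightarrow> fn A B f \<and>
      (\<forall>x\<in>E A. \<forall>y\<in>E A. val f x = val f y \<longrightarrow> x = y) \<and> (\<forall>y\<in>E B. \<exists>x\<in>E A. val f x = y)" for B f
    proof (cases "fn A B f")
      case True
      then have "val f ` E A \<subseteq> E B" using val_in[OF True] by blast
      then have "val f ` E A = E B \<longleftrightarrow> E B \<subseteq> val f ` E A" by blast
      also have "\<dots> \<longleftrightarrow> (\<forall>y\<in>E B. \<exists>x\<in>E A. val f x = y)"
        unfolding subset_eq image_iff by (intro ball_cong bex_cong refl eq_commute)
      finally have "val f ` E A = E B \<longleftrightarrow> (\<forall>y\<in>E B. \<exists>x\<in>E A. val f x = y)" .
      then show ?thesis unfolding zf_bij_iff inj_on_def by simp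
    next
      case False
      then show ?thesis unfolding zf_bij_iff by simp
    qed
    then show ?thesis unfolding zf_countable_def by simp
  qed
  assume t: "tm t"
  show ?thesis unfolding * by (intro definability dfn_fun trm_weaken t)
qed

text \<open>By \<open>osc_le_iff\<close>, the last condition bounds the oscillation on each member of the cover by \<open>e\<close>.\<close>

definition fine_cover :: "'v zf_space \<Rightarrow> 'v \<Rightarrow> 'v \<Rightarrow> 'v \<Rightarrow> bool" where
  "fine_cover X f e \<A> \<longleftrightarrow> countable_set \<A> \<and> (\<forall>A\<in>E \<A>. clp X (E A)) \<and>
    (\<forall>x\<in>pts X. \<exists>A\<in>E \<A>. x \<in> E A) \<and> (\<forall>A\<in>E \<A>. \<forall>x\<in>E A. \<forall>y\<in>E A. close e (val f x) (val f y))"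

text \<open>The oscillation exists as soon as the differences are bounded, by completeness.\<close>

lemma osc_le_iff:
  assumes f: "fn X (zf_R \<R>) f" and A: "E A \<subseteq> E X" and e: "e \<in> R" "\<zero> \<sqsubset> e"
  shows "(\<exists>s. zf_is_osc mem \<R> A f s \<and> s \<sqsubseteq> e) \<longleftrightarrow> (\<forall>x\<in>E A. \<forall>y\<in>E A. close e (val f x) (val f y))"
proof (cases "E A = {}")
  case True
  then show ?thesis unfolding zf_is_osc_def using e(2) lt_imp_le by auto
next
  case False
  let ?d = "\<lambda>x y. zf_abs mem \<R> (zf_minus mem \<R> (val f x) (val f y))"
  let ?D = "{?d x y | x y. x \<in> E A \<and> y \<in> E A}"
  have v: "val f x \<in> R" "zf_app mem f x = val f x" if "x \<in> E A" for x
    using val_in[OF f] zf_app_eq_val[OF f] A that by auto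
  have dD: "{zf_abs mem \<R> (zf_minus mem \<R> (zf_app mem f x) (zf_app mem f y)) | x y. x \<in> E A \<and> y \<in> E A} = ?D"
    by (rule Collect_pairs_cong) (simp only: v(2))
  have osc: "zf_is_osc mem \<R> A f s \<longleftrightarrow> zf_is_sup mem \<R> ?D s" for s
    unfolding zf_is_osc_def dD using False by simp
  have le: "?d x y \<sqsubseteq> r \<longleftrightarrow> close r (val f x) (val f y)" "?d x y \<in> R" if "x \<in> E A" "y \<in> E A" "r \<in> R" for x y r
    using abs_minus_le[OF v(1)[OF that(1)] v(1)[OF that(2)] that(3)] by auto
  show ?thesis
  proof
    assume "\<exists>s. zf_is_osc mem \<R> A f s \<and> s \<sqsubseteq> e"
    then obtain s where s: "zf_is_sup mem \<R> ?D s" "s \<sqsubseteq> e" unfolding osc by blast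
    show "\<forall>x\<in>E A. \<forall>y\<in>E A. close e (val f x) (val f y)"
    proof (intro ballI)
      fix x y assume xy: "x \<in> E A" "y \<in> E A"
      then have "?d x y \<sqsubseteq> s" "s \<in> R" using s(1) unfolding zf_is_sup_def by blast+
      then have "?d x y \<sqsubseteq> e" using le_trans[of "?d x y" s e] s(2) le(2)[OF xy e(1)] e(1) by blast
      then show "close e (val f x) (val f y)" using le(1)[OF xy e(1)] by blast
    qed
  next
    assume c: "\<forall>x\<in>E A. \<forall>y\<in>E A. close e (val f x) (val f y)"
    let ?d' = "\<lambda>x y. if val f x \<oplus> rneg (val f y) \<sqsubset> \<zero> then rneg (val f x \<oplus> rneg (val f y)) else val f x \<oplus> rneg (val f y)"
    have eq: "?d x y = ?d' x y" if "x \<in> E A" "y \<in> E A" for x y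
      using abs_minus_le(3)[OF v(1)[OF that(1)] v(1)[OF that(2)] e(1)] .
    have "setlike {z \<in> R. \<exists>x\<in>E A. \<exists>y\<in>E A. z = ?d' x y}" by (rule setlike_sep, intro real_definability)
    then obtain D where D: "E D = {z \<in> R. \<exists>x\<in>E A. \<exists>y\<in>E A. z = ?d' x y}" unfolding setlike_def by blast
    have "?d' x y \<in> R" if "x \<in> E A" "y \<in> E A" for x y using v(1) that by simp
    then have "E D = {?d' x y | x y. x \<in> E A \<and> y \<in> E A}" unfolding D by blast
    also have "\<dots> = ?D" by (rule Collect_pairs_cong) (simp only: eq)
    finally have ED: "E D = ?D" .
    have ub: "\<forall>z\<in>E D. z \<sqsubseteq> e" unfolding ED using le(1)[OF _ _ e(1)] c by auto
    have "E D \<subseteq> R" "E D \<noteq> {}" using False le(2)[OF _ _ e(1)] unfolding ED by blast+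
    then obtain s where s: "zf_is_sup mem \<R> (E D) s" using sup_exists[OF _ _ e(1) ub] by blast
    then have "s \<sqsubseteq> e" using ub e(1) unfolding zf_is_sup_def by blast
    then show "\<exists>s. zf_is_osc mem \<R> A f s \<and> s \<sqsubseteq> e" using s unfolding osc ED by blast
  qed
qed

text \<open>Membership in the ring is thereby a matter of covers alone.\<close>

lemma fine_cover_continuous:
  assumes X: "top X" and f: "fn (zf_pts X) (zf_R \<R>) f" and cov: "\<And>e. e \<in> R \<Longrightarrow> \<zero> \<sqsubset> e \<Longrightarrow> \<exists>\<A>. fine_cover X f e \<A>"
  shows "f \<in> CC X"
  unfolding C_iff continuous_real_iff[OF X]
proof (intro conjI f ballI impI)
  fix x e assume x: "x \<in> pts X" and e: "e \<in> R" "\<zero> \<sqsubset> e"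
  obtain \<A> where "fine_cover X f e \<A>" using cov[OF e] by blast
  then obtain A where "clp X (E A)" "x \<in> E A" "\<forall>y\<in>E A. close e (val f x) (val f y)"
    using x unfolding fine_cover_def by blast
  then show "\<exists>U. opn X U \<and> x \<in> U \<and> (\<forall>y\<in>U. close e (val f x) (val f y))" unfolding clp_def by blast
qed

abbreviation UU :: "'v zf_space \<Rightarrow> 'v set" where "UU X \<equiv> E (zf_U mem \<R> X)"
abbreviation UB :: "'v zf_space \<Rightarrow> 'v set" where "UB X \<equiv> E (zf_U_bounded mem \<R> X)"

text \<open>The condition also has to be definable, for otherwise the description that defines the ring would be void.\<close>

lemma U_iff:
  assumes X: "top X"
  shows "f \<in> UU X \<longleftrightarrow> fn (zf_pts X) (zf_R \<R>) f \<and> (\<forall>e\<in>R. \<zero> \<sqsubset> e \<longrightarrow> (\<exists>\<A>. fine_cover X f e \<A>))"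
proof -
  let ?P = "\<lambda>f. \<forall>e\<in>R. \<zero> \<sqsubset> e \<longrightarrow> (\<exists>\<A>. fine_cover X f e \<A>)"
  have cond: "(\<exists>\<A>. zf_countable mem \<A> \<and> (\<forall>A\<in>E \<A>. zf_clopen mem X A) \<and> zf_Union mem \<A> = zf_pts X \<and>
        (\<forall>A\<in>E \<A>. \<exists>s. zf_is_osc mem \<R> A f s \<and> s \<sqsubseteq> e)) \<longleftrightarrow> (\<exists>\<A>. fine_cover X f e \<A>)"
    if f: "f \<in> CC X" and e: "e \<in> R" "\<zero> \<sqsubset> e" for f e
  proof -
    have un: "zf_Union mem \<A> = zf_pts X \<longleftrightarrow> (\<forall>x\<in>pts X. \<exists>A\<in>E \<A>. x \<in> E A)" if cl: "\<forall>A\<in>E \<A>. clp X (E A)" for \<A>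
    proof -
      have "E A \<subseteq> pts X" if "A \<in> E \<A>" for A using cl that clp_subset[OF X] by blast
      then have "(\<Union>A\<in>E \<A>. E A) = pts X \<longleftrightarrow> (\<forall>x\<in>pts X. \<exists>A\<in>E \<A>. x \<in> E A)" by blast
      then show ?thesis using elts_inject[of "zf_Union mem \<A>" "zf_pts X"] by simp
    qed
    have os: "(\<forall>A\<in>E \<A>. \<exists>s. zf_is_osc mem \<R> A f s \<and> s \<sqsubseteq> e) \<longleftrightarrow>
        (\<forall>A\<in>E \<A>. \<forall>x\<in>E A. \<forall>y\<in>E A. close e (val f x) (val f y))" if cl: "\<forall>A\<in>E \<A>. clp X (E A)" for \<A>
    proof -
      have "E A \<subseteq> pts X" if "A \<in> E \<A>" for A using cl that clp_subset[OF X] by blast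
      then have "(\<exists>s. zf_is_osc mem \<R> A f s \<and> s \<sqsubseteq> e) \<longleftrightarrow> (\<forall>x\<in>E A. \<forall>y\<in>E A. close e (val f x) (val f y))"
        if "A \<in> E \<A>" for A using osc_le_iff[OF C_fun[OF f] _ e, of A] that by simp
      then show ?thesis by (rule ball_cong[OF refl])
    qed
    have "(zf_countable mem \<A> \<and> (\<forall>A\<in>E \<A>. zf_clopen mem X A) \<and> zf_Union mem \<A> = zf_pts X \<and>
        (\<forall>A\<in>E \<A>. \<exists>s. zf_is_osc mem \<R> A f s \<and> s \<sqsubseteq> e)) \<longleftrightarrow> fine_cover X f e \<A>" for \<A>
    proof (cases "\<forall>A\<in>E \<A>. clp X (E A)")
      case True
      show ?thesis unfolding fine_cover_def zf_clopen_iff[OF X] un[OF True] os[OF True] ..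
    next
      case False
      then show ?thesis unfolding fine_cover_def zf_clopen_iff[OF X] by (simp only: simp_thms)
    qed
    then show ?thesis by (simp only:)
  qed
  have "{f \<in> CC X. \<forall>e\<in>R. \<zero> \<sqsubset> e \<longrightarrow> (\<exists>\<A>. zf_countable mem \<A> \<and> (\<forall>A\<in>E \<A>. zf_clopen mem X A) \<and> zf_Union mem \<A> = zf_pts X \<and>
        (\<forall>A\<in>E \<A>. \<exists>s. zf_is_osc mem \<R> A f s \<and> s \<sqsubseteq> e))} = {f \<in> CC X. ?P f}"
    by (intro Collect_cong conj_cong refl ball_cong imp_cong) (rule cond)
  moreover have "setlike {f \<in> CC X. ?P f}"
    unfolding fine_cover_def close_def by (rule setlike_sep, intro real_definability dfn_countable dfn_clp)
  ultimately have "UU X = {f \<in> CC X. ?P f}" unfolding zf_U_def by (simp only: elts_zf_set)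
  then have "f \<in> UU X \<longleftrightarrow> f \<in> CC X \<and> ?P f" by simp
  also have "\<dots> \<longleftrightarrow> fn (zf_pts X) (zf_R \<R>) f \<and> ?P f"
    using fine_cover_continuous[OF X, of f] C_fun[of f X] by blast
  finally show ?thesis .
qed

definition bdd :: "'v zf_space \<Rightarrow> 'v \<Rightarrow> bool" where
  "bdd X f \<longleftrightarrow> (\<exists>u\<in>R. \<exists>v\<in>R. \<forall>x\<in>pts X. u \<sqsubseteq> val f x \<and> val f x \<sqsubseteq> v)"

lemma zf_bounded_iff:
  assumes f: "fn (zf_pts X) (zf_R \<R>) f"
  shows "zf_bounded mem \<R> X f \<longleftrightarrow> bdd X f"
proof -
  have neg0: "rneg \<zero> = \<zero>" using neg_eqI[of \<zero> \<zero>] by simp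
  have v: "val f x \<in> R" "zf_app mem f x = val f x" if "x \<in> pts X" for x
    using val_in[OF f] zf_app_eq_val[OF f] that by auto
  have abs: "zf_abs mem \<R> a \<sqsubseteq> m \<longleftrightarrow> a \<sqsubseteq> m \<and> rneg m \<sqsubseteq> a" if "a \<in> R" "m \<in> R" for a m
  proof -
    have z: "zf_minus mem \<R> a \<zero> = a"
      unfolding zf_minus_def by (rule the_equality) (use that zf_plus_eq in auto)
    have "zf_abs mem \<R> a \<sqsubseteq> m \<longleftrightarrow> close m a \<zero>" using abs_minus_le(1)[OF that(1) zero_in that(2)] unfolding z .
    moreover have "\<zero> \<sqsubseteq> a \<oplus> m \<longleftrightarrow> rneg m \<sqsubseteq> a"
    proof
      assume "\<zero> \<sqsubseteq> a \<oplus> m"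
      then have "\<zero> \<oplus> rneg m \<sqsubseteq> a \<oplus> m \<oplus> rneg m" using that by (intro le_add) auto
      then show "rneg m \<sqsubseteq> a" using that by (simp add: radd_assoc)
    next
      assume "rneg m \<sqsubseteq> a"
      then have "rneg m \<oplus> m \<sqsubseteq> a \<oplus> m" using that by (intro le_add) auto
      then show "\<zero> \<sqsubseteq> a \<oplus> m" using that radd_commute[of "rneg m" m] by simp
    qed
    ultimately show ?thesis unfolding close_def using that by simp
  qed
  show ?thesis
  proof
    assume "zf_bounded mem \<R> X f"
    then obtain m where m: "m \<in> R" "\<forall>x\<in>pts X. zf_abs mem \<R> (zf_app mem f x) \<sqsubseteq> m" unfolding zf_bounded_def by blast
    then have "\<forall>x\<in>pts X. rneg m \<sqsubseteq> val f x \<and> val f x \<sqsubseteq> m" using abs v by simp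
    then show "bdd X f" unfolding bdd_def using m(1) rneg_in by blast
  next
    assume "bdd X f"
    then obtain u w where uw: "u \<in> R" "w \<in> R" "\<And>x. x \<in> pts X \<Longrightarrow> u \<sqsubseteq> val f x \<and> val f x \<sqsubseteq> w" unfolding bdd_def by blast
    let ?m = "rmax (rneg u) w"
    have m: "?m \<in> R" using uw by simp
    have "zf_abs mem \<R> (zf_app mem f x) \<sqsubseteq> ?m" if x: "x \<in> pts X" for x
    proof -
      have "val f x \<sqsubseteq> ?m" using le_trans[of "val f x" w ?m] uw(3)[OF x] rmax_ge(2)[of w "rneg u"] v[OF x] uw m by simp
      moreover have "rneg ?m \<sqsubseteq> u" using neg_le[OF rmax_ge(1)[of w "rneg u"]] uw m by simp
      then have "rneg ?m \<sqsubseteq> val f x" using le_trans[of "rneg ?m" u "val f x"] uw(3)[OF x] v[OF x] uw m by simp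
      ultimately show ?thesis using abs v[OF x] m by simp
    qed
    with m show "zf_bounded mem \<R> X f" unfolding zf_bounded_def by blast
  qed
qed

lemma UB_iff:
  assumes X: "top X"
  shows "f \<in> UB X \<longleftrightarrow> f \<in> UU X \<and> bdd X f"
proof -
  have "{f \<in> UU X. zf_bounded mem \<R> X f} = {f \<in> UU X. bdd X f}"
    using zf_bounded_iff U_iff[OF X] by blast
  moreover have "setlike {f \<in> UU X. bdd X f}"
    unfolding bdd_def by (rule setlike_sep, intro real_definability)
  ultimately show ?thesis unfolding zf_U_bounded_def by simp
qed

text \<open>A cover on which \<open>f\<close> oscillates by at most the modulus of continuity of \<open>F\<close> serves the composite.\<close>

lemma U_unif:
  assumes X: "top X" and f: "f \<in> UU X" and F: "unif F"
  shows "\<exists>g\<in>UU X. (\<forall>x\<in>pts X. val g x = F (val f x)) \<and> (bdd X f \<longrightarrow> bdd X g)"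
proof -
  have fn: "fn (zf_pts X) (zf_R \<R>) f" and cov: "\<And>e. e \<in> R \<Longrightarrow> \<zero> \<sqsubset> e \<Longrightarrow> \<exists>\<A>. fine_cover X f e \<A>"
    using f unfolding U_iff[OF X] by blast+
  obtain g where g: "fn (zf_pts X) (zf_R \<R>) g" "\<And>x. x \<in> pts X \<Longrightarrow> val g x = F (val f x)"
    using compose_exists[OF fn F] by blast
  have "\<exists>\<A>. fine_cover X g e \<A>" if e: "e \<in> R" "\<zero> \<sqsubset> e" for e
  proof -
    obtain d where d: "d \<in> R" "\<zero> \<sqsubset> d" "\<forall>a\<in>R. \<forall>b\<in>R. close d a b \<longrightarrow> close e (F a) (F b)"
      using unif_close[OF F e] by blast
    obtain \<A> where A: "fine_cover X f d \<A>" using cov[OF d(1,2)] by blast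
    have "close e (val g x) (val g y)" if "B \<in> E \<A>" "x \<in> E B" "y \<in> E B" for B x y
    proof -
      have "clp X (E B)" "close d (val f x) (val f y)" using A that unfolding fine_cover_def by blast+
      moreover have "x \<in> pts X" "y \<in> pts X" using clp_subset[OF X \<open>clp X (E B)\<close>] that by auto
      ultimately show ?thesis using d(3) g(2) val_in[OF fn] by simp
    qed
    then show ?thesis using A unfolding fine_cover_def by blast
  qed
  then have "g \<in> UU X" unfolding U_iff[OF X] using g(1) by blast
  moreover have "bdd X g" if "bdd X f"
  proof -
    obtain u v where uv: "u \<in> R" "v \<in> R" "\<forall>x\<in>pts X. u \<sqsubseteq> val f x \<and> val f x \<sqsubseteq> v" using \<open>bdd X f\<close> unfolding bdd_def by blast
    obtain u' v' where uv': "u' \<in> R" "v' \<in> R" "\<forall>a\<in>R. u \<sqsubseteq> a \<and> a \<sqsubseteq> v \<longrightarrow> u' \<sqsubseteq> F a \<and> F a \<sqsubseteq> v'"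
      using unif_bounded[OF F uv(1,2)] by blast
    have "u' \<sqsubseteq> val g x \<and> val g x \<sqsubseteq> v'" if "x \<in> pts X" for x
      using uv(3) uv'(3) g(2)[OF that] val_in[OF fn that] that by simp
    then show ?thesis unfolding bdd_def using uv'(1,2) by blast
  qed
  ultimately show ?thesis using g(2) by blast
qed

lemma U_chi:
  assumes X: "top X" and A: "clp X (E A)"
  shows "\<exists>g\<in>UU X. (\<forall>x\<in>pts X. val g x = chi (E A) x) \<and> bdd X g"
proof -
  obtain g where g: "g \<in> CC X" "\<And>x. x \<in> pts X \<Longrightarrow> val g x = chi (E A) x" using C_chi[OF X A] by blast
  let ?B = "zf_set mem (pts X - E A)"
  let ?C = "zf_set mem {A, ?B}"
  have EC: "E ?C = {A, ?B}" "E ?B = pts X - E A" by simp_all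
  have "fine_cover X g e ?C" if e: "e \<in> R" "\<zero> \<sqsubset> e" for e
    unfolding fine_cover_def
  proof (intro conjI ballI)
    show "countable_set ?C" by (intro zf_finite_countable zf_finite_pair)
    show "clp X (E B)" if "B \<in> E ?C" for B using that A clp_compl[OF X A] EC by auto
    show "\<exists>B\<in>E ?C. x \<in> E B" if "x \<in> pts X" for x using that EC by auto
    fix B x y assume B: "B \<in> E ?C" "x \<in> E B" "y \<in> E B"
    then have "x \<in> pts X" "y \<in> pts X" "x \<in> E A \<longleftrightarrow> y \<in> E A" using clp_subset[OF X A] EC by auto
    then have "val g x = val g y" "val g y \<in> R" using g(2) unfolding chi_def by auto
    then show "close e (val g x) (val g y)" using close_refl e by simp
  qed
  then have "g \<in> UU X" unfolding U_iff[OF X] using C_fun[OF g(1)] by blast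
  moreover have "bdd X g" unfolding bdd_def using g(2) lt_imp_le[OF one_pos] unfolding chi_def
    by (intro bexI[of _ \<zero>] bexI[of _ \<one>]) auto
  ultimately show ?thesis using g(2) by blast
qed

text \<open>Assign to each point the first member of the cover that contains it.  The assignment is locally constant,
because finitely many clopen sets precede a given one; hence the set of the points whose first member satisfies
\<open>P\<close> is clopen.  This replaces the disjoint refinement of the cover.\<close>

lemma clopen_cover_selection:
  assumes X: "top X" and count: "countable_set \<A>" and cl: "\<And>A. A \<in> E \<A> \<Longrightarrow> clp X (E A)"
    and co: "\<And>x. x \<in> pts X \<Longrightarrow> \<exists>A\<in>E \<A>. x \<in> E A" and P: "df (\<lambda>s. P (s 0))"
  shows "\<exists>C. clp X (E C) \<and> (\<forall>x\<in>E C. \<exists>A\<in>E \<A>. x \<in> E A \<and> P A) \<and>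
    (\<forall>x\<in>pts X - E C. \<exists>A\<in>E \<A>. x \<in> E A \<and> \<not> P A)"
proof -
  obtain B j where j: "E B \<subseteq> E om" "fn \<A> B j" "inj_on (val j) (E \<A>)"
    using count unfolding zf_countable_def zf_bij_iff by blast
  have jo: "val j A \<in> E om" if "A \<in> E \<A>" for A using val_in[OF j(2) that] j(1) by blast
  have sub: "E A \<subseteq> pts X" if "A \<in> E \<A>" for A using clp_subset[OF X cl[OF that]] .
  have PD: "df (\<lambda>s. P (t s))" if "tm t" for t by (rule dfn_subst[OF that, of "\<lambda>a s. P a"]) (rule P)
  let ?first = "\<lambda>A x. A \<in> E \<A> \<and> x \<in> E A \<and> (\<forall>B\<in>E \<A>. x \<in> E B \<longrightarrow> val j B \<notin> E (val j A))"
  have first_ex: "\<exists>A. ?first A x" if x: "x \<in> pts X" for x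
  proof -
    let ?S = "{n \<in> E om. \<exists>A\<in>E \<A>. x \<in> E A \<and> n = val j A}"
    have "setlike ?S" by (rule setlike_sep, intro definability)
    moreover have "?S \<noteq> {}" using co[OF x] jo by blast
    ultimately obtain n where n: "n \<in> ?S" "\<forall>m\<in>?S. m \<notin> E n" using omega_minimal[of ?S] by blast
    then obtain A where "A \<in> E \<A>" "x \<in> E A" "n = val j A" by blast
    then show ?thesis using n(2) jo by blast
  qed
  have first_unique: "A = A'" if "?first A x" "?first A' x" for A A' x
  proof -
    have "val j A = val j A'" using that omega_linear[OF jo, of A'] jo[of A] by blast
    then show ?thesis using inj_onD[OF j(3)] that by blast
  qed
  \<comment> \<open>only finitely many members are numbered below \<open>n\<close>, so their union is closed\<close>
  have earlier: "\<exists>u\<in>E (zf_opens X). \<forall>x. x \<in> E u \<longleftrightarrow> x \<in> pts X \<and> (\<forall>B\<in>E \<A>. val j B \<in> E n \<longrightarrow> x \<notin> E B)"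
    if "n \<in> E om" for n
    using that
  proof (induction n rule: omega_induct)
    case dfn show ?case by (intro definability)
  next
    case zero
    have "zf_pts X \<in> E (zf_opens X)" using opn_pts[OF X] by simp
    then show ?case by (intro bexI[of _ "zf_pts X"]) simp_all
  next
    case (succ n)
    then obtain u where u: "u \<in> E (zf_opens X)" "\<And>x. x \<in> E u \<longleftrightarrow> x \<in> pts X \<and> (\<forall>B\<in>E \<A>. val j B \<in> E n \<longrightarrow> x \<notin> E B)" by blast
    show ?case
    proof (cases "\<exists>D\<in>E \<A>. val j D = n")
      case True
      then obtain D where D: "D \<in> E \<A>" "val j D = n" by blast
      have uniq: "B = D" if "B \<in> E \<A>" "val j B = n" for B using inj_onD[OF j(3)] that D by blast
      have "opn X (E u \<inter> (pts X - E D))" using opn_Int[OF X] u(1) cl[OF D(1)] unfolding clp_def by simp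
      then obtain w where w: "w \<in> E (zf_opens X)" "E w = E u \<inter> (pts X - E D)" unfolding opn_def by blast
      have "x \<in> E w \<longleftrightarrow> x \<in> pts X \<and> (\<forall>B\<in>E \<A>. val j B \<in> E (zsucc n) \<longrightarrow> x \<notin> E B)" for x
      proof -
        have "val j B \<in> E (zsucc n) \<longleftrightarrow> B = D \<or> val j B \<in> E n" if "B \<in> E \<A>" for B
          using uniq[OF that] D(2) by auto
        then show ?thesis unfolding w(2) using u(2)[of x] D(1) by blast
      qed
      then show ?thesis using w(1) by blast
    next
      case False
      then show ?thesis using u by auto
    qed
  qed
  have nbhd: "\<exists>N. opn X N \<and> x \<in> N \<and> (\<forall>y\<in>N. ?first A y)" if A: "?first A x" for A x
  proof -
    obtain u where u: "u \<in> E (zf_opens X)" "\<And>y. y \<in> E u \<longleftrightarrow> y \<in> pts X \<and> (\<forall>B\<in>E \<A>. val j B \<in> E (val j A) \<longrightarrow> y \<notin> E B)"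
      using earlier[OF jo] A by blast
    have "opn X (E A \<inter> E u)" using opn_Int[OF X] cl A u(1) unfolding clp_def by simp
    moreover have "x \<in> E A \<inter> E u" using A u(2) sub by blast
    moreover have "?first A y" if "y \<in> E A \<inter> E u" for y using that A u(2) by blast
    ultimately show ?thesis by blast
  qed
  let ?C = "{x \<in> pts X. \<exists>A. ?first A x \<and> P A}"
  have "setlike ?C" by (rule setlike_sep, intro definability PD)
  then obtain C where C: "E C = ?C" unfolding setlike_def by blast
  have oC: "opn X (E C)"
  proof (rule opn_nbhd[OF X])
    fix x assume "x \<in> E C"
    then obtain A where A: "?first A x" "P A" unfolding C by blast
    then obtain N where N: "opn X N" "x \<in> N" "\<forall>y\<in>N. ?first A y" using nbhd by blast
    then have "N \<subseteq> E C" unfolding C using A(2) opn_subset[OF X N(1)] by blast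
    with N show "\<exists>U. opn X U \<and> x \<in> U \<and> U \<subseteq> E C" by blast
  qed simp
  have oD: "opn X (pts X - E C)"
  proof (rule opn_nbhd[OF X])
    fix x assume x: "x \<in> pts X - E C"
    then obtain A where A: "?first A x" using first_ex by blast
    then obtain N where N: "opn X N" "x \<in> N" "\<forall>y\<in>N. ?first A y" using nbhd by blast
    have "y \<notin> E C" if "y \<in> N" for y
    proof
      assume "y \<in> E C"
      then obtain A' where A': "?first A' y" "P A'" unfolding C by blast
      have "A' = A" using first_unique[OF A'(1)] N(3) that by blast
      then have "x \<in> E C" unfolding C using A A'(2) x by blast
      then show False using x by blast
    qed
    then have "N \<subseteq> pts X - E C" using opn_subset[OF X N(1)] by blast
    with N show "\<exists>U. opn X U \<and> x \<in> U \<and> U \<subseteq> pts X - E C" by blast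
  qed simp
  have "clp X (E C)" using oC oD unfolding clp_def by blast
  moreover have "\<forall>x\<in>E C. \<exists>A\<in>E \<A>. x \<in> E A \<and> P A" unfolding C by blast
  moreover have "\<forall>x\<in>pts X - E C. \<exists>A\<in>E \<A>. x \<in> E A \<and> \<not> P A"
  proof
    fix x assume x: "x \<in> pts X - E C"
    then obtain A where A: "?first A x" using first_ex by blast
    then have "\<not> P A" using x unfolding C by blast
    then show "\<exists>A\<in>E \<A>. x \<in> E A \<and> \<not> P A" using A by blast
  qed
  ultimately show ?thesis by blast
qed

text \<open>Choose \<open>q = 1/4\<close> and select the members of the cover on which \<open>f\<close> somewhere reaches \<open>1/2\<close>.\<close>

lemma U_separation:
  assumes X: "top X" and f: "f \<in> UU X"
  shows "\<exists>C. \<exists>q\<in>R. clp X (E C) \<and> \<zero> \<sqsubset> q \<and> (\<forall>x\<in>E C. q \<sqsubseteq> val f x) \<and> (\<forall>x\<in>pts X - E C. q \<sqsubseteq> \<one> \<oplus> rneg (val f x))"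
proof -
  have fn: "fn (zf_pts X) (zf_R \<R>) f" and cov: "\<And>e. e \<in> R \<Longrightarrow> \<zero> \<sqsubset> e \<Longrightarrow> \<exists>\<A>. fine_cover X f e \<A>"
    using f unfolding U_iff[OF X] by blast+
  have v: "val f x \<in> R" if "x \<in> pts X" for x using val_in[OF fn that] .
  \<comment> \<open>\<open>h = 1/2\<close> and \<open>q = 1/4\<close>\<close>
  obtain h where h: "h \<in> R" "\<zero> \<sqsubset> h" "h \<oplus> h = \<one>" using half_exists[OF one_pos one_in] by blast
  obtain q where q: "q \<in> R" "\<zero> \<sqsubset> q" "q \<oplus> q = h" using half_exists[OF h(2,1)] by blast
  obtain \<A> where A: "fine_cover X f q \<A>" using cov[OF q(1,2)] by blast
  then have count: "countable_set \<A>"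
    and cl: "\<And>A. A \<in> E \<A> \<Longrightarrow> clp X (E A)" and co: "\<And>x. x \<in> pts X \<Longrightarrow> \<exists>A\<in>E \<A>. x \<in> E A"
    and os: "\<And>A x y. A \<in> E \<A> \<Longrightarrow> x \<in> E A \<Longrightarrow> y \<in> E A \<Longrightarrow> close q (val f x) (val f y)"
    unfolding fine_cover_def by blast+
  have sub: "E A \<subseteq> pts X" if "A \<in> E \<A>" for A using clp_subset[OF X cl[OF that]] .
  have "df (\<lambda>s. \<exists>y\<in>E (s 0). h \<sqsubseteq> val f y)" by (intro real_definability)
  from clopen_cover_selection[where P = "\<lambda>A. \<exists>y\<in>E A. h \<sqsubseteq> val f y", OF X count cl co this]
  obtain C where clC: "clp X (E C)" and C: "\<forall>x\<in>E C. \<exists>A\<in>E \<A>. x \<in> E A \<and> (\<exists>y\<in>E A. h \<sqsubseteq> val f y)"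
    and D: "\<forall>x\<in>pts X - E C. \<exists>A\<in>E \<A>. x \<in> E A \<and> \<not> (\<exists>y\<in>E A. h \<sqsubseteq> val f y)" by blast
  have "q \<sqsubseteq> val f x" if "x \<in> E C" for x
  proof -
    obtain A y where A: "A \<in> E \<A>" "x \<in> E A" "y \<in> E A" "h \<sqsubseteq> val f y" using C \<open>x \<in> E C\<close> by blast
    have xy: "x \<in> pts X" "y \<in> pts X" using A sub by blast+
    have "val f y \<sqsubseteq> val f x \<oplus> q" using os[OF A(1,2,3)] unfolding close_def by blast
    then have "q \<oplus> q \<sqsubseteq> val f x \<oplus> q" unfolding q(3) using le_trans[OF A(4)] v xy q h by simp
    then show ?thesis using add_le_cancel q v xy by blast
  qed
  moreover have "q \<sqsubseteq> \<one> \<oplus> rneg (val f x)" if x: "x \<in> pts X - E C" for x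
  proof -
    have "\<not> h \<sqsubseteq> val f x" using D x by blast
    then have "val f x \<sqsubseteq> h" using le_linear[OF h(1) v] x by blast
    then have "rneg h \<sqsubseteq> rneg (val f x)" using neg_le v x h by blast
    then have "\<one> \<oplus> rneg h \<sqsubseteq> \<one> \<oplus> rneg (val f x)" using x v h by (intro add_mono) auto
    moreover have "\<one> \<oplus> rneg h = h" using radd_assoc[of h h "rneg h"] h by simp
    moreover have "q \<sqsubseteq> h" using lt_imp_le[OF lt_add_pos[OF q(2) q(1) q(1)]] q(3) by simp
    ultimately show ?thesis using le_trans[of q h "\<one> \<oplus> rneg (val f x)"] q h v x by simp
  qed
  ultimately show ?thesis using clC q by blast
qed

end

section \<open>Embeddings and compactifications\<close>

context zf_model
begin

lemma elts_image: "fn A B f \<Longrightarrow> E (zf_image mem f A) = val f ` E A"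
proof -
  assume f: "fn A B f"
  have "setlike {y \<in> E B. \<exists>x\<in>E A. y = val f x}" by (rule setlike_sep, intro definability)
  moreover have "{y \<in> E B. \<exists>x\<in>E A. y = val f x} = zf_app mem f ` E A"
    using val_in[OF f] zf_app_eq_val[OF f] by auto
  ultimately have "E (zf_image mem f A) = zf_app mem f ` E A" unfolding zf_image_def by simp
  also have "\<dots> = val f ` E A" using zf_app_eq_val[OF f] by auto
  finally show ?thesis .
qed

lemma pts_subspace [simp]: "zf_pts (zf_subspace mem S A) = A"
  unfolding zf_subspace_def by simp

lemma opn_subspace: "opn (zf_subspace mem S A) W \<longleftrightarrow> (\<exists>U. opn S U \<and> W = U \<inter> E A)"
proof -
  have eq: "w = zf_set mem (E u \<inter> E A) \<longleftrightarrow> (\<forall>x. x \<in> E w \<longleftrightarrow> x \<in> E u \<and> x \<in> E A)" for u w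
    using elts_inject[of w "zf_set mem (E u \<inter> E A)"] by (simp add: set_eq_iff)
  have "setlike {w. \<exists>u\<in>E (zf_opens S). \<forall>x. x \<in> E w \<longleftrightarrow> x \<in> E u \<and> x \<in> E A}"
    by (rule setlike_subset[where A = "zpow A"]) (intro definability, auto)
  moreover have "{w. \<exists>u\<in>E (zf_opens S). \<forall>x. x \<in> E w \<longleftrightarrow> x \<in> E u \<and> x \<in> E A} = {zf_set mem (E u \<inter> E A) | u. u \<in> E (zf_opens S)}"
    unfolding eq[symmetric] by blast
  ultimately have *: "E (zf_opens (zf_subspace mem S A)) = {zf_set mem (E u \<inter> E A) | u. u \<in> E (zf_opens S)}"
    unfolding zf_subspace_def by simp
  have "opn (zf_subspace mem S A) W \<longleftrightarrow> (\<exists>u\<in>E (zf_opens S). E (zf_set mem (E u \<inter> E A)) = W)"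
    unfolding opn_def * by blast
  also have "\<dots> \<longleftrightarrow> (\<exists>u\<in>E (zf_opens S). W = E u \<inter> E A)"
    by (simp only: elts_zf_set[OF setlike_Int] eq_commute[of W])
  finally show ?thesis unfolding opn_def by blast
qed

lemma embedding_continuous:
  assumes "zf_embedding mem S T f"
  shows "zf_continuous mem S T f"
proof -
  let ?A = "zf_image mem f (zf_pts S)"
  have f: "fn (zf_pts S) (zf_pts T) f" and c: "zf_continuous mem S (zf_subspace mem T ?A) f"
    using assms unfolding zf_embedding_def zf_homeomorphism_def by blast+
  have "opn S {x \<in> pts S. val f x \<in> V}" if "opn T V" for V
  proof -
    have "opn (zf_subspace mem T ?A) (V \<inter> E ?A)" unfolding opn_subspace using that by blast
    then have "opn S {x \<in> pts S. val f x \<in> V \<inter> E ?A}" using c unfolding zf_continuous_iff by blast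
    moreover have "{x \<in> pts S. val f x \<in> V \<inter> E ?A} = {x \<in> pts S. val f x \<in> V}"
      unfolding elts_image[OF f] by blast
    ultimately show ?thesis by simp
  qed
  then show ?thesis unfolding zf_continuous_iff using f by blast
qed

text \<open>Injectivity comes from \<open>T\<^sub>1\<close>, since a neighbourhood of the one point would have to contain the other; the
inverse is continuous because the open sets of \<open>T\<close> that witness the condition have an open union.\<close>

lemma embeddingI:
  assumes T: "top T" and T1: "zf_T1 mem S" and c: "zf_continuous mem S T f"
    and nb: "\<And>W x. opn S W \<Longrightarrow> x \<in> W \<Longrightarrow> \<exists>U. opn T U \<and> val f x \<in> U \<and> (\<forall>y\<in>pts S. val f y \<in> U \<longrightarrow> y \<in> W)"
  shows "zf_embedding mem S T f"
proof -
  let ?A = "zf_image mem f (zf_pts S)"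
  let ?S = "zf_subspace mem T ?A"
  have f: "fn (zf_pts S) (zf_pts T) f" using c unfolding zf_continuous_iff by blast
  have im: "E ?A = val f ` pts S" by (rule elts_image[OF f])
  have inj: "x = y" if xy: "x \<in> pts S" "y \<in> pts S" "val f x = val f y" for x y
  proof (rule ccontr)
    assume "x \<noteq> y"
    then obtain W where W: "W \<in> E (zf_opens S)" "x \<in> E W" "y \<notin> E W" using T1 xy(1,2) unfolding zf_T1_def by blast
    have "opn S (E W)" using W(1) by simp
    from nb[OF this W(2)] show False using xy W(3) by auto
  qed
  have fA: "fn (zf_pts S) ?A f"
    unfolding zf_fun_def
  proof (intro conjI ballI)
    show "E f \<subseteq> E (zf_prod mem (zf_pts S) ?A)"
    proof
      fix p assume p: "p \<in> E f"
      then obtain x y where xy: "p = pr x y" "x \<in> pts S" using f unfolding zf_fun_def elts_zf_prod by blast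
      then have "val f x = y" using val_eqI[OF f] p by blast
      moreover have "val f x \<in> E ?A" unfolding im using xy(2) by blast
      ultimately show "p \<in> E (zf_prod mem (zf_pts S) ?A)" using xy by simp
    qed
    show "\<exists>!y. pr x y \<in> E f" if "x \<in> pts S" for x using fun_ex1[OF f that] .
  qed
  have c1: "zf_continuous mem S ?S f"
    unfolding zf_continuous_iff opn_subspace
  proof (intro conjI allI impI)
    show "fn (zf_pts S) (zf_pts ?S) f" using fA by simp
    fix V assume "\<exists>U. opn T U \<and> V = U \<inter> E ?A"
    then obtain U where U: "opn T U" "V = U \<inter> E ?A" by blast
    have "{x \<in> pts S. val f x \<in> V} = {x \<in> pts S. val f x \<in> U}" unfolding U(2) im by blast
    then show "opn S {x \<in> pts S. val f x \<in> V}" using c U(1) unfolding zf_continuous_iff by simp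
  qed
  have "\<exists>g. fn ?A (zf_pts S) g \<and> (\<forall>p\<in>E ?A. val g p \<in> pts S \<and> p = val f (val g p))"
  proof (rule fun_existsI)
    show "df (\<lambda>s. s 0 = val f (s (Suc 0)))" by (intro definability)
    show "\<exists>!x. x \<in> pts S \<and> p = val f x" if "p \<in> E ?A" for p using that inj unfolding im by blast
  qed
  then obtain g where g: "fn ?A (zf_pts S) g" "\<And>p. p \<in> E ?A \<Longrightarrow> val g p \<in> pts S" "\<And>p. p \<in> E ?A \<Longrightarrow> val f (val g p) = p" by auto
  have gf: "val g (val f x) = x" if "x \<in> pts S" for x
  proof -
    have "val f x \<in> E ?A" using that im by blast
    then show ?thesis using inj[of "val g (val f x)" x] g(2,3) that by simp
  qed
  have c2: "zf_continuous mem ?S S g"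
    unfolding zf_continuous_iff opn_subspace
  proof (intro conjI allI impI)
    show "fn (zf_pts ?S) (zf_pts S) g" using g(1) by simp
    fix V assume V: "opn S V"
    obtain v where v: "E v = V" using opn_setlike[OF V] unfolding setlike_def by blast
    let ?U = "{p \<in> pts T. \<exists>u\<in>E (zf_opens T). p \<in> E u \<and> (\<forall>y\<in>pts S. val f y \<in> E u \<longrightarrow> y \<in> E v)}"
    have "opn T ?U"
    proof (rule opn_nbhd[OF T])
      show "setlike ?U" by (rule setlike_sep, intro definability)
      fix p assume "p \<in> ?U"
      then obtain u where u: "u \<in> E (zf_opens T)" "p \<in> E u" "\<forall>y\<in>pts S. val f y \<in> E u \<longrightarrow> y \<in> E v" by blast
      have "E u \<subseteq> pts T" using opn_subset[OF T, of "E u"] u(1) by simp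
      then have "E u \<subseteq> ?U" using u by blast
      then show "\<exists>U. opn T U \<and> p \<in> U \<and> U \<subseteq> ?U" using u by (intro exI[of _ "E u"]) simp
    qed
    moreover have "{p \<in> pts ?S. val g p \<in> V} = ?U \<inter> E ?A"
    proof (intro equalityI subsetI)
      fix p assume "p \<in> {p \<in> pts ?S. val g p \<in> V}"
      then have p: "p \<in> E ?A" "val g p \<in> V" by auto
      obtain U where U: "opn T U" "val f (val g p) \<in> U" "\<forall>y\<in>pts S. val f y \<in> U \<longrightarrow> y \<in> V" using nb[OF V p(2)] by blast
      obtain u where u: "u \<in> E (zf_opens T)" "E u = U" using U(1) unfolding opn_def by blast
      have "p \<in> E u" using U(2) g(3)[OF p(1)] u(2) by simp
      moreover have "p \<in> pts T" using opn_subset[OF T U(1)] u(2) \<open>p \<in> E u\<close> by blast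
      ultimately show "p \<in> ?U \<inter> E ?A" using u U(3) p(1) v by blast
    next
      fix p assume p: "p \<in> ?U \<inter> E ?A"
      then obtain x where x: "x \<in> pts S" "p = val f x" using im by blast
      then have "x \<in> V" using p v by blast
      then show "p \<in> {p \<in> pts ?S. val g p \<in> V}" using p gf[OF x(1)] x(2) by simp
    qed
    ultimately show "\<exists>U. opn T U \<and> {p \<in> pts ?S. val g p \<in> V} = U \<inter> E ?A" by blast
  qed
  have "zf_homeomorphism mem S ?S f"
    unfolding zf_homeomorphism_def
  proof (intro conjI c1 exI[of _ g] c2 ballI)
    show "zf_app mem g (zf_app mem f x) = x" if "x \<in> pts S" for x
      using gf[OF that] zf_app_eq_val[OF f that] zf_app_eq_val[OF g(1), of "val f x"] im that by simp
    show "zf_app mem f (zf_app mem g p) = p" if "p \<in> pts ?S" for p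
      using that g(3)[of p] zf_app_eq_val[OF g(1), of p] zf_app_eq_val[OF f g(2)[of p]] by simp
  qed
  then show ?thesis unfolding zf_embedding_def using f by blast
qed

lemma dense_iff: "fn A (zf_pts Z) f \<Longrightarrow>
  zf_dense mem Z (zf_image mem f A) \<longleftrightarrow> (\<forall>U. opn Z U \<longrightarrow> U \<noteq> {} \<longrightarrow> (\<exists>x\<in>E A. val f x \<in> U))"
proof -
  assume f: "fn A (zf_pts Z) f"
  have "val f ` E A \<subseteq> pts Z" using val_in[OF f] by blast
  then have "zf_dense mem Z (zf_image mem f A) \<longleftrightarrow> (\<forall>u\<in>E (zf_opens Z). E u \<noteq> {} \<longrightarrow> E u \<inter> val f ` E A \<noteq> {})"
    unfolding zf_dense_def elts_image[OF f] by simp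
  also have "\<dots> \<longleftrightarrow> (\<forall>U. opn Z U \<longrightarrow> U \<noteq> {} \<longrightarrow> U \<inter> val f ` E A \<noteq> {})" unfolding opn_def by blast
  also have "\<dots> \<longleftrightarrow> (\<forall>U. opn Z U \<longrightarrow> U \<noteq> {} \<longrightarrow> (\<exists>x\<in>E A. val f x \<in> U))" by blast
  finally show ?thesis .
qed

lemma extends_to_iff:
  assumes b: "fn (zf_pts X) (zf_pts Z) b"
  shows "zf_extends_to mem X Z b K \<longleftrightarrow>
    (\<forall>f. zf_continuous mem X K f \<longrightarrow>
      (\<exists>g. zf_continuous mem Z K g \<and> (\<forall>x\<in>pts X. val g (val b x) = val f x)))"
proof -
  have "(\<forall>x\<in>pts X. zf_app mem g (zf_app mem b x) = zf_app mem f x) \<longleftrightarrow> (\<forall>x\<in>pts X. val g (val b x) = val f x)"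
    if "zf_continuous mem X K f" "zf_continuous mem Z K g" for f g
  proof (rule ball_cong[OF refl])
    fix x assume x: "x \<in> pts X"
    have fg: "fn (zf_pts X) (zf_pts K) f" "fn (zf_pts Z) (zf_pts K) g"
      using that unfolding zf_continuous_iff by blast+
    show "(zf_app mem g (zf_app mem b x) = zf_app mem f x) = (val g (val b x) = val f x)"
      using zf_app_eq_val[OF b x] zf_app_eq_val[OF fg(1) x] zf_app_eq_val[OF fg(2) val_in[OF b x]] by simp
  qed
  then show ?thesis unfolding zf_extends_to_def by blast
qed

text \<open>Continuous maps into the discrete space on these two points correspond to clopen sets.\<close>

definition two :: "'v" where "two = zf_set mem {emp, zsucc emp}"

definition discrete_two :: "'v zf_space" where "discrete_two = Zf_Space two (zpow two)"

lemma elts_two [simp]: "E two = {emp, zsucc emp}" unfolding two_def by (rule elts_zf_set) (rule setlike_pair)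

lemma zero_neq_succ: "emp \<noteq> zsucc emp"
  using not_mem_self[of emp] by (metis elts_zsucc insertI1)

lemma pts_two [simp]: "zf_pts discrete_two = two" unfolding discrete_two_def by simp

lemma opn_two: "opn discrete_two U \<longleftrightarrow> setlike U \<and> U \<subseteq> E two"
  unfolding opn_def discrete_two_def setlike_def by auto

lemma top_two: "top discrete_two"
  unfolding zf_topological_def discrete_two_def by auto

lemma clp_two: "clp discrete_two (E A) \<longleftrightarrow> E A \<subseteq> E two"
  unfolding clp_def opn_two by (simp del: elts_two)

lemma zero_dimensional_two: "zf_zero_dimensional mem discrete_two"
  unfolding zf_zero_dimensional_def zf_clopen_iff[OF top_two]
proof (rule zf_baseI)
  show "df (\<lambda>s. s 0 \<in> {A. clp discrete_two (E A)})" unfolding mem_Collect_eq by (intro dfn_clp trm_var)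
  show "opn discrete_two (E A)" if "A \<in> {A. clp discrete_two (E A)}" for A
    using that unfolding clp_def by blast
  fix U x assume U: "opn discrete_two U" "x \<in> U"
  then obtain u where u: "E u = U" unfolding opn_def by blast
  have "E u \<subseteq> E two" using U(1) unfolding opn_two u by (rule conjunct2)
  then have "clp discrete_two (E u)" by (rule clp_two[THEN iffD2])
  then show "\<exists>B\<in>{A. clp discrete_two (E A)}. x \<in> E B \<and> E B \<subseteq> U"
    using U(2) u by (intro bexI[of _ u]) simp_all
qed

lemma T1_two: "zf_T1 mem discrete_two"
  unfolding zf_T1_def
proof (intro ballI impI)
  fix x y assume xy: "x \<in> pts discrete_two" "y \<in> pts discrete_two" "x \<noteq> y"
  have "opn discrete_two {x}" using xy(1) unfolding opn_two by simp
  then obtain U where "U \<in> E (zf_opens discrete_two)" "E U = {x}" unfolding opn_def by blast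
  then show "\<exists>U\<in>E (zf_opens discrete_two). x \<in> E U \<and> y \<notin> E U"
    using xy(3) by (intro bexI[of _ U]) simp_all
qed

lemma compact_two: "zf_compact mem discrete_two"
  unfolding zf_compact_def
proof (intro allI impI)
  fix C assume C: "E C \<subseteq> E (zf_opens discrete_two) \<and> zf_Union mem C = zf_pts discrete_two"
  then have un: "(\<Union>u\<in>E C. E u) = {emp, zsucc emp}" using elts_zf_Union[of C] by simp
  then obtain u v where uv: "u \<in> E C" "v \<in> E C" "emp \<in> E u" "zsucc emp \<in> E v" by blast
  have D: "E (zf_set mem {u, v}) = {u, v}" by simp
  have "E (zf_Union mem (zf_set mem {u, v})) = E two"
  proof -
    have "E u \<union> E v = {emp, zsucc emp}" using un uv by blast
    then show ?thesis by simp
  qed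
  then have "zf_Union mem (zf_set mem {u, v}) = zf_pts discrete_two" unfolding elts_inject by simp
  then show "\<exists>D. E D \<subseteq> E C \<and> zf_finite mem D \<and> zf_Union mem D = zf_pts discrete_two"
  proof (intro exI conjI)
    show "E (zf_set mem {u, v}) \<subseteq> E C" unfolding D using uv(1,2) by blast
    show "zf_finite mem (zf_set mem {u, v})" by (rule zf_finite_pair)
  qed
qed

text \<open>The characteristic function of \<open>C\<close>, as a map to the two-point space, extends to \<open>Z\<close>.\<close>

lemma clopen_extends:
  assumes X: "top X" and Z: "top Z" and b: "fn (zf_pts X) (zf_pts Z) b"
    and ext: "zf_extends_to mem X Z b discrete_two" and C: "clp X (E C)"
  shows "\<exists>A. clp Z (E A) \<and> (\<forall>x\<in>pts X. val b x \<in> E A \<longleftrightarrow> x \<in> E C)"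
proof -
  let ?F = "\<lambda>x. if x \<in> E C then zsucc emp else emp"
  have "\<exists>f. fn (zf_pts X) two f \<and> (\<forall>x\<in>pts X. val f x = ?F x)"
  proof (rule fun_exists_trm)
    show "tm (\<lambda>s. ?F (s 0))" by (intro definability)
    show "?F x \<in> E two" for x unfolding elts_two by (simp only: insert_iff split: if_split) simp
  qed
  then obtain f where f: "fn (zf_pts X) two f" "\<And>x. x \<in> pts X \<Longrightarrow> val f x = ?F x" by blast
  have "zf_continuous mem X discrete_two f"
    unfolding zf_continuous_iff
  proof (intro conjI allI impI)
    show "fn (zf_pts X) (zf_pts discrete_two) f" using f(1) by simp
    fix V assume V: "opn discrete_two V"
    show "opn X {x \<in> pts X. val f x \<in> V}"
    proof (rule opn_nbhd[OF X])
      obtain v where "E v = V" using V unfolding opn_def by blast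
      then show "setlike {x \<in> pts X. val f x \<in> V}" using setlike_preimage[of "zf_pts X" f v] by simp
      fix x assume "x \<in> {x \<in> pts X. val f x \<in> V}"
      then have x: "x \<in> pts X" "val f x \<in> V" by blast+
      obtain U where U: "opn X U" "x \<in> U" "\<forall>y\<in>U. y \<in> E C \<longleftrightarrow> x \<in> E C"
        using clp_separates[OF C x(1)] by blast
      have "y \<in> {x \<in> pts X. val f x \<in> V}" if y: "y \<in> U" for y
      proof -
        have yX: "y \<in> pts X" using opn_subset[OF X U(1)] y by blast
        have "y \<in> E C \<longleftrightarrow> x \<in> E C" using U(3) y by blast
        then have "val f y = val f x" unfolding f(2)[OF yX] f(2)[OF x(1)] by (simp only:)
        then show ?thesis using yX x(2) by simp
      qed
      then show "\<exists>U. opn X U \<and> x \<in> U \<and> U \<subseteq> {x \<in> pts X. val f x \<in> V}"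
        using U(1,2) by blast
    qed
  qed
  then obtain g where g: "zf_continuous mem Z discrete_two g" "\<And>x. x \<in> pts X \<Longrightarrow> val g (val b x) = val f x"
    using ext unfolding extends_to_iff[OF b] by blast
  have gf: "fn (zf_pts Z) two g" using g(1) unfolding zf_continuous_iff by simp
  let ?A = "{z \<in> pts Z. val g z \<in> {zsucc emp}}"
  have o: "opn discrete_two {zsucc emp}" "opn discrete_two {emp}" unfolding opn_two elts_two by (blast intro: setlike_singleton)+
  have oA: "opn Z ?A" using g(1) o(1) unfolding zf_continuous_iff by blast
  have "opn Z {z \<in> pts Z. val g z \<in> {emp}}" using g(1) o(2) unfolding zf_continuous_iff by blast
  moreover have "{z \<in> pts Z. val g z \<in> {emp}} = pts Z - ?A"
  proof -
    have "val g z \<in> {emp} \<longleftrightarrow> val g z \<notin> {zsucc emp}" if "z \<in> pts Z" for z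
      using val_in[OF gf that, unfolded elts_two] zero_neq_succ by (metis insertE singletonD singletonI)
    then show ?thesis by blast
  qed
  ultimately have "clp Z ?A" using oA unfolding clp_def by simp
  moreover obtain A where A: "E A = ?A" using opn_setlike[OF oA] unfolding setlike_def by blast
  moreover have "val b x \<in> ?A \<longleftrightarrow> x \<in> E C" if "x \<in> pts X" for x
  proof -
    have "val b x \<in> ?A \<longleftrightarrow> ?F x = zsucc emp" using g(2)[OF that] f(2)[OF that] val_in[OF b that] by (simp only: mem_Collect_eq singleton_iff simp_thms)
    then show ?thesis using zero_neq_succ by (simp only: split: if_split) blast
  qed
  ultimately show ?thesis by (intro exI[of _ A] conjI ballI) (simp_all only:)
qed

text \<open>The usual argument that two maps into a Hausdorff space agree if they agree on a dense set, for a map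
and the identity.\<close>

lemma dense_agree:
  assumes Z: "top Z" and haus: "\<And>x y. x \<in> pts Z \<Longrightarrow> y \<in> pts Z \<Longrightarrow> x \<noteq> y \<Longrightarrow>
      \<exists>W W'. opn Z W \<and> opn Z W' \<and> x \<in> W \<and> y \<in> W' \<and> W \<inter> W' = {}"
    and k: "zf_continuous mem Z Z k"
    and dense: "\<And>U. opn Z U \<Longrightarrow> U \<noteq> {} \<Longrightarrow> \<exists>y\<in>U. val k y = y" and z: "z \<in> pts Z"
  shows "val k z = z"
proof (rule ccontr)
  assume ne: "val k z \<noteq> z"
  have kf: "fn (zf_pts Z) (zf_pts Z) k" using k unfolding zf_continuous_iff by blast
  obtain W W' where W: "opn Z W" "opn Z W'" "val k z \<in> W" "z \<in> W'" "W \<inter> W' = {}"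
    using haus[OF val_in[OF kf z] z ne] by blast
  have "opn Z ({x \<in> pts Z. val k x \<in> W} \<inter> W')" using opn_Int[OF Z _ W(2)] k W(1) unfolding zf_continuous_iff by blast
  moreover have "z \<in> {x \<in> pts Z. val k x \<in> W} \<inter> W'" using z W by blast
  ultimately obtain y where "y \<in> {x \<in> pts Z. val k x \<in> W} \<inter> W'" "val k y = y" using dense by blast
  then show False using W(5) by auto
qed

end

context zf_real_model
begin

text \<open>The extensions of the two embeddings to each other's compactification are mutually inverse, because their
composites fix the dense image of \<open>Y\<close>.\<close>

lemma max_Tychonoff_compactification_unique:
  assumes Y: "top Y" and 1: "zf_max_Tychonoff_compactification mem \<R> Y Z t"
    and 2: "zf_max_Tychonoff_compactification mem \<R> Y W s"
  shows "zf_homeomorphic mem Z W"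
proof -
  have c: "\<exists>k. zf_continuous mem Z W k \<and> (\<forall>y\<in>pts Y. val k (val t y) = val s y)"
    if "zf_max_Tychonoff_compactification mem \<R> Y Z t" "zf_max_Tychonoff_compactification mem \<R> Y W s" for Z W t s
  proof -
    have t: "zf_continuous mem Y Z t" and s: "zf_continuous mem Y W s"
      using that embedding_continuous unfolding zf_max_Tychonoff_compactification_def zf_compactification_def by blast+
    have tf: "fn (zf_pts Y) (zf_pts Z) t" using t unfolding zf_continuous_iff by blast
    have "zf_extends_to mem Y Z t W"
      using that unfolding zf_max_Tychonoff_compactification_def zf_compactification_def by blast
    then show ?thesis using s unfolding extends_to_iff[OF tf] by blast
  qed
  have id: "val l (val k z) = z"
    if "zf_max_Tychonoff_compactification mem \<R> Y Z t"
      and k: "zf_continuous mem Z W k" "\<forall>y\<in>pts Y. val k (val t y) = val s y"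
      and l: "zf_continuous mem W Z l" "\<forall>y\<in>pts Y. val l (val s y) = val t y" and z: "z \<in> pts Z" for Z W t s k l z
  proof -
    have Z: "top Z" "zf_Tychonoff mem \<R> Z" and d: "zf_dense mem Z (zf_image mem t (zf_pts Y))" 
      and t: "zf_continuous mem Y Z t"
      using that(1) embedding_continuous unfolding zf_max_Tychonoff_compactification_def zf_compactification_def by blast+
    have tf: "fn (zf_pts Y) (zf_pts Z) t" using t unfolding zf_continuous_iff by blast
    obtain m where m: "zf_continuous mem Z Z m" "\<forall>x\<in>pts Z. val m x = val l (val k x)"
      using continuous_compose[OF k(1) l(1)] by blast
    have "val m z = z"
    proof (rule dense_agree[OF Z(1) _ m(1) _ z])
      show "\<exists>W W'. opn Z W \<and> opn Z W' \<and> x \<in> W \<and> y \<in> W' \<and> W \<inter> W' = {}"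
        if "x \<in> pts Z" "y \<in> pts Z" "x \<noteq> y" for x y using Tychonoff_Hausdorff[OF Z that] .
      fix U assume "opn Z U" "U \<noteq> {}"
      then obtain y where y: "y \<in> pts Y" "val t y \<in> U" using d unfolding dense_iff[OF tf] by blast
      have "val m (val t y) = val t y" using m(2) k(2) l(2) y(1) val_in[OF tf y(1)] by simp
      then show "\<exists>x\<in>U. val m x = x" using y(2) by blast
    qed
    then show ?thesis using m(2) z by simp
  qed
  obtain k where k: "zf_continuous mem Z W k" "\<forall>y\<in>pts Y. val k (val t y) = val s y" using c[OF 1 2] by blast
  obtain l where l: "zf_continuous mem W Z l" "\<forall>y\<in>pts Y. val l (val s y) = val t y" using c[OF 2 1] by blast
  have kf: "fn (zf_pts Z) (zf_pts W) k" and lf: "fn (zf_pts W) (zf_pts Z) l" using k l unfolding zf_continuous_iff by blast+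
  have "zf_homeomorphism mem Z W k"
    unfolding zf_homeomorphism_def
  proof (intro conjI k(1) exI[of _ l] l(1) ballI)
    show "zf_app mem l (zf_app mem k z) = z" if z: "z \<in> pts Z" for z
      using id[OF 1 k l z] zf_app_eq_val[OF kf z] zf_app_eq_val[OF lf val_in[OF kf z]] by simp
    show "zf_app mem k (zf_app mem l w) = w" if w: "w \<in> pts W" for w
      using id[OF 2 l k w] zf_app_eq_val[OF lf w] zf_app_eq_val[OF kf val_in[OF lf w]] by simp
  qed
  then show ?thesis unfolding zf_homeomorphic_def by blast
qed

end

section \<open>The map induced by a ring isomorphism\<close>

text \<open>The parameter \<open>P\<close> is either ring, so that both parts of the theorem are instances.\<close>

locale function_ring_isomorphism = zf_real_model mem \<R>
  for mem :: "'v \<Rightarrow> 'v \<Rightarrow> bool" and \<R> :: "'v zf_reals" +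
  fixes X Z Y :: "'v zf_space" and b P h :: 'v
  assumes X: "zf_topological mem X" and Y: "zf_topological mem Y" and YT: "zf_Tychonoff mem \<R> Y"
    and Z: "zf_Banaschewski mem X Z b"
    and P: "zf_elts mem P = UU X \<or> zf_elts mem P = UB X"
    and h: "zf_bij mem P (zf_C mem \<R> Y) h"
    and hom: "\<And>f g k. f \<in> E P \<Longrightarrow> g \<in> E P \<Longrightarrow> k \<in> E P \<Longrightarrow>
        (zf_is_sum mem \<R> X f g k \<longrightarrow> zf_is_sum mem \<R> Y (zf_app mem h f) (zf_app mem h g) (zf_app mem h k)) \<and>
        (zf_is_product mem \<R> X f g k \<longrightarrow> zf_is_product mem \<R> Y (zf_app mem h f) (zf_app mem h g) (zf_app mem h k))"
begin

lemma P_U: "f \<in> E P \<Longrightarrow> f \<in> UU X"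
  using P UB_iff[OF X] by blast

lemma P_fun: "f \<in> E P \<Longrightarrow> fn (zf_pts X) (zf_R \<R>) f"
  using P_U U_iff[OF X] by blast

lemma P_val: "f \<in> E P \<Longrightarrow> x \<in> pts X \<Longrightarrow> val f x \<in> R"
  using P_fun val_in by blast

lemma P_unif:
  assumes f: "f \<in> E P" and F: "unif F"
  shows "\<exists>g\<in>E P. \<forall>x\<in>pts X. val g x = F (val f x)"
proof -
  obtain g where g: "g \<in> UU X" "\<forall>x\<in>pts X. val g x = F (val f x)" "bdd X f \<longrightarrow> bdd X g"
    using U_unif[OF X P_U[OF f] F] by blast
  have "g \<in> E P" using P
  proof
    assume "E P = UB X"
    then show ?thesis using f g(1,3) UB_iff[OF X] by blast
  qed (use g(1) in blast)
  with g(2) show ?thesis by blast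
qed

lemma P_chi: "clp X (E A) \<Longrightarrow> \<exists>g\<in>E P. \<forall>x\<in>pts X. val g x = chi (E A) x"
  using U_chi[OF X, of A] P UB_iff[OF X] by blast

lemma h_fun: "fn P (zf_C mem \<R> Y) h" and h_inj: "inj_on (val h) (E P)" and h_surj: "val h ` E P = CC Y"
  using h unfolding zf_bij_iff by blast+

lemma h_surj_obtain: "g \<in> CC Y \<Longrightarrow> \<exists>f\<in>E P. val h f = g"
  unfolding h_surj[symmetric] by blast

lemma h_C: "f \<in> E P \<Longrightarrow> val h f \<in> CC Y"
  using val_in[OF h_fun] .

abbreviation H :: "'v \<Rightarrow> 'v \<Rightarrow> 'v" where "H f y \<equiv> val (val h f) y"

lemma H_in: "f \<in> E P \<Longrightarrow> y \<in> pts Y \<Longrightarrow> H f y \<in> R"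
  using C_val[OF h_C] .

lemma H_add:
  assumes "f \<in> E P" "g \<in> E P" "k \<in> E P" "\<And>x. x \<in> pts X \<Longrightarrow> val k x = val f x \<oplus> val g x" "y \<in> pts Y"
  shows "H k y = H f y \<oplus> H g y"
proof -
  have "zf_is_sum mem \<R> X f g k"
    unfolding zf_is_sum_def using assms(1-4) zf_app_eq_val[OF P_fun] zf_plus_eq P_val by simp
  then have "zf_is_sum mem \<R> Y (val h f) (val h g) (val h k)"
    using hom[OF assms(1-3)] zf_app_eq_val[OF h_fun] assms(1-3) by simp
  then show ?thesis
    unfolding zf_is_sum_def using assms zf_app_eq_val[OF C_fun[OF h_C]] zf_plus_eq H_in by simp
qed

lemma H_mult:
  assumes "f \<in> E P" "g \<in> E P" "k \<in> E P" "\<And>x. x \<in> pts X \<Longrightarrow> val k x = val f x \<otimes> val g x" "y \<in> pts Y"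
  shows "H k y = H f y \<otimes> H g y"
proof -
  have "zf_is_product mem \<R> X f g k"
    unfolding zf_is_product_def using assms(1-4) zf_app_eq_val[OF P_fun] zf_times_eq P_val by simp
  then have "zf_is_product mem \<R> Y (val h f) (val h g) (val h k)"
    using hom[OF assms(1-3)] zf_app_eq_val[OF h_fun] assms(1-3) by simp
  then show ?thesis
    unfolding zf_is_product_def using assms zf_app_eq_val[OF C_fun[OF h_C]] zf_times_eq H_in by simp
qed

lemma H_cong:
  assumes "f \<in> E P" "g \<in> E P" "\<And>x. x \<in> pts X \<Longrightarrow> val f x = val g x"
  shows "f = g"
  using fun_eqI[OF P_fun[OF assms(1)] P_fun[OF assms(2)]] assms(3) by blast

text \<open>The value at \<open>y\<close> is its own double.\<close>

lemma H_zero: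
  assumes "f \<in> E P" "\<And>x. x \<in> pts X \<Longrightarrow> val f x = \<zero>" "y \<in> pts Y"
  shows "H f y = \<zero>"
proof -
  have "H f y = H f y \<oplus> H f y"
    by (rule H_add) (use assms in auto)
  then have "H f y \<oplus> H f y = \<zero> \<oplus> H f y" using H_in[OF assms(1,3)] by simp
  then show ?thesis by (rule radd_cancel) (use H_in[OF assms(1,3)] in auto)
qed

text \<open>By surjectivity some member of the ring is mapped to the constant 1; the image of the unit of the ring acts
on it as a unit.\<close>

lemma H_one:
  assumes f: "f \<in> E P" and one: "\<And>x. x \<in> pts X \<Longrightarrow> val f x = \<one>" and y: "y \<in> pts Y"
  shows "H f y = \<one>"
proof -
  obtain q where q: "q \<in> CC Y" "\<forall>y\<in>pts Y. val q y = \<one>" using C_const[OF Y one_in] by blast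
  then obtain p where p: "p \<in> E P" "val h p = q" using h_surj_obtain by blast
  have "H p y = H p y \<otimes> H f y"
    by (rule H_mult) (use f p one y P_val in auto)
  then show ?thesis using p(2) q(2) y H_in[OF f y] by simp
qed

abbreviation zc :: "'v \<Rightarrow> bool" where "zc A \<equiv> clp Z (E A)"

lemma Z_top: "top Z" and Z_compact: "zf_compact mem Z" and Z_zero_dim: "zf_zero_dimensional mem Z"
  and Z_T1: "zf_T1 mem Z" and b_embedding: "zf_embedding mem X Z b"
  and b_dense: "zf_dense mem Z (zf_image mem b (zf_pts X))"
  and Z_extends: "\<And>K. top K \<Longrightarrow> zf_compact mem K \<Longrightarrow> zf_zero_dimensional mem K \<Longrightarrow> zf_T1 mem K \<Longrightarrow> zf_extends_to mem X Z b K"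
  using Z unfolding zf_Banaschewski_def zf_compactification_def by blast+

lemma b_continuous: "zf_continuous mem X Z b"
  by (rule embedding_continuous[OF b_embedding])

lemma b_fun: "fn (zf_pts X) (zf_pts Z) b"
  using b_continuous unfolding zf_continuous_iff by blast

lemma zc_obtain:
  assumes "clp Z U" shows "\<exists>A. E A = U \<and> zc A"
  using clp_setlike[OF assms] assms unfolding setlike_def by blast

text \<open>The member of the ring that is 1 on the trace of \<open>A\<close> on \<open>X\<close> and 0 elsewhere.\<close>

definition trace_chi :: "'v \<Rightarrow> 'v \<Rightarrow> bool" where
  "trace_chi A c \<longleftrightarrow> c \<in> E P \<and> (\<forall>x\<in>pts X. val c x = chi (E A) (val b x))"

lemma trace_chi_exists:
  assumes "zc A" shows "\<exists>c. trace_chi A c"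
proof -
  let ?B = "{x \<in> pts X. val b x \<in> E A}"
  have pre: "opn X {x \<in> pts X. val b x \<in> V}" if "opn Z V" for V
    using b_continuous that unfolding zf_continuous_iff by blast
  have "pts X - ?B = {x \<in> pts X. val b x \<in> pts Z - E A}" using val_in[OF b_fun] by blast
  moreover have "opn X {x \<in> pts X. val b x \<in> pts Z - E A}"
    by (rule pre) (use assms in \<open>simp add: clp_def\<close>)
  moreover have o: "opn X ?B" by (rule pre) (use assms in \<open>simp add: clp_def\<close>)
  ultimately have "clp X ?B" unfolding clp_def by (simp only: simp_thms)
  moreover obtain B where "E B = ?B" using opn_setlike[OF o] unfolding setlike_def by blast
  ultimately have B: "E B = ?B" "clp X (E B)" by (simp_all only:)
  obtain c where c: "c \<in> E P" "\<forall>x\<in>pts X. val c x = chi (E B) x" using P_chi[OF B(2)] by blast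
  have "val c x = chi (E A) (val b x)" if "x \<in> pts X" for x
    using c(2) that unfolding chi_def B(1) by simp
  then show ?thesis using c(1) unfolding trace_chi_def by blast
qed

lemma trace_chi_unique: "trace_chi A c \<Longrightarrow> trace_chi A d \<Longrightarrow> c = d"
  unfolding trace_chi_def using H_cong[of c d] by simp

text \<open>For fixed \<open>y\<close> this is the ultrafilter of clopen sets of \<open>Z\<close> that converges to the image of \<open>y\<close>.\<close>

definition holds :: "'v \<Rightarrow> 'v \<Rightarrow> bool" where
  "holds A y \<longleftrightarrow> (\<exists>c. trace_chi A c \<and> H c y \<noteq> \<zero>)"

lemma dfn_holds: "tm t \<Longrightarrow> tm u \<Longrightarrow> df (\<lambda>s. holds (t s) (u s))"
  unfolding holds_def trace_chi_def by (intro definability trm_chi trm_weaken)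

lemma holds_iff: "trace_chi A c \<Longrightarrow> holds A y \<longleftrightarrow> H c y \<noteq> \<zero>"
  unfolding holds_def using trace_chi_unique[of A _ c] by metis

lemma trace_chi_cases:
  assumes c: "trace_chi A c" and y: "y \<in> pts Y"
  shows "H c y = \<zero> \<or> H c y = \<one>"
proof (rule idempotent_cases)
  have cP: "c \<in> E P" using c unfolding trace_chi_def by blast
  show "H c y \<in> R" by (rule H_in[OF cP y])
  have "H c y = H c y \<otimes> H c y"
  proof (rule H_mult[OF cP cP cP _ y])
    fix x assume "x \<in> pts X"
    then show "val c x = val c x \<otimes> val c x" using c unfolding trace_chi_def chi_def by simp
  qed
  then show "H c y \<otimes> H c y = H c y" by (rule sym)
qed

lemma holds_iff_one: "trace_chi A c \<Longrightarrow> y \<in> pts Y \<Longrightarrow> holds A y \<longleftrightarrow> H c y = \<one>"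
  using holds_iff[of A c y] trace_chi_cases[of A c y] zero_neq_one by auto

text \<open>The characteristic functions of \<open>A\<close> and of its complement add up to 1, and \<open>h\<close> maps them to functions with
values 0 and 1.\<close>

lemma holds_compl:
  assumes "zc A" "E A' = pts Z - E A" "y \<in> pts Y"
  shows "holds A' y \<longleftrightarrow> \<not> holds A y"
proof -
  have A': "zc A'" using clp_compl[OF Z_top assms(1)] assms(2) by simp
  obtain c where c: "trace_chi A c" using trace_chi_exists[OF assms(1)] by blast
  obtain d where d: "trace_chi A' d" using trace_chi_exists[OF A'] by blast
  have PP: "c \<in> E P" "d \<in> E P" using c d unfolding trace_chi_def by blast+
  have "clp X (pts X)" by (rule clp_pts[OF X])
  then obtain u where u: "u \<in> E P" "\<forall>x\<in>pts X. val u x = chi (pts X) x" using P_chi[of "zf_pts X"] by blast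
  then have u1: "val u x = \<one>" if "x \<in> pts X" for x using that unfolding chi_def by simp
  have "H u y = H c y \<oplus> H d y"
  proof (rule H_add[OF PP u(1) _ assms(3)])
    fix x assume x: "x \<in> pts X"
    then have "val b x \<in> pts Z" by (rule val_in[OF b_fun])
    then show "val u x = val c x \<oplus> val d x"
      using c d x u1 assms(2) unfolding trace_chi_def chi_def by simp
  qed
  then have s: "H c y \<oplus> H d y = \<one>" using H_one[OF u(1) u1 assms(3)] by simp
  have R: "H c y \<in> R" "H d y \<in> R" using H_in PP assms(3) by auto
  show ?thesis
  proof (cases "H c y = \<zero>")
    case True
    then show ?thesis using s R holds_iff[OF c] holds_iff[OF d] zero_neq_one by simp
  next
    case False
    then have "H c y = \<one>" using trace_chi_cases[OF c assms(3)] by blast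
    then have "H d y \<oplus> \<one> = \<zero> \<oplus> \<one>" using s R radd_commute[of "H d y" \<one>] by simp
    then have "H d y = \<zero>" by (rule radd_cancel) (use R in auto)
    then show ?thesis using False holds_iff[OF c] holds_iff[OF d] by simp
  qed
qed

text \<open>The characteristic function of an intersection is a product, and the reals have no zero divisors.\<close>

lemma holds_Int:
  assumes "zc A" "zc B" "E D = E A \<inter> E B" "y \<in> pts Y"
  shows "holds D y \<longleftrightarrow> holds A y \<and> holds B y"
proof -
  have D: "zc D" unfolding assms(3) by (rule clp_Int[OF Z_top assms(1,2)])
  obtain a where a: "trace_chi A a" using trace_chi_exists[OF assms(1)] by blast
  obtain c where c: "trace_chi B c" using trace_chi_exists[OF assms(2)] by blast
  obtain d where d: "trace_chi D d" using trace_chi_exists[OF D] by blast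
  have PP: "a \<in> E P" "c \<in> E P" "d \<in> E P" using a c d unfolding trace_chi_def by blast+
  have m: "H d y = H a y \<otimes> H c y"
  proof (rule H_mult[OF PP _ assms(4)])
    fix x assume x: "x \<in> pts X"
    show "val d x = val a x \<otimes> val c x"
      using a c d x assms(3) unfolding trace_chi_def chi_def by simp
  qed
  have R: "H a y \<in> R" "H c y \<in> R" using H_in PP assms(4) by auto
  have "H a y \<otimes> H c y = \<zero> \<longleftrightarrow> H a y = \<zero> \<or> H c y = \<zero>"
    using mul_eq_zero[OF _ R] R by auto
  then show ?thesis unfolding holds_iff[OF a] holds_iff[OF c] holds_iff[OF d] m by blast
qed

lemma holds_pts:
  assumes "y \<in> pts Y" shows "holds (zf_pts Z) y"
proof -
  obtain c where c: "trace_chi (zf_pts Z) c" using trace_chi_exists[of "zf_pts Z"] clp_pts[OF Z_top] by blast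
  have cP: "c \<in> E P" using c unfolding trace_chi_def by blast
  have one: "val c x = \<one>" if "x \<in> pts X" for x
    using c that val_in[OF b_fun that] unfolding trace_chi_def chi_def by simp
  have "H c y = \<one>" by (rule H_one[OF cP one assms])
  then show ?thesis unfolding holds_iff[OF c] using zero_neq_one by simp
qed

lemma holds_Un:
  assumes "zc A" "zc B" "E D = E A \<union> E B" "y \<in> pts Y"
  shows "holds D y \<longleftrightarrow> holds A y \<or> holds B y"
proof -
  have cD: "zc D" unfolding assms(3) by (rule clp_Un[OF Z_top assms(1,2)])
  obtain A' where A': "E A' = pts Z - E A" "zc A'" using zc_obtain[OF clp_compl[OF Z_top assms(1)]] by blast
  obtain B' where B': "E B' = pts Z - E B" "zc B'" using zc_obtain[OF clp_compl[OF Z_top assms(2)]] by blast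
  obtain D' where D': "E D' = pts Z - E D" "zc D'" using zc_obtain[OF clp_compl[OF Z_top cD]] by blast
  have "E D' = E A' \<inter> E B'" unfolding D'(1) A'(1) B'(1) assms(3) by blast
  then have "holds D' y \<longleftrightarrow> holds A' y \<and> holds B' y" by (rule holds_Int[OF A'(2) B'(2) _ assms(4)])
  then show ?thesis
    using holds_compl[OF assms(1) A'(1) assms(4)] holds_compl[OF assms(2) B'(1) assms(4)] holds_compl[OF cD D'(1) assms(4)] by blast
qed

text \<open>Otherwise \<open>h\<close> would identify the characteristic function of a nonempty trace with 0.  The trace is nonempty
because \<open>X\<close> is dense in \<open>Z\<close>.\<close>

lemma holds_nonempty:
  assumes A: "zc A" and ne: "E A \<noteq> {}"
  shows "\<exists>y\<in>pts Y. holds A y"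
proof (rule ccontr)
  assume no: "\<not> (\<exists>y\<in>pts Y. holds A y)"
  obtain c where c: "trace_chi A c" using trace_chi_exists[OF A] by blast
  obtain d where d: "d \<in> E P" "\<forall>x\<in>pts X. val d x = chi {} x" using P_chi[of emp] clp_empty[OF X] by auto
  have cP: "c \<in> E P" using c unfolding trace_chi_def by blast
  have d0: "val d x = \<zero>" if "x \<in> pts X" for x using d(2) that unfolding chi_def by simp
  have "val h c = val h d"
  proof (rule fun_eqI[OF C_fun[OF h_C[OF cP]] C_fun[OF h_C[OF d(1)]]])
    fix y assume y: "y \<in> pts Y"
    then have "H c y = \<zero>" using no holds_iff[OF c] by blast
    then show "H c y = H d y" using H_zero[OF d(1) d0 y] by simp
  qed
  then have "c = d" using inj_onD[OF h_inj _ cP d(1)] by blast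
  have "opn Z (E A)" using A unfolding clp_def by blast
  then obtain x where x: "x \<in> pts X" "val b x \<in> E A"
    using b_dense ne unfolding dense_iff[OF b_fun] by blast
  have "val c x = \<one>" using c x unfolding trace_chi_def chi_def by simp
  then show False using d0[OF x(1)] \<open>c = d\<close> zero_neq_one by simp
qed

text \<open>The clopen sets outside the ultrafilter are directed.  If they covered \<open>Z\<close>, then \<open>Z\<close> itself would be one of
them by compactness; so some point lies only in clopen sets of the ultrafilter.  Two such points would be
separated by a clopen set and its complement, which cannot both be in it.\<close>

lemma point_exists:
  assumes y: "y \<in> pts Y"
  shows "\<exists>!z. z \<in> pts Z \<and> (\<forall>A. zc A \<longrightarrow> z \<in> E A \<longrightarrow> holds A y)"
proof -
  have "setlike {a \<in> E (zf_opens Z). zc a \<and> \<not> holds a y}"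
    by (rule setlike_sep, intro definability dfn_clp dfn_holds)
  then obtain C where C: "E C = {a \<in> E (zf_opens Z). zc a \<and> \<not> holds a y}" unfolding setlike_def by blast
  have inC: "a \<in> E C \<longleftrightarrow> zc a \<and> \<not> holds a y" for a unfolding C clp_def by auto
  have "\<exists>z\<in>pts Z. \<forall>u\<in>E C. z \<notin> E u"
  proof (rule ccontr)
    assume no: "\<not> ?thesis"
    have "\<exists>u\<in>E C. E u = pts Z"
    proof (rule compact_directed[OF Z_compact _ _ Z_top])
      show "E C \<subseteq> E (zf_opens Z)" unfolding C by blast
      have "\<not> holds emp y"
        using holds_compl[of emp "zf_pts Z" y] holds_pts[OF y] clp_empty[OF Z_top] y by simp
      then have "emp \<in> E C" unfolding inC using clp_empty[OF Z_top] by simp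
      then show "E C \<noteq> {}" by blast
      show "\<exists>u\<in>E C. x \<in> E u" if "x \<in> pts Z" for x using no that by blast
      fix u v assume uv: "u \<in> E C" "v \<in> E C"
      then obtain w where w: "E w = E u \<union> E v" "zc w" using zc_obtain[OF clp_Un[OF Z_top]] unfolding inC by blast
      have "w \<in> E C" using holds_Un[OF _ _ w(1) y] uv w(2) unfolding inC by blast
      then show "\<exists>w\<in>E C. E u \<union> E v \<subseteq> E w" using w(1) by blast
    qed
    then obtain u where u: "u \<in> E C" "E u = pts Z" by blast
    have "u = zf_pts Z" using u(2) elts_inject[of u "zf_pts Z"] by blast
    then show False using u(1) holds_pts[OF y] unfolding inC by blast
  qed
  then obtain z where zZ: "z \<in> pts Z" and zC: "\<forall>u\<in>E C. z \<notin> E u" by blast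
  have z: "z \<in> pts Z" "\<And>u. zc u \<Longrightarrow> z \<in> E u \<Longrightarrow> holds u y"
    using zZ zC inC by blast+
  have uniq: "w = z" if w: "w \<in> pts Z" "\<And>u. zc u \<Longrightarrow> w \<in> E u \<Longrightarrow> holds u y" for w
  proof (rule ccontr)
    assume "w \<noteq> z"
    then obtain V where "V \<in> E (zf_opens Z)" "w \<in> E V" "z \<notin> E V" using Z_T1 w(1) z(1) unfolding zf_T1_def by blast
    then obtain A where A: "zc A" "w \<in> E A" "z \<notin> E A"
      using zero_dim_nbhd[OF Z_top Z_zero_dim, of "E V" w] by auto
    obtain A' where A': "E A' = pts Z - E A" "zc A'" using zc_obtain[OF clp_compl[OF Z_top A(1)]] by blast
    have "holds A y" by (rule w(2)[OF A(1,2)])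
    moreover have "holds A' y" by (rule z(2)[OF A'(2)]) (use A'(1) A(3) z(1) in blast)
    ultimately show False using holds_compl[OF A(1) A'(1) y] by blast
  qed
  show ?thesis
  proof (rule ex1I[of _ z])
    show "z \<in> pts Z \<and> (\<forall>A. zc A \<longrightarrow> z \<in> E A \<longrightarrow> holds A y)" using z by blast
    show "w = z" if "w \<in> pts Z \<and> (\<forall>A. zc A \<longrightarrow> w \<in> E A \<longrightarrow> holds A y)" for w
      by (rule uniq) (use that in blast)+
  qed
qed

text \<open>The map that sends \<open>y\<close> to the limit of its ultrafilter.\<close>

definition rep :: "'v \<Rightarrow> bool" where
  "rep t \<longleftrightarrow> fn (zf_pts Y) (zf_pts Z) t \<and> (\<forall>y\<in>pts Y. \<forall>A. zc A \<longrightarrow> (val t y \<in> E A \<longleftrightarrow> holds A y))"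

lemma rep_exists: "\<exists>t. rep t"
proof -
  have "\<exists>t. fn (zf_pts Y) (zf_pts Z) t \<and> (\<forall>y\<in>pts Y. val t y \<in> pts Z \<and> (\<forall>A. zc A \<longrightarrow> val t y \<in> E A \<longrightarrow> holds A y))"
  proof (rule fun_existsI)
    show "df (\<lambda>s. \<forall>A. zc A \<longrightarrow> s (Suc 0) \<in> E A \<longrightarrow> holds A (s 0))"
      by (intro definability dfn_clp dfn_holds)
  qed (rule point_exists)
  then obtain t where t: "fn (zf_pts Y) (zf_pts Z) t" "\<And>y A. y \<in> pts Y \<Longrightarrow> zc A \<Longrightarrow> val t y \<in> E A \<Longrightarrow> holds A y" by blast
  have "val t y \<in> E A" if y: "y \<in> pts Y" and A: "zc A" and hA: "holds A y" for y A
  proof (rule ccontr)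
    assume n: "val t y \<notin> E A"
    obtain A' where A': "E A' = pts Z - E A" "zc A'" using zc_obtain[OF clp_compl[OF Z_top A]] by blast
    have "holds A' y" using t(2)[OF y A'(2)] A'(1) n val_in[OF t(1) y] by blast
    then show False using holds_compl[OF A A'(1) y] hA by blast
  qed
  then show ?thesis unfolding rep_def using t by blast
qed

text \<open>With \<open>g = 1 / max q f\<close>, the product \<open>k = g f\<close> belongs to the ring by \<open>inv_max_mult\<close> and is 1 on the trace of
\<open>A\<close>.  Hence \<open>k\<close> times the characteristic function \<open>c\<close> of the trace is \<open>c\<close>.  Where the image of \<open>c\<close> is 1, so is that
of \<open>k\<close>, and \<open>f\<close> divides \<open>k\<close>.  All products that occur are members of the ring, as they must be for \<open>h\<close> to respect them.\<close>

lemma nonvanishing: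
  assumes f: "f \<in> E P" and A: "zc A" and q: "q \<in> R" "\<zero> \<sqsubset> q"
    and le: "\<And>x. x \<in> pts X \<Longrightarrow> val b x \<in> E A \<Longrightarrow> q \<sqsubseteq> val f x"
    and y: "y \<in> pts Y" "holds A y"
  shows "H f y \<noteq> \<zero>"
proof
  assume 0: "H f y = \<zero>"
  have qi: "rinv q \<in> R" "\<zero> \<sqsubset> rinv q" using q rinv_in inv_pos pos_neq_zero by auto
  obtain g where g: "g \<in> E P" "\<forall>x\<in>pts X. val g x = rinv (rmax q (val f x))"
    using P_unif[OF f unif_inv_max[OF q]] by blast
  obtain l where l: "l \<in> E P" "\<forall>x\<in>pts X. val l x = rinv q \<otimes> val f x"
    using P_unif[OF f unif_scale[OF qi]] by blast
  obtain k where k: "k \<in> E P" "\<forall>x\<in>pts X. val k x = rmin \<one> (val l x)"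
    using P_unif[OF l(1) unif_min[OF one_in]] by blast
  have kx: "val k x = val g x \<otimes> val f x" if "x \<in> pts X" for x
    using k(2) l(2) g(2) inv_max_mult[OF q P_val[OF f that]] that by simp
  obtain c where c: "trace_chi A c" using trace_chi_exists[OF A] by blast
  have cP: "c \<in> E P" using c unfolding trace_chi_def by blast
  have kc: "H c y = H k y \<otimes> H c y"
  proof (rule H_mult[OF k(1) cP cP _ y(1)])
    fix x assume x: "x \<in> pts X"
    show "val c x = val k x \<otimes> val c x"
    proof (cases "val b x \<in> E A")
      case True
      then have "q \<sqsubseteq> val f x" using le x by blast
      then have "\<zero> \<sqsubset> val f x" "rmax q (val f x) = val f x"
        using lt_le_trans[of \<zero> q "val f x"] q P_val[OF f x] unfolding rmax_def by auto
      then have "val k x = \<one>"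
        using kx[OF x] g(2) x rmul_inv[of "val f x"] rinv_in[of "val f x"] pos_neq_zero rmul_commute P_val[OF f x] by simp
      then show ?thesis using P_val[OF cP x] by simp
    next
      case False
      then have "val c x = \<zero>" using c x unfolding trace_chi_def chi_def by simp
      then show ?thesis using P_val[OF k(1) x] by simp
    qed
  qed
  have c1: "H c y = \<one>" using holds_iff_one[OF c y(1)] y(2) by blast
  have "H k y = H g y \<otimes> H f y" by (rule H_mult[OF g(1) f k(1) kx y(1)])
  then have "H k y = \<zero>" using 0 H_in[OF g(1) y(1)] by simp
  then have "\<one> = \<zero> \<otimes> \<one>" using kc unfolding c1 by simp
  then show False using zero_neq_one by simp
qed

text \<open>The clopen set on which the preimage \<open>f\<close> of \<open>g\<close> is bounded away from 0, or its complement, on which \<open>1 - f\<close> is,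
contains \<open>z\<close> after extension to \<open>Z\<close>.\<close>

lemma separating_clopen:
  assumes t: "rep t" and g: "g \<in> CC Y" and z: "z \<in> pts Z"
  shows "\<exists>A. zc A \<and> z \<in> E A \<and>
    ((\<forall>y\<in>pts Y. val t y \<in> E A \<longrightarrow> val g y \<noteq> \<zero>) \<or> (\<forall>y\<in>pts Y. val t y \<in> E A \<longrightarrow> val g y \<noteq> \<one>))"
proof -
  obtain f where f: "f \<in> E P" "val h f = g" using h_surj_obtain[OF g] by blast
  obtain C q where q: "q \<in> R" "\<zero> \<sqsubset> q" and C: "clp X (E C)" "\<forall>x\<in>E C. q \<sqsubseteq> val f x"
    "\<forall>x\<in>pts X - E C. q \<sqsubseteq> \<one> \<oplus> rneg (val f x)"
    using U_separation[OF X P_U[OF f(1)]] by blast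
  obtain A where A: "zc A" "\<forall>x\<in>pts X. val b x \<in> E A \<longleftrightarrow> x \<in> E C"
    using clopen_extends[OF X Z_top b_fun Z_extends[OF top_two compact_two zero_dimensional_two T1_two] C(1)] by blast
  show ?thesis
  proof (cases "z \<in> E A")
    case True
    have "val g y \<noteq> \<zero>" if y: "y \<in> pts Y" "val t y \<in> E A" for y
    proof -
      have "holds A y" using t y A(1) unfolding rep_def by blast
      then show ?thesis using nonvanishing[OF f(1) A(1) q _ y(1)] C(2) A(2) f(2) by blast
    qed
    then have "\<forall>y\<in>pts Y. val t y \<in> E A \<longrightarrow> val g y \<noteq> \<zero>" by (intro ballI impI)
    then show ?thesis using A(1) True by (intro exI[of _ A] conjI disjI1)
  next
    case False
    obtain A' where A': "E A' = pts Z - E A" "zc A'" using zc_obtain[OF clp_compl[OF Z_top A(1)]] by blast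
    obtain f' where f': "f' \<in> E P" "\<forall>x\<in>pts X. val f' x = \<one> \<oplus> rneg (val f x)"
      using P_unif[OF f(1) unif_reflect[OF one_in]] by blast
    obtain u where u: "u \<in> E P" "\<forall>x\<in>pts X. val u x = chi (pts X) x" using P_chi[of "zf_pts X"] clp_pts[OF X] by blast
    have u1: "val u x = \<one>" if "x \<in> pts X" for x using u(2) that unfolding chi_def by simp
    have "val g y \<noteq> \<one>" if y: "y \<in> pts Y" "val t y \<in> E A'" for y
    proof
      assume g1: "val g y = \<one>"
      have "holds A' y" using t y A'(2) unfolding rep_def by blast
      then have n: "H f' y \<noteq> \<zero>"
      proof (rule nonvanishing[OF f'(1) A'(2) q _ y(1), rotated])
        fix x assume x: "x \<in> pts X" "val b x \<in> E A'"
        then have "x \<in> pts X - E C" using A(2) A'(1) by blast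
        then show "q \<sqsubseteq> val f' x" using C(3) f'(2) x(1) by simp
      qed
      have "H u y = H f y \<oplus> H f' y"
      proof (rule H_add[OF f(1) f'(1) u(1) _ y(1)])
        fix x assume x: "x \<in> pts X"
        then show "val u x = val f x \<oplus> val f' x"
          using u1 f'(2) radd_left_commute[of "val f x" \<one> "rneg (val f x)"] P_val[OF f(1) x] by simp
      qed
      then have "H f' y \<oplus> \<one> = \<zero> \<oplus> \<one>"
        using H_one[OF u(1) u1 y(1)] f(2) g1 H_in[OF f'(1) y(1)] radd_commute[of "H f' y" \<one>] by simp
      then have "H f' y = \<zero>" by (rule radd_cancel) (use H_in[OF f'(1) y(1)] in auto)
      with n show False by blast
    qed
    then have "\<forall>y\<in>pts Y. val t y \<in> E A' \<longrightarrow> val g y \<noteq> \<one>" by (intro ballI impI)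
    moreover have "z \<in> E A'" unfolding A'(1) using False z by blast
    ultimately show ?thesis using A'(2) by (intro exI[of _ A'] conjI disjI2)
  qed
qed

lemma rep_continuous:
  assumes t: "rep t" shows "zf_continuous mem Y Z t"
proof -
  have tf: "fn (zf_pts Y) (zf_pts Z) t" using t unfolding rep_def by blast
  have "opn Y {y \<in> pts Y. val t y \<in> V}" if V: "opn Z V" for V
  proof (rule opn_nbhd[OF Y])
    obtain v where "E v = V" using V unfolding opn_def by blast
    then show "setlike {y \<in> pts Y. val t y \<in> V}" using setlike_preimage[of "zf_pts Y" t v] by simp
    fix y assume "y \<in> {y \<in> pts Y. val t y \<in> V}"
    then have y: "y \<in> pts Y" "val t y \<in> V" by auto
    obtain A where A: "zc A" "val t y \<in> E A" "E A \<subseteq> V" using zero_dim_nbhd[OF Z_top Z_zero_dim V y(2)] by blast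
    obtain c where c: "trace_chi A c" using trace_chi_exists[OF A(1)] by blast
    have cP: "c \<in> E P" using c unfolding trace_chi_def by blast
    have iff: "val t y' \<in> E A \<longleftrightarrow> H c y' = \<one>" if "y' \<in> pts Y" for y'
      using t A(1) that holds_iff_one[OF c that] unfolding rep_def by blast
    let ?N = "{y \<in> pts Y. \<zero> \<sqsubset> H c y}"
    have "opn Y ?N" by (rule opn_rays(2)[OF h_C[OF cP] zero_in])
    moreover have "y \<in> ?N" using iff[OF y(1)] A(2) y(1) one_pos by simp
    moreover have "?N \<subseteq> {y \<in> pts Y. val t y \<in> V}"
    proof
      fix y' assume y': "y' \<in> ?N"
      then have "H c y' \<noteq> \<zero>" using pos_neq_zero by blast
      then have "H c y' = \<one>" using trace_chi_cases[OF c] y' by blast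
      then show "y' \<in> {y \<in> pts Y. val t y \<in> V}" using iff y' A(3) by blast
    qed
    ultimately show "\<exists>U. opn Y U \<and> y \<in> U \<and> U \<subseteq> {y \<in> pts Y. val t y \<in> V}" by blast
  qed
  then show ?thesis unfolding zf_continuous_iff using tf by blast
qed

lemma rep_dense:
  assumes t: "rep t" and U: "opn Z U" "U \<noteq> {}"
  shows "\<exists>y\<in>pts Y. val t y \<in> U"
proof -
  obtain z where z: "z \<in> U" using U(2) by blast
  obtain A where A: "zc A" "z \<in> E A" "E A \<subseteq> U" using zero_dim_nbhd[OF Z_top Z_zero_dim U(1) z] by blast
  then obtain y where "y \<in> pts Y" "holds A y" using holds_nonempty by blast
  then have "val t y \<in> E A" using t A(1) unfolding rep_def by blast
  then show ?thesis using A(3) \<open>y \<in> pts Y\<close> by blast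
qed

text \<open>For a function \<open>g\<close> that is 0 at \<open>y\<close> and 1 off \<open>W\<close>, a clopen neighbourhood of \<open>t y\<close> as in
\<open>separating_clopen\<close> cannot omit the value 0; so it omits 1, and its preimage lies in \<open>W\<close>.\<close>

lemma rep_embedding:
  assumes t: "rep t" shows "zf_embedding mem Y Z t"
proof (rule embeddingI[OF Z_top _ rep_continuous[OF t]])
  show "zf_T1 mem Y" using YT unfolding zf_Tychonoff_def by blast
  have tf: "fn (zf_pts Y) (zf_pts Z) t" using t unfolding rep_def by blast
  fix W y assume W: "opn Y W" "y \<in> W"
  have y: "y \<in> pts Y" using opn_subset[OF Y W(1)] W(2) by blast
  obtain g N N' where g: "g \<in> CC Y" "y \<in> N" "pts Y - W \<subseteq> N'" "\<forall>y\<in>N. val g y = \<zero>" "\<forall>y\<in>N'. val g y = \<one>"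
    using Tychonoff_separation[OF Y YT W] by blast
  obtain A where A: "zc A" "val t y \<in> E A" 
    "(\<forall>y\<in>pts Y. val t y \<in> E A \<longrightarrow> val g y \<noteq> \<zero>) \<or> (\<forall>y\<in>pts Y. val t y \<in> E A \<longrightarrow> val g y \<noteq> \<one>)"
    using separating_clopen[OF t g(1) val_in[OF tf y]] by blast
  have "\<forall>y\<in>pts Y. val t y \<in> E A \<longrightarrow> val g y \<noteq> \<one>" using A(2,3) y g(2,4) by blast
  then have "\<forall>y'\<in>pts Y. val t y' \<in> E A \<longrightarrow> y' \<in> W" using g(3,5) by blast
  moreover have "opn Z (E A)" using A(1) unfolding clp_def by blast
  ultimately show "\<exists>U. opn Z U \<and> val t y \<in> U \<and> (\<forall>y\<in>pts Y. val t y \<in> U \<longrightarrow> y \<in> W)" using A(2) by blast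
qed

text \<open>The open sets of \<open>K\<close> that miss the image under \<open>f\<close> of the trace of some clopen neighbourhood of \<open>z\<close>.  The
complement of their union is the set of cluster points of \<open>f\<close> at \<open>z\<close>.\<close>

definition avoids :: "'v \<Rightarrow> 'v zf_space \<Rightarrow> 'v \<Rightarrow> 'v \<Rightarrow> 'v \<Rightarrow> bool" where
  "avoids t K f z u \<longleftrightarrow> u \<in> E (zf_opens K) \<and>
    (\<exists>A. zc A \<and> z \<in> E A \<and> (\<forall>y\<in>pts Y. val t y \<in> E A \<longrightarrow> val f y \<notin> E u))"

text \<open>The open sets that \<open>f\<close> avoids near \<open>z\<close> are directed.  By compactness, if they cover \<open>K\<close> together with an open
set \<open>V\<close>, then one of them does so (\<open>covers\<close>).  For empty \<open>V\<close> this is impossible, as the image of \<open>t\<close> is dense; so there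
is a cluster point, and by \<open>separating_clopen\<close> there is only one.  For a neighbourhood \<open>V\<close> of the
cluster point it gives continuity: the avoided set that remains is also avoided near all points of the
same clopen neighbourhood of \<open>z\<close>, whose cluster points therefore lie in \<open>V\<close>.\<close>

lemma rep_extension:
  assumes t: "rep t" and K: "top K" "zf_compact mem K" "zf_Tychonoff mem \<R> K"
    and f: "zf_continuous mem Y K f"
  shows "\<exists>g. zf_continuous mem Z K g \<and> (\<forall>y\<in>pts Y. val g (val t y) = val f y)"
proof -
  have tf: "fn (zf_pts Y) (zf_pts Z) t" using t unfolding rep_def by blast
  have ff: "fn (zf_pts Y) (zf_pts K) f" using f unfolding zf_continuous_iff by blast
  let ?avoid = "avoids t K f"
  have covers: "\<exists>u. ?avoid z u \<and> E u \<union> V = pts K"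
    if z: "z \<in> pts Z" and V: "opn K V" and cov: "\<And>k. k \<in> pts K \<Longrightarrow> k \<notin> V \<Longrightarrow> \<exists>u. ?avoid z u \<and> k \<in> E u" for z V
  proof -
    obtain v where v: "E v = V" using V unfolding opn_def by blast
    have "setlike {w \<in> E (zf_opens K). \<exists>u. ?avoid z u \<and> (\<forall>k. k \<in> E w \<longleftrightarrow> k \<in> E u \<or> k \<in> E v)}"
      unfolding avoids_def by (rule setlike_sep, intro definability dfn_clp)
    then obtain C where "E C = {w \<in> E (zf_opens K). \<exists>u. ?avoid z u \<and> (\<forall>k. k \<in> E w \<longleftrightarrow> k \<in> E u \<or> k \<in> E v)}"
      unfolding setlike_def by blast
    then have C: "E C = {w \<in> E (zf_opens K). \<exists>u. ?avoid z u \<and> E w = E u \<union> V}"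
      unfolding set_eq_iff Un_iff v .
    have inC: "\<exists>w\<in>E C. E w = E u \<union> V" if u: "?avoid z u" for u
    proof -
      have "opn K (E u \<union> V)" using opn_Un[OF K(1) _ V] u unfolding avoids_def by simp
      then obtain w where "w \<in> E (zf_opens K)" "E w = E u \<union> V" unfolding opn_def by blast
      then show ?thesis unfolding C using u by blast
    qed
    have ne: "?avoid z emp"
      unfolding avoids_def using opn_empty[OF K(1)] opn_elts[of K emp] clp_pts[OF Z_top] z by auto
    have "\<exists>w\<in>E C. E w = pts K"
    proof (rule compact_directed[OF K(2) _ _ K(1)])
      show "E C \<subseteq> E (zf_opens K)" unfolding C by blast
      show "E C \<noteq> {}" using inC[OF ne] by blast
      show "\<exists>w\<in>E C. k \<in> E w" if k: "k \<in> pts K" for k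
      proof (cases "k \<in> V")
        case True then show ?thesis using inC[OF ne] by blast
      next
        case False then show ?thesis using cov[OF k] inC by blast
      qed
      fix w w' assume "w \<in> E C" "w' \<in> E C"
      then obtain u u' where u: "?avoid z u" "E w = E u \<union> V" and u': "?avoid z u'" "E w' = E u' \<union> V" unfolding C by blast
      obtain A where A: "zc A" "z \<in> E A" "\<forall>y\<in>pts Y. val t y \<in> E A \<longrightarrow> val f y \<notin> E u" using u(1) unfolding avoids_def by blast
      obtain A' where A': "zc A'" "z \<in> E A'" "\<forall>y\<in>pts Y. val t y \<in> E A' \<longrightarrow> val f y \<notin> E u'" using u'(1) unfolding avoids_def by blast
      obtain B where B: "E B = E A \<inter> E A'" "zc B" using zc_obtain[OF clp_Int[OF Z_top A(1) A'(1)]] by blast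
      have "opn K (E u \<union> E u')" using opn_Un[OF K(1)] u(1) u'(1) unfolding avoids_def by simp
      then obtain x where x: "x \<in> E (zf_opens K)" "E x = E u \<union> E u'" unfolding opn_def by blast
      have "?avoid z x" unfolding avoids_def using x A A' B by (intro conjI exI[of _ B]) auto
      then obtain w'' where "w'' \<in> E C" "E w'' = E x \<union> V" using inC by blast
      then show "\<exists>w''\<in>E C. E w \<union> E w' \<subseteq> E w''" using u(2) u'(2) x(2) by blast
    qed
    then obtain w where w: "w \<in> E C" "E w = pts K" by blast
    then obtain u where u: "?avoid z u" "E w = E u \<union> V" unfolding C by blast
    then show ?thesis using w(2) by auto
  qed
  have unique: "\<exists>!k. k \<in> pts K \<and> (\<forall>u. ?avoid z u \<longrightarrow> k \<notin> E u)" if z: "z \<in> pts Z" for z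
  proof -
    have ex: "\<exists>k\<in>pts K. \<forall>u. ?avoid z u \<longrightarrow> k \<notin> E u"
    proof (rule ccontr)
      assume "\<not> ?thesis"
      then obtain u where u: "?avoid z u" "E u \<union> {} = pts K" using covers[OF z opn_empty[OF K(1)]] by blast
      then obtain A where A: "zc A" "z \<in> E A" "\<forall>y\<in>pts Y. val t y \<in> E A \<longrightarrow> val f y \<notin> E u"
        unfolding avoids_def by blast
      have "opn Z (E A)" using A(1) unfolding clp_def by blast
      then obtain y where "y \<in> pts Y" "val t y \<in> E A" using rep_dense[OF t] A(2) by blast
      then show False using A(3) u(2) val_in[OF ff] by blast
    qed
    have eq: "k = k'" if k: "k \<in> pts K" "\<forall>u. ?avoid z u \<longrightarrow> k \<notin> E u" and k': "k' \<in> pts K" "\<forall>u. ?avoid z u \<longrightarrow> k' \<notin> E u" for k k'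
    proof (rule ccontr)
      assume "k \<noteq> k'"
      then obtain V where V: "V \<in> E (zf_opens K)" "k \<in> E V" "k' \<notin> E V"
        using K(3) k(1) k'(1) unfolding zf_Tychonoff_def zf_T1_def by blast
      then have oV: "opn K (E V)" by simp
      \<comment> \<open>\<open>p\<close> is 0 near \<open>k\<close> and 1 near \<open>k'\<close>, so avoiding either value avoids one of them\<close>
      obtain p N N' where p: "p \<in> CC K" "opn K N" "opn K N'" "k \<in> N" "pts K - E V \<subseteq> N'"
        "\<forall>y\<in>N. val p y = \<zero>" "\<forall>y\<in>N'. val p y = \<one>"
        using Tychonoff_separation[OF K(1,3) oV V(2)] by blast
      obtain n n' where n: "n \<in> E (zf_opens K)" "E n = N" and n': "n' \<in> E (zf_opens K)" "E n' = N'"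
        using p(2,3) unfolding opn_def by blast
      obtain g where g: "zf_continuous mem Y line g" "\<forall>y\<in>pts Y. val g y = val p (val f y)"
        using continuous_compose[OF f] p(1) unfolding C_iff by blast
      then have "g \<in> CC Y" unfolding C_iff by blast
      then obtain A where A: "zc A" "z \<in> E A" 
        "(\<forall>y\<in>pts Y. val t y \<in> E A \<longrightarrow> val g y \<noteq> \<zero>) \<or> (\<forall>y\<in>pts Y. val t y \<in> E A \<longrightarrow> val g y \<noteq> \<one>)"
        using separating_clopen[OF t _ z] by blast
      from A(3) show False
      proof
        assume a: "\<forall>y\<in>pts Y. val t y \<in> E A \<longrightarrow> val g y \<noteq> \<zero>"
        have "val f y \<notin> E n" if "y \<in> pts Y" "val t y \<in> E A" for y
          using a that g(2) p(6) n(2) by auto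
        then have "?avoid z n" unfolding avoids_def using n(1) A(1,2) by blast
        then show False using k(2) p(4) n(2) by blast
      next
        assume a: "\<forall>y\<in>pts Y. val t y \<in> E A \<longrightarrow> val g y \<noteq> \<one>"
        have "val f y \<notin> E n'" if "y \<in> pts Y" "val t y \<in> E A" for y
          using a that g(2) p(7) n'(2) by auto
        then have "?avoid z n'" unfolding avoids_def using n'(1) A(1,2) by blast
        then have "k' \<notin> N'" using k'(2) n'(2) by blast
        then show False using k'(1) V(3) p(5) by blast
      qed
    qed
    obtain k where k: "k \<in> pts K" "\<forall>u. ?avoid z u \<longrightarrow> k \<notin> E u" using ex by blast
    show ?thesis
    proof (rule ex1I[of _ k])
      show "k \<in> pts K \<and> (\<forall>u. ?avoid z u \<longrightarrow> k \<notin> E u)" using k by blast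
      show "k' = k" if "k' \<in> pts K \<and> (\<forall>u. ?avoid z u \<longrightarrow> k' \<notin> E u)" for k'
        using that by (intro eq k) blast+
    qed
  qed
  have "\<exists>g. fn (zf_pts Z) (zf_pts K) g \<and> (\<forall>z\<in>pts Z. val g z \<in> pts K \<and> (\<forall>u. ?avoid z u \<longrightarrow> val g z \<notin> E u))"
  proof (rule fun_existsI)
    show "df (\<lambda>s. \<forall>u. ?avoid (s 0) u \<longrightarrow> s (Suc 0) \<notin> E u)"
      unfolding avoids_def by (intro definability dfn_clp)
  qed (rule unique)
  then obtain g where g: "fn (zf_pts Z) (zf_pts K) g" "\<And>z u. z \<in> pts Z \<Longrightarrow> ?avoid z u \<Longrightarrow> val g z \<notin> E u" by blast
  have ext: "val g (val t y) = val f y" if y: "y \<in> pts Y" for y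
  proof -
    let ?z = "val t y"
    have z: "?z \<in> pts Z" by (rule val_in[OF tf y])
    have "val f y \<notin> E u" if "?avoid ?z u" for u using that y unfolding avoids_def by blast
    then have 1: "val f y \<in> pts K \<and> (\<forall>u. ?avoid ?z u \<longrightarrow> val f y \<notin> E u)" using val_in[OF ff y] by blast
    have 2: "val g ?z \<in> pts K \<and> (\<forall>u. ?avoid ?z u \<longrightarrow> val g ?z \<notin> E u)" using g(2)[OF z] val_in[OF g(1) z] by blast
    show ?thesis by (rule ex1E[OF unique[OF z]]) (use 1 2 in blast)
  qed
  have "opn Z {z \<in> pts Z. val g z \<in> V}" if V: "opn K V" for V
  proof (rule opn_nbhd[OF Z_top])
    obtain v where "E v = V" using V unfolding opn_def by blast
    then show "setlike {z \<in> pts Z. val g z \<in> V}" using setlike_preimage[of "zf_pts Z" g v] by simp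
    fix z assume "z \<in> {z \<in> pts Z. val g z \<in> V}"
    then have z: "z \<in> pts Z" "val g z \<in> V" by auto
    have "\<exists>u. ?avoid z u \<and> k \<in> E u" if k: "k \<in> pts K" "k \<notin> V" for k
    proof (rule ccontr)
      assume "\<not> ?thesis"
      then have 1: "k \<in> pts K \<and> (\<forall>u. ?avoid z u \<longrightarrow> k \<notin> E u)" using k(1) by blast
      have 2: "val g z \<in> pts K \<and> (\<forall>u. ?avoid z u \<longrightarrow> val g z \<notin> E u)" using g(2)[OF z(1)] val_in[OF g(1) z(1)] by blast
      have "k = val g z" by (rule ex1E[OF unique[OF z(1)]]) (use 1 2 in blast)
      then show False using z(2) k(2) by blast
    qed
    then obtain u where u: "?avoid z u" "E u \<union> V = pts K" using covers[OF z(1) V] by blast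
    then obtain A where A: "zc A" "z \<in> E A" "\<forall>y\<in>pts Y. val t y \<in> E A \<longrightarrow> val f y \<notin> E u"
      unfolding avoids_def by blast
    have "E A \<subseteq> {z \<in> pts Z. val g z \<in> V}"
    proof
      fix z' assume z': "z' \<in> E A"
      then have zZ: "z' \<in> pts Z" using clp_subset[OF Z_top A(1)] by blast
      have "?avoid z' u" using u(1) A z' unfolding avoids_def by blast
      then have "val g z' \<notin> E u" by (rule g(2)[OF zZ])
      then show "z' \<in> {z \<in> pts Z. val g z \<in> V}" using u(2) val_in[OF g(1) zZ] zZ by blast
    qed
    then show "\<exists>U. opn Z U \<and> z \<in> U \<and> U \<subseteq> {z \<in> pts Z. val g z \<in> V}"
      using A(1,2) unfolding clp_def by blast
  qed
  then have "zf_continuous mem Z K g" unfolding zf_continuous_iff using g(1) by blast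
  then show ?thesis using ext by blast
qed

lemma Banaschewski_is_max_Tychonoff:
  "\<exists>t. zf_max_Tychonoff_compactification mem \<R> Y Z t"
proof -
  obtain t where t: "rep t" using rep_exists by blast
  have tf: "fn (zf_pts Y) (zf_pts Z) t" using t unfolding rep_def by blast
  have "zf_compactification mem Y Z t"
    unfolding zf_compactification_def dense_iff[OF tf]
    using Z_top Z_compact rep_embedding[OF t] rep_dense[OF t] by blast
  moreover have "zf_Tychonoff mem \<R> Z" by (rule zero_dimensional_Tychonoff[OF Z_top Z_zero_dim Z_T1])
  moreover have "zf_extends_to mem Y Z t K" if "top K" "zf_compact mem K" "zf_Tychonoff mem \<R> K" for K
    unfolding extends_to_iff[OF tf] using rep_extension[OF t that] by blast
  ultimately show ?thesis unfolding zf_max_Tychonoff_compactification_def by blast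
qed

end

theorem theorem2p29:
  fixes mem :: "'v \<Rightarrow> 'v \<Rightarrow> bool"
    and \<R> :: "'v zf_reals"
    and X Y beta0X :: "'v zf_space"
    and beta0 :: 'v
  assumes "zf_model mem"
    and "zf_complete_ordered_field mem \<R>"
    and "zf_topological mem X" "zf_nonempty mem X" "zf_zero_dimensional mem X" "zf_T1 mem X"
    and "zf_Banaschewski mem X beta0X beta0"
    and "zf_topological mem Y" "zf_nonempty mem Y" "zf_Tychonoff mem \<R> Y"
  shows
    "(zf_ring_isomorphic mem \<R> X (zf_U_bounded mem \<R> X) Y (zf_C mem \<R> Y) \<longrightarrow>
        (\<exists>betaTY betaT. zf_max_Tychonoff_compactification mem \<R> Y betaTY betaT) \<and>
        (\<forall>betaTY betaT. zf_max_Tychonoff_compactification mem \<R> Y betaTY betaT \<longrightarrow>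
          zf_homeomorphic mem beta0X betaTY)) \<and>
     (zf_CMC mem \<longrightarrow>
       (zf_ring_isomorphic mem \<R> X (zf_U mem \<R> X) Y (zf_C mem \<R> Y) \<longrightarrow>
        (\<exists>betaTY betaT. zf_max_Tychonoff_compactification mem \<R> Y betaTY betaT) \<and>
        (\<forall>betaTY betaT. zf_max_Tychonoff_compactification mem \<R> Y betaTY betaT \<longrightarrow>
          zf_homeomorphic mem beta0X betaTY)))"
proof -
  interpret zf_real_model mem \<R>
    using assms(1,2) by (simp add: zf_real_model_def zf_real_model_axioms_def)
  have "(\<exists>W t. zf_max_Tychonoff_compactification mem \<R> Y W t) \<and>
      (\<forall>W t. zf_max_Tychonoff_compactification mem \<R> Y W t \<longrightarrow> zf_homeomorphic mem beta0X W)"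
    if iso: "zf_ring_isomorphic mem \<R> X P Y (zf_C mem \<R> Y)" and P: "P = zf_U mem \<R> X \<or> P = zf_U_bounded mem \<R> X" for P
  proof -
    obtain h where "zf_bij mem P (zf_C mem \<R> Y) h" "\<forall>f\<in>E P. \<forall>g\<in>E P. \<forall>k\<in>E P.
        (zf_is_sum mem \<R> X f g k \<longrightarrow> zf_is_sum mem \<R> Y (zf_app mem h f) (zf_app mem h g) (zf_app mem h k)) \<and>
        (zf_is_product mem \<R> X f g k \<longrightarrow> zf_is_product mem \<R> Y (zf_app mem h f) (zf_app mem h g) (zf_app mem h k))"
      using iso unfolding zf_ring_isomorphic_def by blast
    then interpret function_ring_isomorphism mem \<R> X beta0X Y beta0 P h
      using assms P by unfold_locales auto
    obtain t where t: "zf_max_Tychonoff_compactification mem \<R> Y beta0X t"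
      using Banaschewski_is_max_Tychonoff by blast
    then show ?thesis using max_Tychonoff_compactification_unique[OF assms(8) t] by blast
  qed
  then show ?thesis by blast
qed

end
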